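(* Let $n=n_0+n_1$ with integers $n_0\ge 0$, $n_1\ge 2$. For $\gamma\in\mathbb{C}$ with $\operatorname{Re}\gamma\ge 0$, $$\int_{\mathbb{R}^n}\prod_{n_0+1\le i<j\le n}(x_i-x_j)^2\prod_{1\le i<j\le n}|x_i-x_j|^{2\gamma}\,d\mu=\prod_{i=1}^{n_0}\frac{\Gamma(1+i\gamma)}{\Gamma(1+\gamma)}\prod_{j=1}^{n_1}\frac{j(1+\gamma)\Gamma(j+(n_0+j)\gamma)}{\Gamma(2+\gamma)}.$$
   Context: $d\mu$ is the standard Gaussian measure on $\mathbb{R}^n$: $d\mu=(2\pi)^{-n/2}\prod_{i=1}^n e^{-x_i^2/2}\,dx_1\cdots dx_n$. *)

theory Defs
  imports "HOL-Probability.Probability"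
begin

text \<open>
  The standard Gaussian measure on $n$-dimensional Euclidean space. Points are functions on the
  index set \<open>{1..n}\<close> (with the value \<open>undefined\<close> outside it), so the reference measure
  \<open>dx_1 ... dx_n\<close> is the finite product of \<open>n\<close> copies of Lebesgue measure on the line.
\<close>

definition gaussian_measure :: "nat \<Rightarrow> (nat \<Rightarrow> real) measure" where
  "gaussian_measure n =
     density (\<Pi>\<^sub>M i\<in>{1..n}. lborel)
       (\<lambda>x. ennreal ((2 * pi) powr (- (real n / 2)) * (\<Prod>i=1..n. exp (- (x i)\<^sup>2 / 2))))"

end

theory Submission
  imports Defs "HOL-Complex_Analysis.Complex_Analysis" "HOL-Real_Asymp.Real_Asymp"
begin

text \<open>
  For real \<open>\<gamma> \<ge> 1\<close> write \<open>\<langle>f\<rangle>\<close> for the Gaussian integral of \<open>f\<close> against \<open>\<Prod>|x\<^sub>i - x\<^sub>j|\<^bsup>2\<gamma>\<^esup>\<close>, and let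
  \<open>T\<close> be the Dunkl operator of \<open>y = x\<^sub>a\<close>, where \<open>a\<close> is the first index of the block carrying the extra
  Vandermonde factor \<open>V\<close>. Integration by parts gives \<open>\<langle>y g f\<rangle> = \<langle>(T g) f\<rangle> + \<langle>g T f\<rangle>\<close> for polynomials.
  Since \<open>V\<close> is orthogonal to everything of lower degree, this moves \<open>m\<close> factors \<open>y\<close> onto \<open>V\<close>, where \<open>m + 1\<close>
  is the size of the block, and \<open>\<langle>V\<^sup>2\<rangle> = (m + 1) \<langle>y\<^sup>m V' V\<rangle> = (m + 1) \<langle>V' T\<^sup>m V\<rangle>\<close> with \<open>V'\<close> the Vandermonde factor
  of the block without \<open>a\<close>. Writing \<open>V / V'\<close> as a coefficient of a product of two generating functions,
  on one of which \<open>T\<close> vanishes while it acts on the other as a weighted shift, shows that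
  \<open>T\<^sup>m V = c V'\<close> with an explicit constant \<open>c\<close>. So the extra factor contributes a polynomial in \<open>\<gamma>\<close> times
  Mehta's integral \<open>M(\<gamma>)\<close>.

  If the block consists of all variables, the extra factor raises \<open>\<gamma>\<close> by one, so the result is a functional
  equation for \<open>M\<close>. As \<open>M\<close> is log-convex, the argument of Bohr and Mollerup determines it up to a constant
  factor. The identity theorem and continuity extend the formula to \<open>Re \<gamma> \<ge> 0\<close>, and \<open>M(0) = 1\<close> fixes the
  constant.
\<close>

text \<open>The obstacle is the action of \<open>T\<close> on \<open>vdm B * q\<close>,
  \<open>B\<close> being the block without \<open>a\<close> and \<open>q\<close> symmetric in
  \<open>B\<close>: swaps of \<open>a\<close> with \<open>B\<close> change both factors. Their total
  is nevertheless \<open>vdm B\<close> times an ordinary derivative of \<open>q\<close>, by Lagrange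
  interpolation at the points of \<open>B\<close>, provided the degree is at most
  \<open>card B\<close>. This derivative freezes the symmetric functions of the whole block, while
  the partial derivative in \<open>T\<close> freezes the other variables. On a series with a
  suitable power of \<open>1 - y X\<close> the two contribute \<open>- \<beta>\<close> and
  \<open>\<gamma> * (1 - \<beta>)\<close>, which cancel exactly for
  \<open>\<beta> = \<gamma> / (1 + \<gamma>)\<close>. That is the origin of the exponent in
  \<open>W\<close>; what remains of \<open>V / V'\<close> is \<open>\<Phi>\<close>.

  Each step of the recursion hands \<open>a\<close> over to the variables outside the block. So the
  number of outside variables must be arbitrary, although the functional equation uses only the case
  in which there are none.

  The bound \<open>\<gamma> \<ge> 1\<close> keeps the weight divided by \<open>x a - x j\<close>
  continuous and of polynomial growth, as integration by parts requires. Smaller and complex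
  exponents enter only through analytic continuation.\<close>

unbundle no vec_syntax
hide_const (open) Finite_Cartesian_Product.transpose

section \<open>Lagrange interpolation\<close>

lemma lagrange_basis_degree:
  fixes x :: "'i \<Rightarrow> 'a::field"
  assumes "finite B"
  shows "degree (\<Prod>j\<in>B. [:- x j, 1:]) = card B" "lead_coeff (\<Prod>j\<in>B. [:- x j, 1:]) = 1"
  by (subst degree_prod_sum_eq) (simp_all add: lead_coeff_prod)

lemma pderiv_sum: "pderiv (\<Sum>i\<in>A. f i) = (\<Sum>i\<in>A. pderiv (f i))"
  by (induction A rule: infinite_finite_induct) (auto simp: pderiv_add)

text \<open>Differentiate the interpolation formula: at \<open>y\<close> the logarithmic derivatives
  of the nodal polynomial and of the Lagrange basis are sums of \<open>1 / (y - x l)\<close>. The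
  left side will arise as the total of the difference quotients over swaps with the block.\<close>

lemma lagrange_derivative:
  fixes x :: "'i \<Rightarrow> real" and h :: "real poly"
  assumes fin: "finite B" and inj: "inj_on x B" and y: "y \<notin> x ` B" and deg: "degree h \<le> card B"
  shows "(\<Sum>l\<in>B. (poly h y - poly h (x l) * (\<Prod>j\<in>B - {l}. (y - x j) / (x l - x j))) / (y - x l))
       = poly (pderiv h) y"
proof -
  define P where "P = (\<Prod>j\<in>B. [:- x j, 1:])"
  define el where "el l = (\<Prod>j\<in>B - {l}. smult (1 / (x l - x j)) [:- x j, 1:])" for l
  define \<kappa> where "\<kappa> = coeff h (card B)"
  have poly_el: "poly (el l) u = (\<Prod>j\<in>B - {l}. (u - x j) / (x l - x j))" for l u
    by (simp add: el_def poly_prod add_divide_distrib[symmetric] diff_divide_distrib[symmetric]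
        minus_divide_left[symmetric])
  have ne: "x l \<noteq> x j" if "l \<in> B" "j \<in> B" "l \<noteq> j" for l j
    using inj that by (auto dest: inj_onD)
  have yne: "y \<noteq> x l" if "l \<in> B" for l using y that by auto
  have el_at: "poly (el l) (x i) = (if i = l then 1 else 0)" if "l \<in> B" "i \<in> B" for l i
  proof (cases "i = l")
    case True
    have "(\<Prod>j\<in>B - {l}. (x l - x j) / (x l - x j)) = 1"
      by (rule prod.neutral) (use ne that in auto)
    then show ?thesis using True by (simp add: poly_el)
  next
    case False
    have "(\<Prod>j\<in>B - {l}. (x i - x j) / (x l - x j)) = 0"
      by (rule prod_zero) (use fin False that in auto)
    then show ?thesis using False by (simp add: poly_el)
  qed
  have deg_el: "degree (el l) < card B" if "l \<in> B" for l
  proof -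
    have "degree (el l) \<le> (\<Sum>j\<in>B - {l}. degree (smult (1 / (x l - x j)) [:- x j, 1:]))"
      using degree_prod_sum_le[OF finite_Diff[OF fin], of "\<lambda>j. smult (1 / (x l - x j)) [:- x j, 1:]"]
      by (simp only: el_def o_def)
    also have "\<dots> \<le> (\<Sum>j\<in>B - {l}. 1)" by (intro sum_mono order.trans[OF degree_smult_le]) auto
    also have "\<dots> = card (B - {l})" by (simp only: card_eq_sum)
    also have "\<dots> < card B" using fin that by (rule card_Diff1_less)
    finally show ?thesis .
  qed
  \<comment> \<open>\<open>card B\<close> nodes determine only degrees below \<open>card B\<close>;
    the multiple of \<open>P\<close>, which vanishes at all nodes, supplies the coefficient of
    degree \<open>card B\<close>.\<close>
  have expand: "h = smult \<kappa> P + (\<Sum>l\<in>B. smult (poly h (x l)) (el l))"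
  proof (rule poly_eqI_degree_lead_coeff)
    have "coeff (el l) (card B) = 0" if "l \<in> B" for l
      using deg_el[OF that] by (rule coeff_eq_0)
    moreover have "coeff P (card B) = 1"
      using lagrange_basis_degree[OF fin, of x] by (simp add: P_def)
    ultimately show "coeff h (card B) = coeff (smult \<kappa> P + (\<Sum>l\<in>B. smult (poly h (x l)) (el l))) (card B)"
      by (simp add: \<kappa>_def coeff_sum)
    show "card B \<le> card (x ` B)" using inj by (simp add: card_image)
    show "degree h \<le> card B" by (fact deg)
    show "degree (smult \<kappa> P + (\<Sum>l\<in>B. smult (poly h (x l)) (el l))) \<le> card B"
      using lagrange_basis_degree[OF fin, of x] deg_el
      by (intro degree_add_le degree_sum_le order.trans[OF degree_smult_le] fin) (auto simp: P_def less_imp_le)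
    fix z assume "z \<in> x ` B"
    then obtain i where i: "i \<in> B" "z = x i" by auto
    have "poly P (x i) = 0" unfolding P_def poly_prod
      by (rule prod_zero) (use fin i in auto)
    moreover have "(\<Sum>l\<in>B. poly h (x l) * poly (el l) (x i)) = (\<Sum>l\<in>B. if l = i then poly h (x i) else 0)"
      by (rule sum.cong) (use el_at i in auto)
    ultimately show "poly h z = poly (smult \<kappa> P + (\<Sum>l\<in>B. smult (poly h (x l)) (el l))) z"
      using i fin by (simp add: poly_sum)
  qed
  define s where "s = (\<Sum>l\<in>B. 1 / (y - x l))"
  have dP: "poly (pderiv P) y = poly P y * s"
  proof -
    have "(\<Prod>j\<in>B - {l}. y - x j) = (\<Prod>j\<in>B. y - x j) * (1 / (y - x l))" if "l \<in> B" for l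
      using prod.remove[OF fin that, of "\<lambda>j. y - x j"] yne[OF that] by simp
    then show ?thesis
      by (simp add: P_def pderiv_prod poly_sum poly_prod pderiv_pCons s_def sum_distrib_left)
  qed
  have del: "poly (pderiv (el l)) y = poly (el l) y * (s - 1 / (y - x l))" if "l \<in> B" for l
  proof -
    have "(\<Prod>j\<in>B - {l} - {i}. (y - x j) / (x l - x j)) * (1 / (x l - x i)) = poly (el l) y * (1 / (y - x i))"
      if "i \<in> B - {l}" for i
      using prod.remove[of "B - {l}" i "\<lambda>j. (y - x j) / (x l - x j)"] fin that yne[of i] ne[OF \<open>l \<in> B\<close>, of i]
      by (simp add: poly_el)
    then have "poly (pderiv (el l)) y = (\<Sum>i\<in>B - {l}. poly (el l) y * (1 / (y - x i)))"
      unfolding el_def pderiv_prod poly_sum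
      by (intro sum.cong)
        (simp_all add: poly_prod pderiv_smult pderiv_pCons el_def add_divide_distrib[symmetric] diff_divide_distrib[symmetric]
        minus_divide_left[symmetric])
    also have "\<dots> = poly (el l) y * (s - 1 / (y - x l))"
      using sum.remove[OF fin that, of "\<lambda>i. 1 / (y - x i)"] by (simp add: s_def sum_distrib_left)
    finally show ?thesis .
  qed
  have "(\<Sum>l\<in>B. (poly h y - poly h (x l) * poly (el l) y) / (y - x l))
      = poly h y * s - (\<Sum>l\<in>B. poly h (x l) * poly (el l) y * (1 / (y - x l)))"
    by (simp add: s_def sum_distrib_left diff_divide_distrib sum_subtractf)
  also have "\<dots> = \<kappa> * poly (pderiv P) y + (\<Sum>l\<in>B. poly h (x l) * poly (pderiv (el l)) y)"
  proof -
    have "poly h y = \<kappa> * poly P y + (\<Sum>l\<in>B. poly h (x l) * poly (el l) y)"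
      by (subst expand) (simp add: poly_sum)
    then show ?thesis
      by (simp add: dP del algebra_simps sum_distrib_left sum_subtractf sum.distrib)
  qed
  also have "\<dots> = poly (pderiv h) y"
    using arg_cong[OF expand, of "\<lambda>q. poly (pderiv q) y"] by (simp add: pderiv_add pderiv_smult pderiv_sum poly_sum)
  finally show ?thesis by (simp add: poly_el)
qed

text \<open>Compare top coefficients when the \<open>m\<close>-th power is interpolated at
  \<open>m + 1\<close> nodes; every numerator \<open>L i\<close> is monic of degree
  \<open>m\<close>.\<close>

lemma sum_power_div_prod_diff:
  fixes x :: "'i \<Rightarrow> real"
  assumes inj: "inj_on x S" and card: "card S = Suc m"
  shows "(\<Sum>i\<in>S. x i ^ m / (\<Prod>j\<in>S - {i}. x i - x j)) = 1"
proof -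
  have fin: "finite S" using card by (simp add: card_ge_0_finite)
  define L where "L i = (\<Prod>j\<in>S - {i}. [:- x j, 1:])" for i
  define d where "d i = (\<Prod>j\<in>S - {i}. x i - x j)" for i
  have cardm: "card (S - {i}) = m" if "i \<in> S" for i using that card fin by simp
  have degL: "degree (L i) = m" "coeff (L i) m = 1" if "i \<in> S" for i
    using lagrange_basis_degree[of "S - {i}" x] fin cardm[OF that] by (auto simp: L_def)
  have d0: "d i \<noteq> 0" if "i \<in> S" for i
    unfolding d_def using that inj fin by (auto dest: inj_onD)
  have "monom 1 m = (\<Sum>i\<in>S. smult (x i ^ m / d i) (L i))"
  proof (rule poly_eqI_degree)
    fix z assume "z \<in> x ` S"
    then obtain i where i: "i \<in> S" "z = x i" by auto
    have *: "poly (L l) (x i) = (if l = i then d i else 0)" if "l \<in> S" for l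
    proof (cases "l = i")
      case False
      then have "(\<Prod>j\<in>S - {l}. x i - x j) = 0"
        by (intro prod_zero) (use fin i in auto)
      then show ?thesis using False by (simp add: L_def poly_prod)
    qed (simp add: L_def d_def poly_prod)
    have "(\<Sum>l\<in>S. x l ^ m / d l * poly (L l) (x i)) = (\<Sum>l\<in>S. if l = i then x i ^ m else 0)"
      by (rule sum.cong) (use * d0 i in auto)
    then show "poly (monom 1 m) z = poly (\<Sum>i\<in>S. smult (x i ^ m / d i) (L i)) z"
      using i fin by (simp add: poly_sum poly_monom)
  next
    show "degree (monom (1::real) m) < card (x ` S)"
      using inj card by (simp add: card_image degree_monom_eq)
    have "degree (\<Sum>i\<in>S. smult (x i ^ m / d i) (L i)) \<le> m"
      using degL by (intro degree_sum_le fin order.trans[OF degree_smult_le]) auto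
    then show "degree (\<Sum>i\<in>S. smult (x i ^ m / d i) (L i)) < card (x ` S)"
      using inj card by (simp add: card_image)
  qed
  then have "coeff (monom 1 m) m = coeff (\<Sum>i\<in>S. smult (x i ^ m / d i) (L i)) m" by simp
  then show ?thesis using degL by (simp add: coeff_sum d_def)
qed

section \<open>Binomial power series\<close>

text \<open>This is the binomial series of \<open>1 - c X\<close> to the power
  \<open>- \<nu>\<close>.\<close>

definition fps_geom_powr :: "real \<Rightarrow> real \<Rightarrow> real fps" where
  "fps_geom_powr \<nu> c = Abs_fps (\<lambda>i. pochhammer \<nu> i / fact i * c ^ i)"

lemma fps_geom_powr_nth [simp]: "fps_geom_powr \<nu> c $ i = pochhammer \<nu> i / fact i * c ^ i"
  by (simp add: fps_geom_powr_def)

lemma fps_geom_powr_0 [simp]: "fps_geom_powr 0 c = 1"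
  by (rule fps_ext) (simp add: pochhammer_0_left)

text \<open>The Chu-Vandermonde convolution of Pochhammer symbols.\<close>

lemma fps_geom_powr_add: "fps_geom_powr (\<mu> + \<nu>) c = fps_geom_powr \<mu> c * fps_geom_powr \<nu> c"
proof (rule fps_ext)
  fix n
  have "(fps_geom_powr \<mu> c * fps_geom_powr \<nu> c) $ n =
     (\<Sum>k\<le>n. (of_nat (n choose k) * pochhammer \<mu> k * pochhammer \<nu> (n - k)) / fact n * c ^ n)"
    unfolding fps_mult_nth atLeast0AtMost
  proof (rule sum.cong[OF refl])
    fix k assume "k \<in> {..n}"
    then have k: "k \<le> n" by simp
    then have "c ^ n = c ^ k * c ^ (n - k)" by (simp flip: power_add)
    then show "fps_geom_powr \<mu> c $ k * fps_geom_powr \<nu> c $ (n - k)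
        = (of_nat (n choose k) * pochhammer \<mu> k * pochhammer \<nu> (n - k)) / fact n * c ^ n"
      using k by (simp add: binomial_fact)
  qed
  also have "\<dots> = fps_geom_powr (\<mu> + \<nu>) c $ n"
    by (simp add: pochhammer_binomial_sum sum_distrib_right sum_divide_distrib)
  finally show "fps_geom_powr (\<mu> + \<nu>) c $ n = (fps_geom_powr \<mu> c * fps_geom_powr \<nu> c) $ n" ..
qed

lemma fps_geom_powr_minus: "fps_geom_powr \<nu> c * fps_geom_powr (- \<nu>) c = 1"
  by (simp flip: fps_geom_powr_add)

lemma fps_geom_powr_neg1: "fps_geom_powr (-1) c = 1 - fps_const c * fps_X"
proof (rule fps_ext)
  fix n
  show "fps_geom_powr (-1) c $ n = (1 - fps_const c * fps_X) $ n"
  proof (cases "n \<le> 1")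
    case True
    then show ?thesis by (cases n) auto
  next
    case False
    then have "pochhammer (-1 :: real) n = 0"
      using pochhammer_of_nat_eq_0_lemma[of 1 n, where ?'a = real] by simp
    then show ?thesis using False by auto
  qed
qed

lemma fps_geom_powr_1_mult: "fps_geom_powr 1 c * (1 - fps_const c * fps_X) = 1"
  using fps_geom_powr_minus[of 1 c] by (simp add: fps_geom_powr_neg1)

lemma fps_geom_powr_1_diff:
  "fps_geom_powr 1 c - fps_geom_powr 1 d = fps_const (c - d) * fps_X * fps_geom_powr 1 c * fps_geom_powr 1 d"
proof -
  have "fps_const (c - d) = fps_const c - fps_const d" by simp
  then show ?thesis
    using fps_geom_powr_1_mult[of c] fps_geom_powr_1_mult[of d] by algebra
qed

lemma pochhammer_div_fact_Suc:
  fixes \<nu> :: real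
  shows "pochhammer \<nu> (Suc n) / fact (Suc n) * real (Suc n) = \<nu> * (pochhammer (1 + \<nu>) n / fact n)"
proof -
  have "fact (Suc n) = real (Suc n) * (fact n :: real)" by (simp add: fact_Suc)
  then show ?thesis by (simp add: pochhammer_rec add.commute del: of_nat_Suc)
qed

lemma fps_geom_powr_X_deriv:
  "fps_X * fps_deriv (fps_geom_powr \<nu> c) = fps_const \<nu> * (fps_geom_powr 1 c - 1) * fps_geom_powr \<nu> c"
proof -
  have 1: "fps_deriv (fps_geom_powr \<nu> c) = fps_const (\<nu> * c) * fps_geom_powr (1 + \<nu>) c"
  proof (rule fps_ext)
    fix n
    have "fps_deriv (fps_geom_powr \<nu> c) $ n
        = (pochhammer \<nu> (Suc n) / fact (Suc n) * real (Suc n)) * (c * c ^ n)"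
      by (simp add: mult_ac)
    also have "\<dots> = (fps_const (\<nu> * c) * fps_geom_powr (1 + \<nu>) c) $ n"
      unfolding pochhammer_div_fact_Suc by (simp add: mult_ac)
    finally show "fps_deriv (fps_geom_powr \<nu> c) $ n = (fps_const (\<nu> * c) * fps_geom_powr (1 + \<nu>) c) $ n" .
  qed
  have "fps_const (\<nu> * c) = fps_const \<nu> * fps_const c" by simp
  then show ?thesis
    using fps_geom_powr_1_mult[of c] unfolding 1 fps_geom_powr_add by algebra
qed

text \<open>Here the parameter \<open>c\<close> varies, not the series variable; derivatives are
  taken coefficient by coefficient, which needs no topology on series.\<close>

lemma fps_geom_powr_nth_deriv:
  "((\<lambda>c. fps_geom_powr \<nu> c $ i) has_real_derivative (fps_const \<nu> * fps_X * fps_geom_powr (1 + \<nu>) c) $ i) (at c)"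
proof (cases i)
  case 0
  then show ?thesis by (auto intro!: derivative_eq_intros simp: mult.assoc)
next
  case (Suc j)
  have "((\<lambda>c. pochhammer \<nu> (Suc j) / fact (Suc j) * c ^ Suc j) has_real_derivative
      pochhammer \<nu> (Suc j) / fact (Suc j) * (real (Suc j) * c ^ j)) (at c)"
    by (rule DERIV_cmult, rule DERIV_cong[OF DERIV_pow]) simp
  also have "pochhammer \<nu> (Suc j) / fact (Suc j) * (real (Suc j) * c ^ j)
      = (fps_const \<nu> * fps_X * fps_geom_powr (1 + \<nu>) c) $ Suc j"
    unfolding mult.assoc[symmetric] pochhammer_div_fact_Suc by (simp add: mult_ac)
  finally show ?thesis by (simp only: Suc fps_geom_powr_nth)
qed

lemma fps_mult_nth_deriv:
  fixes A :: "real \<Rightarrow> real fps"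
  assumes "\<And>i. ((\<lambda>u. A u $ i) has_real_derivative A' $ i) (at u)"
    and "\<And>i. ((\<lambda>u. B u $ i) has_real_derivative B' $ i) (at u)"
  shows "((\<lambda>u. (A u * B u) $ i) has_real_derivative (A' * B u + A u * B') $ i) (at u)"
  unfolding fps_mult_nth fps_add_nth
  by (auto intro!: derivative_eq_intros assms simp: sum.distrib[symmetric] algebra_simps)

text \<open>Dividing a polynomial of degree \<open>card B\<close> by \<open>1 - y X\<close> gives
  coefficients that form a geometric sequence of ratio \<open>y\<close> from index
  \<open>card B\<close> on. At that index the coefficient is the quotient of the Vandermonde
  products with and without the point \<open>y\<close>, up to sign.\<close>

lemma prod_linear_geom_nth:
  fixes x :: "'i \<Rightarrow> real"
  assumes "finite B" "card B \<le> k"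
  shows "((\<Prod>l\<in>B. 1 - fps_const (x l) * fps_X) * fps_geom_powr 1 y) $ k = y ^ (k - card B) * (\<Prod>l\<in>B. y - x l)"
  using assms
proof (induction B arbitrary: k rule: finite_induct)
  case empty
  then show ?case by (simp add: pochhammer_fact[symmetric])
next
  case (insert l B)
  define S where "S = (\<Prod>l\<in>B. 1 - fps_const (x l) * fps_X) * fps_geom_powr 1 y"
  from insert obtain j where k: "k = Suc j" and j: "card B \<le> j" by (cases k) auto
  have "((\<Prod>l\<in>insert l B. 1 - fps_const (x l) * fps_X) * fps_geom_powr 1 y) $ k
      = (S - fps_const (x l) * (fps_X * S)) $ k"
    using insert by (simp add: S_def algebra_simps)
  also have "\<dots> = S $ Suc j - x l * S $ j" by (simp add: k)
  also have "\<dots> = y ^ (Suc j - card B) * (\<Prod>l\<in>B. y - x l) - x l * (y ^ (j - card B) * (\<Prod>l\<in>B. y - x l))"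
    using insert.IH[of j] insert.IH[of "Suc j"] j by (simp add: S_def)
  also have "\<dots> = y ^ (k - card (insert l B)) * (\<Prod>l\<in>insert l B. y - x l)"
    using insert j by (simp add: k Suc_diff_le algebra_simps)
  finally show ?case .
qed

section \<open>Vandermonde products\<close>

text \<open>The order on indices selects each unordered pair once. The general codomain serves
  signed differences, real weights and complex powers alike.\<close>

definition pair_prod :: "'i::linorder set \<Rightarrow> ('i \<Rightarrow> 'i \<Rightarrow> 'a::comm_monoid_mult) \<Rightarrow> 'a" where
  "pair_prod S f = (\<Prod>(i, j)\<in>{(i, j). i \<in> S \<and> j \<in> S \<and> i < j}. f i j)"

lemma pair_prod_remove:
  assumes "finite S" "l \<in> S"
  shows "pair_prod S f = (\<Prod>j\<in>S - {l}. if l < j then f l j else f j l) * pair_prod (S - {l}) f"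
proof -
  define e where "e j = (if l < j then (l, j) else (j, l))" for j
  have split: "{(i, j). i \<in> S \<and> j \<in> S \<and> i < j}
      = e ` (S - {l}) \<union> {(i, j). i \<in> S - {l} \<and> j \<in> S - {l} \<and> i < j}" (is "_ = ?A \<union> ?B")
  proof (intro equalityI subsetI)
    fix p assume "p \<in> {(i, j). i \<in> S \<and> j \<in> S \<and> i < j}"
    then obtain i j where p: "p = (i, j)" "i \<in> S" "j \<in> S" "i < j" by auto
    consider "i = l" | "j = l" | "i \<noteq> l" "j \<noteq> l" by blast
    then show "p \<in> ?A \<union> ?B"
    proof cases
      case 1
      then have "p = e j" using p by (simp add: e_def)
      then show ?thesis using p 1 by auto
    next
      case 2
      then have "p = e i" using p by (auto simp: e_def)
      then show ?thesis using p 2 by auto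
    qed (use p in auto)
  next
    fix p assume "p \<in> ?A \<union> ?B"
    then show "p \<in> {(i, j). i \<in> S \<and> j \<in> S \<and> i < j}"
      using assms(2) by (auto simp: e_def split: if_splits)
  qed
  have fB: "finite ?B" by (rule finite_subset[of _ "S \<times> S"]) (use assms in auto)
  have disj: "?A \<inter> ?B = {}" by (auto simp: e_def split: if_splits)
  have inj: "inj_on e (S - {l})" by (auto simp: e_def inj_on_def split: if_splits)
  have "(\<Prod>(i, j)\<in>?A. f i j) = (\<Prod>j\<in>S - {l}. if l < j then f l j else f j l)"
    unfolding prod.reindex[OF inj] by (rule prod.cong) (auto simp: e_def)
  then show ?thesis
    unfolding pair_prod_def split
    by (subst prod.union_disjoint) (use assms fB disj in auto)
qed

text \<open>In this grouping a swap of \<open>a\<close> and \<open>b\<close> preserves the joint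
  factor of every other \<open>j\<close> and the last product, for symmetric factors and for
  differences alike; only \<open>F a b\<close> can change sign.\<close>

lemma pair_prod_remove2:
  fixes f :: "'i::linorder \<Rightarrow> 'i \<Rightarrow> 'a::comm_monoid_mult"
  assumes "finite S" "a \<in> S" "b \<in> S" "a \<noteq> b"
  defines "F \<equiv> \<lambda>i j. if i < j then f i j else f j i"
  shows "pair_prod S f = F a b * (\<Prod>j\<in>S - {a, b}. F a j * F b j) * pair_prod (S - {a, b}) f"
proof -
  have 1: "S - {a} - {b} = S - {a, b}" by auto
  have "(\<Prod>j\<in>S - {a}. F a j) = F a b * (\<Prod>j\<in>S - {a, b}. F a j)"
    using prod.remove[of "S - {a}" b "F a"] assms by (simp add: 1)
  then show ?thesis
    using pair_prod_remove[OF assms(1,2), of f] pair_prod_remove[of "S - {a}" b f] assms(1-4)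
    by (simp add: 1 F_def prod.distrib mult_ac)
qed

lemma pair_prod_cong:
  "(\<And>i j. i \<in> S \<Longrightarrow> j \<in> S \<Longrightarrow> i < j \<Longrightarrow> f i j = g i j) \<Longrightarrow> pair_prod S f = pair_prod S g"
  unfolding pair_prod_def by (intro prod.cong) auto

lemma pair_prod_transpose:
  assumes "finite S" "a \<in> S" "b \<in> S" and sym: "\<And>i j. f i j = f j i"
  shows "pair_prod S (\<lambda>i j. f (transpose a b i) (transpose a b j)) = pair_prod S f"
proof (cases "a = b")
  case False
  let ?f = "\<lambda>i j. f (transpose a b i) (transpose a b j)"
  have rest: "pair_prod (S - {a, b}) ?f = pair_prod (S - {a, b}) f"
    by (rule pair_prod_cong) auto
  have eq: "(if i < j then g i j else g j i) = g i j" if "\<And>i j. g i j = g j i" for i j and g :: "'a \<Rightarrow> 'a \<Rightarrow> 'b"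
    using that by auto
  have sym': "?f i j = ?f j i" for i j by (rule sym)
  have "(\<Prod>j\<in>S - {a, b}. ?f a j * ?f b j) = (\<Prod>j\<in>S - {a, b}. f a j * f b j)"
    by (rule prod.cong) (auto simp: mult.commute)
  then show ?thesis
    unfolding pair_prod_remove2[OF assms(1-3) False, of ?f] pair_prod_remove2[OF assms(1-3) False, of f]
      eq[of f, OF sym] eq[of ?f, OF sym'] rest by (simp add: sym[of b a])
qed simp

definition vdm :: "'i::linorder set \<Rightarrow> ('i \<Rightarrow> real) \<Rightarrow> real" where
  "vdm S x = pair_prod S (\<lambda>i j. x i - x j)"

lemma vdm_cong: "(\<And>i. i \<in> S \<Longrightarrow> x i = y i) \<Longrightarrow> vdm S x = vdm S y"
  unfolding vdm_def by (rule pair_prod_cong) auto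

lemma vdm_transpose:
  assumes "finite S" "a \<in> S" "b \<in> S" "a \<noteq> b"
  shows "vdm S (x \<circ> transpose a b) = - vdm S x"
proof -
  let ?F = "\<lambda>x i j. if i < j then x i - x j else x j - x i :: real"
  have 1: "?F (x \<circ> transpose a b) a j * ?F (x \<circ> transpose a b) b j = ?F x a j * ?F x b j"
    if "j \<in> S - {a, b}" for j using that by (auto simp: algebra_simps)
  have 2: "pair_prod (S - {a, b}) (\<lambda>i j. (x \<circ> transpose a b) i - (x \<circ> transpose a b) j)
      = pair_prod (S - {a, b}) (\<lambda>i j. x i - x j)"
    by (rule pair_prod_cong) auto
  have 3: "?F (x \<circ> transpose a b) a b = - ?F x a b" by auto
  have 4: "(\<Prod>j\<in>S - {a, b}. ?F (x \<circ> transpose a b) a j * ?F (x \<circ> transpose a b) b j)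
      = (\<Prod>j\<in>S - {a, b}. ?F x a j * ?F x b j)" by (rule prod.cong[OF refl 1])
  show ?thesis
    unfolding vdm_def pair_prod_remove2[OF assms] 2 3 4 by simp
qed

text \<open>The sign \<open>\<sigma>\<close> depends on the order of the indices but not on
  \<open>x\<close>. Being constant with square \<open>1\<close>, it disappears wherever two
  Vandermonde products are multiplied.\<close>

lemma vdm_remove:
  assumes "finite S" "l \<in> S"
  obtains \<sigma> where "\<sigma> * \<sigma> = (1::real)" "\<And>x. vdm S x = \<sigma> * (\<Prod>j\<in>S - {l}. x l - x j) * vdm (S - {l}) x"
proof
  define \<sigma> where "\<sigma> = (\<Prod>j\<in>S - {l}. if l < j then 1 else - 1 :: real)"
  show "\<sigma> * \<sigma> = 1" unfolding \<sigma>_def prod.distrib[symmetric] by (rule prod.neutral) auto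
  fix x :: "'a \<Rightarrow> real"
  have "(\<Prod>j\<in>S - {l}. if l < j then x l - x j else x j - x l) = \<sigma> * (\<Prod>j\<in>S - {l}. x l - x j)"
    unfolding \<sigma>_def prod.distrib[symmetric] by (rule prod.cong) auto
  then show "vdm S x = \<sigma> * (\<Prod>j\<in>S - {l}. x l - x j) * vdm (S - {l}) x"
    unfolding vdm_def using pair_prod_remove[OF assms, of "\<lambda>i j. x i - x j"] by simp
qed

section \<open>Polynomial functions and Dunkl operators\<close>

text \<open>The number is only an upper bound for the degree. Generation by single variables fits
  Dunkl operators, which have a simple commutation rule with multiplication by a variable.\<close>

inductive polyf :: "'i set \<Rightarrow> nat \<Rightarrow> (('i \<Rightarrow> real) \<Rightarrow> real) \<Rightarrow> bool" for I where
  polyf_const: "polyf I d (\<lambda>_. c)"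
| polyf_var_mult: "i \<in> I \<Longrightarrow> polyf I d f \<Longrightarrow> polyf I (Suc d) (\<lambda>x. x i * f x)"
| polyf_add: "polyf I d f \<Longrightarrow> polyf I d g \<Longrightarrow> polyf I d (\<lambda>x. f x + g x)"

lemma polyf_mono: "polyf I d f \<Longrightarrow> d \<le> e \<Longrightarrow> polyf I e f"
proof (induction arbitrary: e rule: polyf.induct)
  case (polyf_var_mult i d f)
  then obtain e' where "e = Suc e'" "d \<le> e'" by (cases e) auto
  then show ?case using polyf_var_mult by (auto intro: polyf.intros)
qed (auto intro: polyf.intros)

lemma polyf_mult: "polyf I d f \<Longrightarrow> polyf I e g \<Longrightarrow> polyf I (d + e) (\<lambda>x. f x * g x)"
proof (induction rule: polyf.induct)
  case (polyf_const d c)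
  have "polyf I e (\<lambda>x. c * g x)" using polyf_const
  proof (induction rule: polyf.induct)
    case (polyf_var_mult i d f)
    then have "polyf I (Suc d) (\<lambda>x. x i * (c * f x))" by (intro polyf.intros)
    then show ?case by (simp add: mult_ac)
  qed (auto simp: algebra_simps intro: polyf.intros)
  then show ?case by (rule polyf_mono) simp
next
  case (polyf_var_mult i d f)
  then have "polyf I (Suc (d + e)) (\<lambda>x. x i * (f x * g x))" by (intro polyf.intros) auto
  then show ?case by (simp add: mult_ac)
qed (auto simp: algebra_simps intro: polyf.intros)

lemma polyf_cmult: "polyf I d f \<Longrightarrow> polyf I d (\<lambda>x. c * f x)"
  using polyf_mult[OF polyf_const[of I 0 c], of d f] by simp

lemma polyf_var: "i \<in> I \<Longrightarrow> polyf I (Suc 0) (\<lambda>x. x i)"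
  using polyf_var_mult[of i I 0 "\<lambda>_. 1"] by (auto intro: polyf.intros)

lemma polyf_diff: "polyf I d f \<Longrightarrow> polyf I d g \<Longrightarrow> polyf I d (\<lambda>x. f x - g x)"
  using polyf_add[of I d f "\<lambda>x. (-1) * g x"] polyf_cmult[of I d g "-1"] by simp

lemma polyf_sum: "(\<And>i. i \<in> A \<Longrightarrow> polyf I d (f i)) \<Longrightarrow> polyf I d (\<lambda>x. \<Sum>i\<in>A. f i x)"
  by (induction A rule: infinite_finite_induct) (auto intro: polyf.intros)

lemma polyf_power: "i \<in> I \<Longrightarrow> polyf I k (\<lambda>x. x i ^ k)"
  by (induction k) (auto intro: polyf.intros)

lemma polyf_prod_linear:
  assumes "finite S" "S \<subseteq> I" "l \<in> I"
  shows "polyf I (card S) (\<lambda>x. \<Prod>j\<in>S. x l - x j)"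
  using assms
proof (induction S rule: finite_induct)
  case (insert j S)
  then have "polyf I (Suc 0 + card S) (\<lambda>x. (x l - x j) * (\<Prod>j\<in>S. x l - x j))"
    by (intro polyf_mult polyf_diff polyf_var) auto
  then show ?case using insert by simp
qed (auto intro: polyf.intros)

lemma polyf_vdm: "finite S \<Longrightarrow> S \<subseteq> I \<Longrightarrow> polyf I (card S choose 2) (vdm S)"
proof (induction S rule: finite_induct)
  case empty
  have "vdm ({} :: 'a set) = (\<lambda>_. 1)" by (auto simp: vdm_def pair_prod_def)
  then show ?case by (simp only: polyf_const)
next
  case (insert l S)
  obtain \<sigma> where \<sigma>: "\<And>x. vdm (insert l S) x = \<sigma> * (\<Prod>j\<in>S. x l - x j) * vdm S x"
    using vdm_remove[of "insert l S" l] insert by (metis Diff_insert_absorb finite_insert insertI1)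
  have "polyf I (card S + (card S choose 2)) (\<lambda>x. (\<sigma> * (\<Prod>j\<in>S. x l - x j)) * vdm S x)"
    using insert by (intro polyf_mult polyf_cmult polyf_prod_linear) auto
  then show ?case using insert by (simp add: \<sigma> [abs_def] numeral_2_eq_2)
qed

lemma polyf_transpose:
  assumes "a \<in> I" "b \<in> I"
  shows "polyf I d f \<Longrightarrow> polyf I d (\<lambda>x. f (x \<circ> transpose a b))"
proof (induction rule: polyf.induct)
  case (polyf_var_mult i d f)
  have "transpose a b i \<in> I" using assms polyf_var_mult(1) by (cases "i = a"; cases "i = b") simp_all
  from polyf.intros(2)[OF this polyf_var_mult.IH] show ?case by (simp add: o_def)
qed (auto intro: polyf.intros)

text \<open>\<open>Q\<close> stays arbitrary in the induction because multiplication by a variable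
  is absorbed into it.\<close>

lemma polyf_monomials:
  assumes I: "finite I" and P: "polyf I d f"
    and mon: "\<And>c \<alpha>. sum \<alpha> I \<le> d \<Longrightarrow> Q (\<lambda>x. c * (\<Prod>i\<in>I. x i ^ \<alpha> i))"
    and add: "\<And>f g. Q f \<Longrightarrow> Q g \<Longrightarrow> Q (\<lambda>x. f x + g x)"
  shows "Q f"
  using P mon add
proof (induction arbitrary: Q rule: polyf.induct)
  case (polyf_const d c)
  from polyf_const(1)[of "\<lambda>_. 0" c] show ?case by simp
next
  case (polyf_var_mult i d f)
  show ?case
  proof (rule polyf_var_mult.IH[of "\<lambda>f. Q (\<lambda>x. x i * f x)"])
    fix c and \<alpha> :: "'a \<Rightarrow> nat" assume \<alpha>: "sum \<alpha> I \<le> d"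
    let ?\<beta> = "\<alpha>(i := Suc (\<alpha> i))"
    have "sum ?\<beta> I = Suc (sum \<alpha> I)"
      using I polyf_var_mult(1) sum.remove[of I i ?\<beta>] sum.remove[of I i \<alpha>] by simp
    moreover have "(\<Prod>k\<in>I. x k ^ ?\<beta> k) = x i * (\<Prod>k\<in>I. x k ^ \<alpha> k)" for x :: "'a \<Rightarrow> real"
      using I polyf_var_mult(1) prod.remove[of I i "\<lambda>k. x k ^ ?\<beta> k"] prod.remove[of I i "\<lambda>k. x k ^ \<alpha> k"]
      by simp
    ultimately show "Q (\<lambda>x. x i * (c * (\<Prod>i\<in>I. x i ^ \<alpha> i)))"
      using polyf_var_mult.prems(1)[of ?\<beta> c] \<alpha> by (simp add: mult_ac)
  next
    fix f g assume "Q (\<lambda>x. x i * f x)" "Q (\<lambda>x. x i * g x)"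
    then show "Q (\<lambda>x. x i * (f x + g x))"
      using polyf_var_mult.prems(2) by (simp add: distrib_left)
  qed
qed blast

text \<open>
  Dunkl operators are a relation, constrained only at points with distinct coordinates: elsewhere the
  difference quotients are junk, but there the weight vanishes.
\<close>
definition dunkl :: "'i set \<Rightarrow> real \<Rightarrow> 'i \<Rightarrow> (('i \<Rightarrow> real) \<Rightarrow> real) \<Rightarrow> (('i \<Rightarrow> real) \<Rightarrow> real) \<Rightarrow> bool" where
  "dunkl I \<gamma> a f f' \<longleftrightarrow> (\<exists>p. (\<forall>x. ((\<lambda>u. f (x(a := u))) has_real_derivative p x) (at (x a))) \<and>
     (\<forall>x. inj_on x I \<longrightarrow>
        f' x = p x + \<gamma> * (\<Sum>j\<in>I - {a}. (f x - f (x \<circ> transpose a j)) / (x a - x j))))"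

lemma dunkl_const: "dunkl I \<gamma> a (\<lambda>_. c) (\<lambda>_. 0)"
  unfolding dunkl_def by (intro exI[of _ "\<lambda>_. 0"]) auto

lemma dunkl_add:
  assumes "dunkl I \<gamma> a f f'" "dunkl I \<gamma> a g g'"
  shows "dunkl I \<gamma> a (\<lambda>x. f x + g x) (\<lambda>x. f' x + g' x)"
proof -
  from assms obtain p q where
    "\<And>x. ((\<lambda>u. f (x(a := u))) has_real_derivative p x) (at (x a))"
    "\<And>x. ((\<lambda>u. g (x(a := u))) has_real_derivative q x) (at (x a))"
    "\<And>x. inj_on x I \<Longrightarrow>
        f' x = p x + \<gamma> * (\<Sum>j\<in>I - {a}. (f x - f (x \<circ> transpose a j)) / (x a - x j))"
    "\<And>x. inj_on x I \<Longrightarrow>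
        g' x = q x + \<gamma> * (\<Sum>j\<in>I - {a}. (g x - g (x \<circ> transpose a j)) / (x a - x j))"
    unfolding dunkl_def by blast
  moreover have "(\<Sum>j\<in>I - {a}. (f x + g x - (f (x \<circ> transpose a j) + g (x \<circ> transpose a j))) / (x a - x j))
      = (\<Sum>j\<in>I - {a}. (f x - f (x \<circ> transpose a j)) / (x a - x j))
        + (\<Sum>j\<in>I - {a}. (g x - g (x \<circ> transpose a j)) / (x a - x j))" for x
    unfolding sum.distrib[symmetric] add_divide_distrib[symmetric] by (simp add: algebra_simps)
  ultimately show ?thesis unfolding dunkl_def
    by (intro exI[of _ "\<lambda>x. p x + q x"]) (simp add: DERIV_add distrib_left)
qed

lemma dunkl_cmult:
  assumes "dunkl I \<gamma> a f f'"
  shows "dunkl I \<gamma> a (\<lambda>x. c * f x) (\<lambda>x. c * f' x)"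
proof -
  from assms obtain p where p:
    "\<And>x. ((\<lambda>u. f (x(a := u))) has_real_derivative p x) (at (x a))"
    "\<And>x. inj_on x I \<Longrightarrow>
        f' x = p x + \<gamma> * (\<Sum>j\<in>I - {a}. (f x - f (x \<circ> transpose a j)) / (x a - x j))"
    unfolding dunkl_def by blast
  have "c * f' x = c * p x + \<gamma> * (\<Sum>j\<in>I - {a}. (c * f x - c * f (x \<circ> transpose a j)) / (x a - x j))"
    if "inj_on x I" for x
    unfolding p(2)[OF that]
    by (simp add: distrib_left sum_distrib_left right_diff_distrib[symmetric] mult_ac)
  then show ?thesis unfolding dunkl_def using p(1)
    by (intro exI[of _ "\<lambda>x. c * p x"]) (auto intro!: DERIV_cmult)
qed

lemma dunkl_sum:
  "(\<And>c. c \<in> A \<Longrightarrow> dunkl I \<gamma> a (f c) (f' c)) \<Longrightarrow> dunkl I \<gamma> a (\<lambda>x. \<Sum>c\<in>A. f c x) (\<lambda>x. \<Sum>c\<in>A. f' c x)"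
  by (induction A rule: infinite_finite_induct) (auto intro: dunkl_const dunkl_add)

text \<open>The commutation rule of a Dunkl operator with multiplication by a variable. Its right
  side contains no division, which is why polynomials are mapped to polynomials.\<close>

lemma dunkl_var_mult:
  assumes I: "finite I" "a \<in> I" "i \<in> I" and f: "dunkl I \<gamma> a f f'"
  shows "dunkl I \<gamma> a (\<lambda>x. x i * f x)
    (\<lambda>x. x i * f' x + (if i = a then f x + \<gamma> * (\<Sum>j\<in>I - {a}. f (x \<circ> transpose a j))
                      else - \<gamma> * f (x \<circ> transpose a i)))"
proof -
  from f obtain p where p:
    "\<And>x. ((\<lambda>u. f (x(a := u))) has_real_derivative p x) (at (x a))"
    "\<And>x. inj_on x I \<Longrightarrow>
        f' x = p x + \<gamma> * (\<Sum>j\<in>I - {a}. (f x - f (x \<circ> transpose a j)) / (x a - x j))"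
    unfolding dunkl_def by blast
  define q where "q x = x i * p x + (if i = a then f x else 0)" for x
  have d: "((\<lambda>u. (x(a := u)) i * f (x(a := u))) has_real_derivative q x) (at (x a))" for x
  proof (cases "i = a")
    case True
    have "((\<lambda>u. u * f (x(a := u))) has_real_derivative 1 * f (x(a := x a)) + p x * x a) (at (x a))"
      by (rule DERIV_mult'[THEN DERIV_cong, OF DERIV_ident p(1)]) simp
    then show ?thesis using True by (simp add: q_def mult.commute add.commute)
  next
    case False
    then show ?thesis using DERIV_cmult[OF p(1)[of x], of "x i"] by (simp add: q_def)
  qed
  have diffquot: "(x i * f x - (x \<circ> transpose a j) i * f (x \<circ> transpose a j)) / (x a - x j)
      = x i * ((f x - f (x \<circ> transpose a j)) / (x a - x j)) +
        (if i = a then f (x \<circ> transpose a j) else if j = i then - f (x \<circ> transpose a i) else 0)"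
    if "inj_on x I" "j \<in> I - {a}" for x j
  proof -
    have "x a \<noteq> x j" using that I(2) by (auto dest: inj_onD)
    then show ?thesis by (auto simp: field_simps)
  qed
  have sumif: "(\<Sum>j\<in>I - {a}. if i = a then f (x \<circ> transpose a j) else if j = i then - f (x \<circ> transpose a i) else 0)
    = (if i = a then (\<Sum>j\<in>I - {a}. f (x \<circ> transpose a j)) else - f (x \<circ> transpose a i))" for x
    using I by auto
  show ?thesis unfolding dunkl_def
  proof (intro exI[of _ q] conjI allI impI)
    fix x :: "'a \<Rightarrow> real" assume inj: "inj_on x I"
    have "(\<Sum>j\<in>I - {a}. (x i * f x - (x \<circ> transpose a j) i * f (x \<circ> transpose a j)) / (x a - x j))
      = (\<Sum>j\<in>I - {a}. x i * ((f x - f (x \<circ> transpose a j)) / (x a - x j)) +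
        (if i = a then f (x \<circ> transpose a j) else if j = i then - f (x \<circ> transpose a i) else 0))"
      by (rule sum.cong[OF refl diffquot[OF inj]])
    also have "\<dots> = x i * (\<Sum>j\<in>I - {a}. (f x - f (x \<circ> transpose a j)) / (x a - x j)) +
      (if i = a then (\<Sum>j\<in>I - {a}. f (x \<circ> transpose a j)) else - f (x \<circ> transpose a i))"
      unfolding sum.distrib sumif by (simp add: sum_distrib_left)
    finally show "x i * f' x + (if i = a then f x + \<gamma> * (\<Sum>j\<in>I - {a}. f (x \<circ> transpose a j))
                      else - \<gamma> * f (x \<circ> transpose a i)) =
      q x + \<gamma> * (\<Sum>j\<in>I - {a}. (x i * f x - (x \<circ> transpose a j) i * f (x \<circ> transpose a j)) / (x a - x j))"
      using p(2)[OF inj] by (simp add: q_def algebra_simps)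
  qed (rule d)
qed

text \<open>Induction with \<open>dunkl_var_mult\<close>. The last conjunct handles the truncated
  \<open>0 - 1 = 0\<close>: a constant must go to zero, or \<open>x i * f' x\<close> would exceed
  degree \<open>0\<close> in the next step.\<close>

lemma polyf_dunkl:
  assumes I: "finite I" "a \<in> I"
  shows "polyf I d f \<Longrightarrow> \<exists>f'. polyf I (d - 1) f' \<and> dunkl I \<gamma> a f f' \<and> (d = 0 \<longrightarrow> f' = (\<lambda>_. 0))"
proof (induction rule: polyf.induct)
  case (polyf_const d c)
  show ?case by (intro exI[of _ "\<lambda>_. 0"]) (auto intro: polyf.intros dunkl_const)
next
  case (polyf_var_mult i d f)
  then obtain f' where f': "polyf I (d - 1) f'" "dunkl I \<gamma> a f f'" "d = 0 \<Longrightarrow> f' = (\<lambda>_. 0)" by blast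
  have 1: "polyf I d (\<lambda>x. x i * f' x)"
  proof (cases d)
    case 0
    then show ?thesis using f'(3) by (auto intro: polyf.intros)
  next
    case (Suc e)
    then show ?thesis using polyf.intros(2)[OF polyf_var_mult(1) f'(1)] by simp
  qed
  have 2: "polyf I d (\<lambda>x. if i = a then f x + \<gamma> * (\<Sum>j\<in>I - {a}. f (x \<circ> transpose a j))
                      else - \<gamma> * f (x \<circ> transpose a i))"
  proof (cases "i = a")
    case True
    then show ?thesis
      by (auto intro!: polyf_add polyf_cmult polyf_sum polyf_transpose I polyf_var_mult)
  next
    case False
    have "polyf I d (\<lambda>x. - \<gamma> * f (x \<circ> transpose a i))"
      by (intro polyf_cmult polyf_transpose I polyf_var_mult)
    then show ?thesis using False by simp
  qed
  show ?case
    using polyf_add[OF 1 2] dunkl_var_mult[OF I polyf_var_mult(1) f'(2)] by auto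
next
  case (polyf_add d f g)
  then obtain f' g' where "polyf I (d - 1) f'" "dunkl I \<gamma> a f f'" "d = 0 \<longrightarrow> f' = (\<lambda>_. 0)"
    "polyf I (d - 1) g'" "dunkl I \<gamma> a g g'" "d = 0 \<longrightarrow> g' = (\<lambda>_. 0)" by blast
  then show ?case
    by (intro exI[of _ "\<lambda>x. f' x + g' x"]) (auto intro: polyf.intros dunkl_add)
qed

lemma polyf_deriv:
  assumes I: "finite I" "a \<in> I"
  shows "polyf I d f \<Longrightarrow> \<exists>p. polyf I d p \<and> (\<forall>x. ((\<lambda>u. f (x(a := u))) has_real_derivative p x) (at (x a)))"
proof (induction rule: polyf.induct)
  case (polyf_const d c)
  show ?case by (intro exI[of _ "\<lambda>_. 0"]) (auto intro: polyf.intros)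
next
  case (polyf_var_mult i d f)
  then obtain p where p: "polyf I d p" "\<And>x. ((\<lambda>u. f (x(a := u))) has_real_derivative p x) (at (x a))"
    by blast
  show ?case
  proof (cases "i = a")
    case True
    have "((\<lambda>u. u * f (x(a := u))) has_real_derivative 1 * f (x(a := x a)) + p x * x a) (at (x a))" for x
      by (rule DERIV_mult'[THEN DERIV_cong, OF DERIV_ident p(2)]) simp
    then have "((\<lambda>u. (x(a := u)) i * f (x(a := u))) has_real_derivative f x + p x * x a) (at (x a))" for x
      by (simp only: True fun_upd_same fun_upd_triv mult_1)
    moreover have "polyf I (Suc d) (\<lambda>x. f x + x a * p x)"
      by (intro polyf.intros(3) polyf.intros(2)[OF I(2)] p polyf_mono[OF polyf_var_mult(2)]) auto
    ultimately show ?thesis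
      by (intro exI[of _ "\<lambda>x. f x + p x * x a"] conjI allI) (simp_all only: mult.commute)
  next
    case False
    have "((\<lambda>u. (x(a := u)) i * f (x(a := u))) has_real_derivative x i * p x) (at (x a))" for x
      unfolding fun_upd_other[OF False] by (rule DERIV_cmult[OF p(2)])
    then show ?thesis using polyf.intros(2)[OF polyf_var_mult(1) p(1)]
      by (intro exI[of _ "\<lambda>x. x i * p x"]) blast
  qed
next
  case (polyf_add d f g)
  then obtain p q where pq: "polyf I d p" "\<And>x. ((\<lambda>u. f (x(a := u))) has_real_derivative p x) (at (x a))"
    "polyf I d q" "\<And>x. ((\<lambda>u. g (x(a := u))) has_real_derivative q x) (at (x a))"
    by blast
  show ?case
    by (intro exI[of _ "\<lambda>x. p x + q x"] conjI allI polyf.intros(3) DERIV_add pq)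
qed

definition polyf_fps :: "'i set \<Rightarrow> (('i \<Rightarrow> real) \<Rightarrow> real fps) \<Rightarrow> bool" where
  "polyf_fps I A \<longleftrightarrow> (\<forall>i. polyf I i (\<lambda>x. A x $ i))"

lemma polyf_fps_mult: "polyf_fps I A \<Longrightarrow> polyf_fps I B \<Longrightarrow> polyf_fps I (\<lambda>x. A x * B x)"
  unfolding polyf_fps_def fps_mult_nth
proof (intro allI polyf_sum)
  fix n i :: nat assume "\<forall>i. polyf I i (\<lambda>x. A x $ i)" "\<forall>i. polyf I i (\<lambda>x. B x $ i)" "i \<in> {0..n}"
  then show "polyf I n (\<lambda>x. A x $ i * B x $ (n - i))"
    using polyf_mult[of I i "\<lambda>x. A x $ i" "n - i" "\<lambda>x. B x $ (n - i)"] by auto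
qed

lemma polyf_fps_1: "polyf_fps I (\<lambda>_. 1)"
  unfolding polyf_fps_def by (auto intro: polyf.intros)

lemma polyf_fps_prod:
  "(\<And>j. j \<in> S \<Longrightarrow> polyf_fps I (A j)) \<Longrightarrow> polyf_fps I (\<lambda>x. \<Prod>j\<in>S. A j x)"
  by (induction S rule: infinite_finite_induct) (auto intro: polyf_fps_mult polyf_fps_1)

lemma polyf_fps_geom_powr: "i \<in> I \<Longrightarrow> polyf_fps I (\<lambda>x. fps_geom_powr \<nu> (x i))"
  unfolding polyf_fps_def by (auto intro!: polyf_cmult polyf_power simp del: times_divide_eq_left)

section \<open>Dunkl operators on Vandermonde products\<close>

lemma prod_transpose_cong:
  assumes "a \<in> S \<longleftrightarrow> b \<in> S"
  shows "(\<Prod>j\<in>S. F ((x \<circ> transpose a b) j)) = (\<Prod>j\<in>S. F (x j))"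
proof -
  have "bij_betw (transpose a b) S S" using assms by (auto simp: bij_betw_transpose_iff intro!: bij_betw_byWitness[where f' = "transpose a b"] simp: in_transpose_image_iff transpose_def)
  from prod.reindex_bij_betw[OF this, of "\<lambda>j. F (x j)"] show ?thesis by simp
qed

lemma fps_prod_geom_powr_X_deriv:
  "fps_X * fps_deriv (\<Prod>k\<in>K. fps_geom_powr \<nu> (x k))
    = (\<Prod>k\<in>K. fps_geom_powr \<nu> (x k)) * (fps_const \<nu> * (\<Sum>k\<in>K. fps_geom_powr 1 (x k) - 1))"
proof (induction K rule: infinite_finite_induct)
  case (insert k K)
  have "fps_X * fps_deriv (fps_geom_powr \<nu> (x k) * (\<Prod>k\<in>K. fps_geom_powr \<nu> (x k)))
     = (fps_X * fps_deriv (fps_geom_powr \<nu> (x k))) * (\<Prod>k\<in>K. fps_geom_powr \<nu> (x k))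
       + fps_geom_powr \<nu> (x k) * (fps_X * fps_deriv (\<Prod>k\<in>K. fps_geom_powr \<nu> (x k)))"
    by (simp add: algebra_simps)
  then show ?case
    using insert by (simp add: fps_geom_powr_X_deriv insert.IH algebra_simps)
qed auto

lemma fps_geom_powr_mult_nth_poly:
  fixes A :: "real fps"
  obtains h :: "real poly" where "degree h \<le> c" "\<And>u. poly h u = (fps_geom_powr \<nu> u * A) $ c"
proof
  define h where "h = (\<Sum>i=0..c. monom (pochhammer \<nu> i / fact i * A $ (c - i)) i)"
  show "degree h \<le> c" unfolding h_def
    by (intro degree_sum_le) (auto intro: order.trans[OF degree_monom_le])
  show "poly h u = (fps_geom_powr \<nu> u * A) $ c" for u
    unfolding h_def poly_sum poly_monom fps_mult_nth by (rule sum.cong) simp_all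
qed

lemma fps_nth_0_prod: "(\<Prod>j\<in>S. A j) $ 0 = (\<Prod>j\<in>S. A j $ 0 :: real)"
  by (induction S rule: infinite_finite_induct) auto

section \<open>Two generating series and the action of the Dunkl operator on them\<close>

locale dunkl_block =
  fixes a :: "'i::linorder" and B K :: "'i set" and \<gamma> :: real
  assumes fin [simp]: "finite B" "finite K" and notin [simp]: "a \<notin> B" "a \<notin> K" and disj: "B \<inter> K = {}"
    and \<gamma>_nonneg: "0 \<le> \<gamma>"
begin

abbreviation "I \<equiv> insert a (B \<union> K)"

text \<open>
  On the functions \<open>vdm B x * h\<close> with \<open>h\<close> a polynomial of degree at most \<open>card B\<close> in the variables
  outside \<open>B\<close>, the Dunkl operator of parameter \<open>\<gamma>\<close> acts as \<open>1 + \<gamma>\<close> times the Dunkl operator of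
  parameter \<open>\<beta>\<close> in the remaining variables.
\<close>
definition "\<beta> = \<gamma> / (1 + \<gamma>)"

text \<open>The factors outside \<open>B\<close> are \<open>1 - x k X\<close> to the power
  \<open>\<beta>\<close>. Treating \<open>a\<close> like the members of \<open>K\<close> makes
  \<open>W\<close> invariant under swaps of \<open>a\<close> with \<open>K\<close>.\<close>

definition W :: "('i \<Rightarrow> real) \<Rightarrow> real fps" where
  "W x = (\<Prod>l\<in>B. 1 - fps_const (x l) * fps_X) * (\<Prod>k\<in>insert a K. fps_geom_powr (- \<beta>) (x k))"

text \<open>The powers cancel those in \<open>W\<close>, so that only the factor
  \<open>1 / (1 - x a X)\<close> survives in the product of the two series.\<close>

definition \<Phi> :: "('i \<Rightarrow> real) \<Rightarrow> real fps" where
  "\<Phi> x = fps_geom_powr 1 (x a) * (\<Prod>k\<in>insert a K. fps_geom_powr \<beta> (x k))"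

lemma W_mult_\<Phi>: "W x * \<Phi> x = (\<Prod>l\<in>B. 1 - fps_const (x l) * fps_X) * fps_geom_powr 1 (x a)"
proof -
  have "(\<Prod>k\<in>insert a K. fps_geom_powr (- \<beta>) (x k)) * (\<Prod>k\<in>insert a K. fps_geom_powr \<beta> (x k)) = 1"
    unfolding prod.distrib[symmetric]
    by (rule prod.neutral) (auto simp: fps_geom_powr_minus mult.commute[of "fps_geom_powr (- \<beta>) _"])
  then show ?thesis unfolding W_def \<Phi>_def by (simp add: mult_ac)
qed

lemma sum_W_\<Phi>: "(\<Sum>c\<le>card B. W x $ (card B - c) * \<Phi> x $ c) = (\<Prod>l\<in>B. x a - x l)"
proof -
  have "(\<Sum>c\<le>card B. W x $ (card B - c) * \<Phi> x $ c) = (\<Phi> x * W x) $ card B"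
    by (simp add: fps_mult_nth atLeast0AtMost mult.commute)
  also have "\<dots> = (\<Prod>l\<in>B. x a - x l)"
    by (simp only: mult.commute[of "\<Phi> x"] W_mult_\<Phi> prod_linear_geom_nth[OF fin(1) order.refl]) simp
  finally show ?thesis .
qed

lemma polyf_W: "polyf_fps I W"
proof -
  have "polyf_fps I (\<lambda>x. (\<Prod>l\<in>B. fps_geom_powr (-1) (x l)) * (\<Prod>k\<in>insert a K. fps_geom_powr (- \<beta>) (x k)))"
    by (intro polyf_fps_mult polyf_fps_prod polyf_fps_geom_powr) auto
  then show ?thesis by (simp only: W_def[abs_def] fps_geom_powr_neg1)
qed

lemma polyf_\<Phi>: "polyf_fps I \<Phi>"
  unfolding \<Phi>_def[abs_def] by (intro polyf_fps_mult polyf_fps_prod polyf_fps_geom_powr) auto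

lemma W_0 [simp]: "W x $ 0 = 1" and \<Phi>_0 [simp]: "\<Phi> x $ 0 = 1"
  by (simp_all add: W_def \<Phi>_def fps_nth_0_prod)

lemma \<Phi>_eq: "\<Phi> x = fps_geom_powr (1 + \<beta>) (x a) * (\<Prod>k\<in>K. fps_geom_powr \<beta> (x k))"
  by (simp add: \<Phi>_def fps_geom_powr_add mult_ac)

text \<open>Completing the product over \<open>B\<close> to one over the whole block makes it
  invariant under swaps inside the block; the exponent at \<open>x a\<close> changes from
  \<open>- \<beta>\<close> to \<open>1 - \<beta>\<close> in return.\<close>

lemma W_eq: "W x = fps_geom_powr (1 - \<beta>) (x a) *
    ((\<Prod>l\<in>insert a B. 1 - fps_const (x l) * fps_X) * (\<Prod>k\<in>K. fps_geom_powr (- \<beta>) (x k)))"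
proof -
  have "fps_geom_powr (- \<beta>) (x a) = (1 - fps_const (x a) * fps_X) * fps_geom_powr (1 - \<beta>) (x a)"
    using fps_geom_powr_add[of "-1" "1 - \<beta>" "x a"] by (simp add: fps_geom_powr_neg1)
  then show ?thesis by (simp add: W_def mult_ac)
qed

text \<open>The left side collects what the Dunkl operator produces from \<open>\<Phi>\<close>.
  Since \<open>\<gamma> = (1 + \<gamma>) * \<beta>\<close>, its terms have the proportions in which
  they occur in the Euler operator \<open>X d/dX\<close>, so the coefficients are shifted with
  weights linear in the index.\<close>

lemma \<Phi>_euler:
  "fps_const ((1 + \<gamma>) * (1 + \<beta>)) * (fps_X * (fps_geom_powr 1 (x a) * \<Phi> x))
     + fps_const \<gamma> * (\<Sum>k\<in>K. fps_X * (\<Phi> x * fps_geom_powr 1 (x k)))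
   = fps_const (1 + \<gamma>) * (fps_X * (fps_X * fps_deriv (\<Phi> x)) + fps_const (1 + \<beta> * (card K + 1)) * (fps_X * \<Phi> x))"
proof -
  let ?S = "\<Sum>k\<in>K. fps_geom_powr 1 (x k)" and ?G = "fps_geom_powr 1 (x a)"
  have d: "fps_X * fps_deriv (\<Phi> x) = \<Phi> x * (fps_const (1 + \<beta>) * (?G - 1) + fps_const \<beta> * (?S - of_nat (card K)))"
  proof -
    have "fps_X * fps_deriv (\<Phi> x) = (fps_X * fps_deriv (fps_geom_powr (1 + \<beta>) (x a))) * (\<Prod>k\<in>K. fps_geom_powr \<beta> (x k))
        + fps_geom_powr (1 + \<beta>) (x a) * (fps_X * fps_deriv (\<Prod>k\<in>K. fps_geom_powr \<beta> (x k)))"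
      unfolding \<Phi>_eq by (simp add: algebra_simps)
    then show ?thesis
      unfolding fps_geom_powr_X_deriv fps_prod_geom_powr_X_deriv
      by (simp add: \<Phi>_eq sum_subtractf algebra_simps)
  qed
  have g: "fps_const \<gamma> = fps_const (1 + \<gamma>) * fps_const \<beta>"
    using \<gamma>_nonneg by (simp add: \<beta>_def)
  have s: "(\<Sum>k\<in>K. fps_X * (\<Phi> x * fps_geom_powr 1 (x k))) = fps_X * \<Phi> x * ?S"
    by (simp add: sum_distrib_left mult.assoc)
  have c1: "fps_const ((1 + \<gamma>) * (1 + \<beta>)) = fps_const (1 + \<gamma>) * fps_const (1 + \<beta>)" by simp
  have c2: "fps_const (1 + \<beta> * (card K + 1)) = fps_const (1 + \<beta>) + fps_const \<beta> * of_nat (card K)"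
    by (simp add: fps_of_nat[symmetric] algebra_simps del: fps_of_nat)
  show ?thesis unfolding d s g c1 c2 by (simp only: algebra_simps mult_1)
qed


lemma \<Phi>_deriv:
  "((\<lambda>u. \<Phi> (x(a := u)) $ c) has_real_derivative
     (fps_const (1 + \<beta>) * (fps_X * (fps_geom_powr 1 (x a) * \<Phi> x))) $ c) (at (x a))"
proof -
  let ?P = "\<Prod>k\<in>K. fps_geom_powr \<beta> (x k)"
  have upd: "\<Phi> (x(a := u)) = fps_geom_powr (1 + \<beta>) u * ?P" for u
  proof -
    have "(\<Prod>k\<in>K. fps_geom_powr \<beta> ((x(a := u)) k)) = ?P" by (rule prod.cong) auto
    then show ?thesis by (simp add: \<Phi>_eq del: fun_upd_apply) simp
  qed
  have "((\<lambda>u. (fps_geom_powr (1 + \<beta>) u * ?P) $ c) has_real_derivative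
     (fps_const (1 + \<beta>) * fps_X * fps_geom_powr (1 + (1 + \<beta>)) (x a) * ?P + fps_geom_powr (1 + \<beta>) (x a) * 0) $ c) (at (x a))"
    by (rule fps_mult_nth_deriv[OF fps_geom_powr_nth_deriv]) simp
  also have "fps_const (1 + \<beta>) * fps_X * fps_geom_powr (1 + (1 + \<beta>)) (x a) * ?P + fps_geom_powr (1 + \<beta>) (x a) * 0
     = fps_const (1 + \<beta>) * (fps_X * (fps_geom_powr 1 (x a) * \<Phi> x))"
    unfolding \<Phi>_eq fps_geom_powr_add[of 1 "1 + \<beta>"] by (simp add: mult_ac)
  finally show ?thesis unfolding upd .
qed

lemma W_deriv:
  "((\<lambda>u. W (x(a := u)) $ b) has_real_derivative
     (fps_const (- \<beta>) * (fps_X * (fps_geom_powr 1 (x a) * W x))) $ b) (at (x a))"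
proof -
  let ?P = "(\<Prod>l\<in>B. 1 - fps_const (x l) * fps_X) * (\<Prod>k\<in>K. fps_geom_powr (- \<beta>) (x k))"
  have upd: "W (x(a := u)) = fps_geom_powr (- \<beta>) u * ?P" for u
  proof -
    have "(\<Prod>k\<in>K. fps_geom_powr (- \<beta>) ((x(a := u)) k)) = (\<Prod>k\<in>K. fps_geom_powr (- \<beta>) (x k))"
      "(\<Prod>l\<in>B. 1 - fps_const ((x(a := u)) l) * fps_X) = (\<Prod>l\<in>B. 1 - fps_const (x l) * fps_X)"
      by (auto intro!: prod.cong)
    then show ?thesis by (simp add: W_def mult_ac del: fun_upd_apply) simp
  qed
  have "((\<lambda>u. (fps_geom_powr (- \<beta>) u * ?P) $ b) has_real_derivative
     (fps_const (- \<beta>) * fps_X * fps_geom_powr (1 + (- \<beta>)) (x a) * ?P + fps_geom_powr (- \<beta>) (x a) * 0) $ b) (at (x a))"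
    by (rule fps_mult_nth_deriv[OF fps_geom_powr_nth_deriv]) simp
  also have "fps_const (- \<beta>) * fps_X * fps_geom_powr (1 + (- \<beta>)) (x a) * ?P + fps_geom_powr (- \<beta>) (x a) * 0
     = fps_const (- \<beta>) * (fps_X * (fps_geom_powr 1 (x a) * W x))"
    unfolding W_def fps_geom_powr_add[of 1 "- \<beta>"] by (simp add: mult_ac)
  finally show ?thesis unfolding upd .
qed

text \<open>Only the single factor \<open>fps_geom_powr 1 (x a)\<close> of \<open>\<Phi>\<close>
  distinguishes \<open>a\<close> from \<open>K\<close>; its difference is given by
  \<open>fps_geom_powr_1_diff\<close>.\<close>

lemma swap_outside:
  assumes inj: "inj_on x I" and k: "k \<in> K"
  shows "vdm B (x \<circ> transpose a k) = vdm B x" "W (x \<circ> transpose a k) = W x"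
    "\<Phi> x $ c - \<Phi> (x \<circ> transpose a k) $ c
      = (x a - x k) * (fps_X * (\<Phi> x * fps_geom_powr 1 (x k))) $ c"
proof -
  have kB: "k \<notin> B" using k disj by auto
  show "vdm B (x \<circ> transpose a k) = vdm B x"
  proof (rule vdm_cong)
    fix i assume "i \<in> B"
    then have "i \<noteq> a" "i \<noteq> k" using kB notin by auto
    then show "(x \<circ> transpose a k) i = x i" by simp
  qed
  have "(\<Prod>l\<in>B. 1 - fps_const ((x \<circ> transpose a k) l) * fps_X) = (\<Prod>l\<in>B. 1 - fps_const (x l) * fps_X)"
    by (rule prod_transpose_cong) (use kB in auto)
  moreover have P: "(\<Prod>k\<in>insert a K. fps_geom_powr \<nu> ((x \<circ> transpose a k') k)) = (\<Prod>k\<in>insert a K. fps_geom_powr \<nu> (x k))"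
    if "k' = k" for \<nu> k'
    by (rule prod_transpose_cong) (use k that in auto)
  ultimately show "W (x \<circ> transpose a k) = W x" unfolding W_def by (simp only: P)
  let ?P = "\<Prod>k\<in>insert a K. fps_geom_powr \<beta> (x k)"
  have "\<Phi> x - \<Phi> (x \<circ> transpose a k) = (fps_geom_powr 1 (x a) - fps_geom_powr 1 (x k)) * ?P"
    unfolding \<Phi>_def P[OF refl] by (simp add: left_diff_distrib)
  also have "\<dots> = fps_const (x a - x k) * (fps_X * (\<Phi> x * fps_geom_powr 1 (x k)))"
    unfolding fps_geom_powr_1_diff \<Phi>_def by (simp only: mult_ac)
  finally have "(\<Phi> x - \<Phi> (x \<circ> transpose a k)) $ c = (fps_const (x a - x k) * (fps_X * (\<Phi> x * fps_geom_powr 1 (x k)))) $ c"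
    by simp
  then show "\<Phi> x $ c - \<Phi> (x \<circ> transpose a k) $ c
      = (x a - x k) * (fps_X * (\<Phi> x * fps_geom_powr 1 (x k))) $ c" by simp
qed

text \<open>The swap replaces the node \<open>x l\<close> by \<open>x a\<close>, so the ratio of the
  two Vandermonde products is a Lagrange basis polynomial at \<open>x a\<close>.\<close>

lemma vdm_swap_inside:
  assumes inj: "inj_on x I" and l: "l \<in> B"
  shows "vdm B (x \<circ> transpose a l) = vdm B x * (\<Prod>j\<in>B - {l}. (x a - x j) / (x l - x j))"
proof -
  obtain \<sigma> where \<sigma>: "\<And>x. vdm B x = \<sigma> * (\<Prod>j\<in>B - {l}. x l - x j) * vdm (B - {l}) x"
    using vdm_remove[OF fin(1) l] by metis
  have "x l \<noteq> x j" if "j \<in> B - {l}" for j using inj l that by (auto dest: inj_onD)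
  then have nz: "(\<Prod>j\<in>B - {l}. x l - x j) \<noteq> 0" by auto
  have al: "a \<noteq> l" using l notin by metis
  have eq: "transpose a l j = j" if "j \<in> B - {l}" for j using that notin by (metis DiffE singletonI transpose_apply_other)
  have 1: "vdm (B - {l}) (x \<circ> transpose a l) = vdm (B - {l}) x"
    by (rule vdm_cong) (simp add: eq)
  have 2: "(\<Prod>j\<in>B - {l}. (x \<circ> transpose a l) l - (x \<circ> transpose a l) j) = (\<Prod>j\<in>B - {l}. x a - x j)"
    by (rule prod.cong) (simp_all add: eq)
  show ?thesis unfolding \<sigma>[of "x \<circ> transpose a l"] \<sigma>[of x] 1 2 prod_dividef using nz by simp
qed

lemma sum_swap_inside:
  assumes inj: "inj_on x I" and bc: "b + c \<le> card B"
  defines "q \<equiv> \<lambda>x. W x $ b * \<Phi> x $ c"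
  shows "(\<Sum>l\<in>B. (vdm B x * q x - vdm B (x \<circ> transpose a l) * q (x \<circ> transpose a l)) / (x a - x l))
    = vdm B x * ((1 - \<beta>) * (fps_X * (fps_geom_powr 1 (x a) * W x)) $ b * \<Phi> x $ c
        + W x $ b * (fps_const (1 + \<beta>) * (fps_X * (fps_geom_powr 1 (x a) * \<Phi> x))) $ c)"
proof -
  let ?w = "(\<Prod>l\<in>insert a B. 1 - fps_const (x l) * fps_X) * (\<Prod>k\<in>K. fps_geom_powr (- \<beta>) (x k))"
  let ?P = "\<Prod>k\<in>K. fps_geom_powr \<beta> (x k)"
  obtain h1 where h1: "degree h1 \<le> b" "\<And>u. poly h1 u = (fps_geom_powr (1 - \<beta>) u * ?w) $ b"
    using fps_geom_powr_mult_nth_poly by blast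
  obtain h2 where h2: "degree h2 \<le> c" "\<And>u. poly h2 u = (fps_geom_powr (1 + \<beta>) u * ?P) $ c"
    using fps_geom_powr_mult_nth_poly by blast
  \<comment> \<open>With the products over the whole block and over \<open>K\<close> frozen,
    \<open>q\<close> becomes a polynomial in one variable: its value at \<open>x a\<close> is
    \<open>q x\<close>, and its value at \<open>x l\<close> is \<open>q\<close> after the swap. The
    bound on \<open>b + c\<close> is the degree bound of \<open>lagrange_derivative\<close>.\<close>
  define h where "h = h1 * h2"
  have deg: "degree h \<le> card B"
    using degree_mult_le[of h1 h2] h1(1) h2(1) bc by (simp add: h_def)
  have qa: "q x = poly h (x a)" by (simp add: q_def h_def h1 h2 W_eq \<Phi>_eq)
  have ql: "q (x \<circ> transpose a l) = poly h (x l)" if l: "l \<in> B" for l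
  proof -
    have lK: "l \<notin> K" using l disj by auto
    have 1: "(\<Prod>l'\<in>insert a B. 1 - fps_const ((x \<circ> transpose a l) l') * fps_X) = (\<Prod>l\<in>insert a B. 1 - fps_const (x l) * fps_X)"
      by (rule prod_transpose_cong) (use l in auto)
    have 2: "(\<Prod>k\<in>K. fps_geom_powr \<nu> ((x \<circ> transpose a l) k)) = (\<Prod>k\<in>K. fps_geom_powr \<nu> (x k))" for \<nu>
      by (rule prod_transpose_cong) (use lK in auto)
    have "W (x \<circ> transpose a l) $ b = poly h1 (x l)"
      unfolding W_eq[of "x \<circ> transpose a l"] 1 2 h1(2) by simp
    moreover have "\<Phi> (x \<circ> transpose a l) $ c = poly h2 (x l)"
      unfolding \<Phi>_eq[of "x \<circ> transpose a l"] 2 h2(2) by simp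
    ultimately show ?thesis by (simp add: q_def h_def)
  qed
  have injB: "inj_on x B" using inj by (rule inj_on_subset) auto
  have xa: "x a \<notin> x ` B" using inj by (auto dest!: inj_onD)
  have "(\<Sum>l\<in>B. (vdm B x * q x - vdm B (x \<circ> transpose a l) * q (x \<circ> transpose a l)) / (x a - x l))
    = vdm B x * (\<Sum>l\<in>B. (poly h (x a) - poly h (x l) * (\<Prod>j\<in>B - {l}. (x a - x j) / (x l - x j))) / (x a - x l))"
    unfolding sum_distrib_left
    by (rule sum.cong[OF refl]) (simp add: vdm_swap_inside[OF inj] qa ql algebra_simps)
  also have "\<dots> = vdm B x * poly (pderiv h) (x a)"
    by (simp only: lagrange_derivative[OF fin(1) injB xa deg])
  also have "poly (pderiv h) (x a) = poly (pderiv h1) (x a) * \<Phi> x $ c + W x $ b * poly (pderiv h2) (x a)"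
    by (simp add: h_def pderiv_mult h1(2) h2(2) W_eq \<Phi>_eq)
  also have "poly (pderiv h2) (x a) = (fps_const (1 + \<beta>) * (fps_X * (fps_geom_powr 1 (x a) * \<Phi> x))) $ c"
  proof (rule DERIV_unique[OF poly_DERIV])
    have "((\<lambda>u. (fps_geom_powr (1 + \<beta>) u * ?P) $ c) has_real_derivative
       (fps_const (1 + \<beta>) * fps_X * fps_geom_powr (1 + (1 + \<beta>)) (x a) * ?P + fps_geom_powr (1 + \<beta>) (x a) * 0) $ c) (at (x a))"
      by (rule fps_mult_nth_deriv[OF fps_geom_powr_nth_deriv]) simp
    also have "fps_const (1 + \<beta>) * fps_X * fps_geom_powr (1 + (1 + \<beta>)) (x a) * ?P + fps_geom_powr (1 + \<beta>) (x a) * 0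
       = fps_const (1 + \<beta>) * (fps_X * (fps_geom_powr 1 (x a) * \<Phi> x))"
      unfolding \<Phi>_eq fps_geom_powr_add[of 1 "1 + \<beta>"] by (simp add: mult_ac)
    finally show "(poly h2 has_real_derivative (fps_const (1 + \<beta>) * (fps_X * (fps_geom_powr 1 (x a) * \<Phi> x))) $ c) (at (x a))"
      unfolding h2(2)[abs_def, symmetric] .
  qed
  also have "poly (pderiv h1) (x a) = (fps_const (1 - \<beta>) * (fps_X * (fps_geom_powr 1 (x a) * W x))) $ b"
  proof (rule DERIV_unique[OF poly_DERIV])
    have "((\<lambda>u. (fps_geom_powr (1 - \<beta>) u * ?w) $ b) has_real_derivative
       (fps_const (1 - \<beta>) * fps_X * fps_geom_powr (1 + (1 - \<beta>)) (x a) * ?w + fps_geom_powr (1 - \<beta>) (x a) * 0) $ b) (at (x a))"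
      by (rule fps_mult_nth_deriv[OF fps_geom_powr_nth_deriv]) simp
    also have "fps_const (1 - \<beta>) * fps_X * fps_geom_powr (1 + (1 - \<beta>)) (x a) * ?w + fps_geom_powr (1 - \<beta>) (x a) * 0
       = fps_const (1 - \<beta>) * (fps_X * (fps_geom_powr 1 (x a) * W x))"
      unfolding W_eq fps_geom_powr_add[of 1 "1 - \<beta>"] by (simp only: mult_ac mult_zero_left mult_zero_right add_0_right)
    finally show "(poly h1 has_real_derivative (fps_const (1 - \<beta>) * (fps_X * (fps_geom_powr 1 (x a) * W x))) $ b) (at (x a))"
      unfolding h1(2)[abs_def, symmetric] .
  qed
  finally show ?thesis by (simp only: fps_mult_left_const_nth mult.assoc)
qed

text \<open>The Dunkl operator annihilates the coefficients of \<open>W\<close> and shifts those of \<open>\<Phi>\<close>.\<close>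
lemma dunkl_W_\<Phi>:
  assumes bc: "b + c \<le> card B"
  shows "dunkl I \<gamma> a (\<lambda>x. vdm B x * (W x $ b * \<Phi> x $ c))
    (\<lambda>x. ((1 + \<gamma>) * (real c + \<beta> * (card K + 1))) * (vdm B x * (W x $ b * (fps_X * \<Phi> x) $ c)))"
  unfolding dunkl_def
proof (intro exI conjI allI impI)
  fix x :: "'i \<Rightarrow> real"
  let ?dW = "(fps_const (- \<beta>) * (fps_X * (fps_geom_powr 1 (x a) * W x))) $ b"
  let ?d\<Phi> = "(fps_const (1 + \<beta>) * (fps_X * (fps_geom_powr 1 (x a) * \<Phi> x))) $ c"
  have v: "vdm B (x(a := u)) = vdm B x" for u by (rule vdm_cong) (use notin in auto)
  have "((\<lambda>u. vdm B x * (W (x(a := u)) $ b * \<Phi> (x(a := u)) $ c)) has_real_derivative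
      vdm B x * (W (x(a := x a)) $ b * ?d\<Phi> + ?dW * \<Phi> (x(a := x a)) $ c)) (at (x a))"
    by (rule DERIV_cmult[OF DERIV_mult'[OF W_deriv \<Phi>_deriv]])
  then show "((\<lambda>u. vdm B (x(a := u)) * (W (x(a := u)) $ b * \<Phi> (x(a := u)) $ c)) has_real_derivative
      vdm B x * (W x $ b * ?d\<Phi> + ?dW * \<Phi> x $ c)) (at (x a))"
    unfolding v fun_upd_triv .
next
  fix x :: "'i \<Rightarrow> real" assume inj: "inj_on x I"
  let ?XW = "(fps_X * (fps_geom_powr 1 (x a) * W x)) $ b"
  let ?X\<Phi> = "(fps_X * (fps_geom_powr 1 (x a) * \<Phi> x)) $ c"
  let ?f = "\<lambda>x. vdm B x * (W x $ b * \<Phi> x $ c)"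
  let ?S = "\<Sum>k\<in>K. (fps_X * (\<Phi> x * fps_geom_powr 1 (x k))) $ c"
  have I: "I - {a} = B \<union> K" using notin by auto
  have K: "(\<Sum>k\<in>K. (?f x - ?f (x \<circ> transpose a k)) / (x a - x k)) = vdm B x * W x $ b * ?S"
    unfolding sum_distrib_left
  proof (rule sum.cong[OF refl])
    fix k assume k: "k \<in> K"
    then have "x a \<noteq> x k" using inj notin by (metis UnI2 inj_on_def insertCI)
    have "?f x - ?f (x \<circ> transpose a k) = vdm B x * W x $ b * (\<Phi> x $ c - \<Phi> (x \<circ> transpose a k) $ c)"
      by (simp only: swap_outside(1,2)[OF inj k] algebra_simps)
    also have "\<dots> = (x a - x k) * (vdm B x * W x $ b * (fps_X * (\<Phi> x * fps_geom_powr 1 (x k))) $ c)"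
      by (simp only: swap_outside(3)[OF inj k] mult_ac)
    finally have eq: "?f x - ?f (x \<circ> transpose a k)
        = (x a - x k) * (vdm B x * W x $ b * (fps_X * (\<Phi> x * fps_geom_powr 1 (x k))) $ c)" .
    show "(?f x - ?f (x \<circ> transpose a k)) / (x a - x k)
        = vdm B x * W x $ b * (fps_X * (\<Phi> x * fps_geom_powr 1 (x k))) $ c"
      unfolding eq using \<open>x a \<noteq> x k\<close> by simp
  qed
  have S: "(\<Sum>j\<in>I - {a}. (?f x - ?f (x \<circ> transpose a j)) / (x a - x j))
      = vdm B x * ((1 - \<beta>) * ?XW * \<Phi> x $ c + W x $ b * ((1 + \<beta>) * ?X\<Phi>)) + vdm B x * W x $ b * ?S"
    unfolding I sum.union_disjoint[OF fin disj] K sum_swap_inside[OF inj bc] by (simp only: fps_mult_left_const_nth)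
  have E: "(1 + \<gamma>) * (1 + \<beta>) * ?X\<Phi> + \<gamma> * ?S = (1 + \<gamma>) * (real c + \<beta> * (card K + 1)) * (fps_X * \<Phi> x) $ c"
  proof -
    have "(1 + \<gamma>) * (1 + \<beta>) * ?X\<Phi> + \<gamma> * ?S
      = (fps_const (1 + \<gamma>) * (fps_X * (fps_X * fps_deriv (\<Phi> x)) + fps_const (1 + \<beta> * (card K + 1)) * (fps_X * \<Phi> x))) $ c"
      unfolding \<Phi>_euler[symmetric] by (simp only: fps_add_nth fps_mult_left_const_nth fps_sum_nth)
    also have "\<dots> = (1 + \<gamma>) * ((fps_X * (fps_X * fps_deriv (\<Phi> x))) $ c + (1 + \<beta> * (card K + 1)) * (fps_X * \<Phi> x) $ c)"
      by (simp only: fps_add_nth fps_mult_left_const_nth)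
    \<comment> \<open>The extra factor \<open>fps_X\<close> shifts the Euler weight from
      \<open>c\<close> to \<open>c - 1\<close>; at \<open>c = 0\<close> both sides vanish.\<close>
    also have "(fps_X * (fps_X * fps_deriv (\<Phi> x))) $ c = (real c - 1) * (fps_X * \<Phi> x) $ c"
      by (cases c; cases "c - 1") auto
    finally show ?thesis by (simp add: algebra_simps)
  qed
  \<comment> \<open>This cancels the two contributions of \<open>W\<close>: \<open>- \<beta>\<close>
    from the partial derivative and \<open>\<gamma> * (1 - \<beta>)\<close> from the swaps inside
    the block.\<close>
  have \<beta>: "\<gamma> * (1 - \<beta>) = \<beta>" using \<gamma>_nonneg by (simp add: \<beta>_def field_simps)
  have "((1 + \<gamma>) * (real c + \<beta> * (card K + 1))) * (vdm B x * (W x $ b * (fps_X * \<Phi> x) $ c))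
      = vdm B x * W x $ b * ((1 + \<gamma>) * (real c + \<beta> * (card K + 1)) * (fps_X * \<Phi> x) $ c)"
    by (simp only: mult_ac)
  also have "\<dots> = vdm B x * (W x $ b * ((1 + \<beta>) * ?X\<Phi>) + (- \<beta> * ?XW) * \<Phi> x $ c)
     + \<gamma> * (vdm B x * ((1 - \<beta>) * ?XW * \<Phi> x $ c + W x $ b * ((1 + \<beta>) * ?X\<Phi>)) + vdm B x * W x $ b * ?S)"
  proof -
    have "V * w * ((1 + g) * (1 + b) * xp + g * t)
      = V * (w * ((1 + b) * xp) + (- b * xw) * P) + g * (V * ((1 - b) * xw * P + w * ((1 + b) * xp)) + V * w * t)"
      if "g * (1 - b) = b" for V w P xw xp t g b :: real
    proof -
      have "g * (1 - b) * (V * xw * P) = b * (V * xw * P)" by (simp only: that)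
      then show ?thesis by (simp add: algebra_simps)
    qed
    from this[OF \<beta>] show ?thesis unfolding E[symmetric] .
  qed
  finally show "((1 + \<gamma>) * (real c + \<beta> * (card K + 1))) * (vdm B x * (W x $ b * (fps_X * \<Phi> x) $ c))
      = vdm B x * (W x $ b * (fps_const (1 + \<beta>) * (fps_X * (fps_geom_powr 1 (x a) * \<Phi> x))) $ c
          + (fps_const (- \<beta>) * (fps_X * (fps_geom_powr 1 (x a) * W x))) $ b * \<Phi> x $ c)
        + \<gamma> * (\<Sum>j\<in>I - {a}. (?f x - ?f (x \<circ> transpose a j)) / (x a - x j))"
    unfolding S by (simp only: fps_mult_left_const_nth)
qed

end

section \<open>The iterated Dunkl operator on the Vandermonde product\<close>

context dunkl_block begin

abbreviation "m \<equiv> card B"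

definition V :: "('i \<Rightarrow> real) \<Rightarrow> real" where
  "V x = vdm B x * (\<Prod>l\<in>B. x a - x l)"

text \<open>Every application lowers the index of \<open>\<Phi>\<close> by one, so the weight met
  after \<open>i\<close> applications is the one belonging to \<open>c - i\<close>.\<close>

definition coef :: "nat \<Rightarrow> nat \<Rightarrow> real" where
  "coef j c = (\<Prod>i<j. (1 + \<gamma>) * (real (c - i) + \<beta> * (card K + 1)))"

text \<open>The \<open>j\<close>-th iterated Dunkl operator in the variable \<open>a\<close>, applied to \<open>V\<close>.\<close>
definition F :: "nat \<Rightarrow> ('i \<Rightarrow> real) \<Rightarrow> real" where
  "F j x = (\<Sum>c\<in>{j..m}. coef j c * (vdm B x * (W x $ (m - c) * \<Phi> x $ (c - j))))"

lemma F_0: "F 0 x = V x"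
  by (simp add: F_def V_def coef_def sum_W_\<Phi>[symmetric] sum_distrib_left atLeast0AtMost)

text \<open>Only the term \<open>c = m\<close> is left, and in it both series contribute their
  constant coefficient \<open>1\<close>.\<close>

lemma F_m: "F m x = (\<Prod>i=1..m. real i * (1 + \<gamma>) + \<gamma> * (card K + 1)) * vdm B x"
proof -
  have "(1 + \<gamma>) * (t + \<beta> * s) = t * (1 + \<gamma>) + \<gamma> * s" for t s :: real
    using \<gamma>_nonneg by (simp add: \<beta>_def field_simps)
  then have "coef m m = (\<Prod>i<m. real (m - i) * (1 + \<gamma>) + \<gamma> * (card K + 1))"
    unfolding coef_def by simp
  also have "\<dots> = (\<Prod>i=1..m. real i * (1 + \<gamma>) + \<gamma> * (card K + 1))"
    by (rule prod.reindex_bij_witness[of _ "\<lambda>i. m - i" "\<lambda>i. m - i"]) auto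
  finally show ?thesis by (simp add: F_def)
qed

lemma polyf_F:
  assumes "j \<le> m"
  shows "polyf I ((m choose 2) + (m - j)) (F j)"
  unfolding F_def[abs_def]
proof (intro polyf_sum polyf_cmult)
  fix c assume c: "c \<in> {j..m}"
  have "polyf I ((m choose 2) + ((m - c) + (c - j))) (\<lambda>x. vdm B x * (W x $ (m - c) * \<Phi> x $ (c - j)))"
    using polyf_W polyf_\<Phi> unfolding polyf_fps_def by (intro polyf_mult polyf_vdm) auto
  then show "polyf I ((m choose 2) + (m - j)) (\<lambda>x. vdm B x * (W x $ (m - c) * \<Phi> x $ (c - j)))"
    using c by simp
qed

lemma dunkl_F:
  assumes "j < m"
  shows "dunkl I \<gamma> a (F j) (F (Suc j))"
proof -
  have "dunkl I \<gamma> a (F j) (\<lambda>x. \<Sum>c\<in>{j..m}. coef j c *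
     (((1 + \<gamma>) * (real (c - j) + \<beta> * (card K + 1))) * (vdm B x * (W x $ (m - c) * (fps_X * \<Phi> x) $ (c - j)))))"
    unfolding F_def[abs_def]
  proof (intro dunkl_sum dunkl_cmult dunkl_W_\<Phi>)
    fix c assume "c \<in> {j..m}"
    then show "m - c + (c - j) \<le> m" by auto
  qed
  also have "(\<lambda>x. \<Sum>c\<in>{j..m}. coef j c *
     (((1 + \<gamma>) * (real (c - j) + \<beta> * (card K + 1))) * (vdm B x * (W x $ (m - c) * (fps_X * \<Phi> x) $ (c - j))))) = F (Suc j)"
  proof
    fix x
    let ?t = "\<lambda>c. coef j c *
     (((1 + \<gamma>) * (real (c - j) + \<beta> * (card K + 1))) * (vdm B x * (W x $ (m - c) * (fps_X * \<Phi> x) $ (c - j))))"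
    \<comment> \<open>The term \<open>c = j\<close> disappears because
      \<open>fps_X * \<Phi> x\<close> has no constant coefficient.\<close>
    have "(\<Sum>c\<in>{j..m}. ?t c) = (\<Sum>c\<in>{Suc j..m}. ?t c)"
      using assms by (subst sum.atLeast_Suc_atMost) auto
    also have "\<dots> = F (Suc j) x"
      unfolding F_def
    proof (rule sum.cong[OF refl])
      fix c assume "c \<in> {Suc j..m}"
      then have c: "c - j = Suc (c - Suc j)" by auto
      have "(fps_X * \<Phi> x) $ (c - j) = \<Phi> x $ (c - Suc j)" by (simp add: c)
      moreover have "coef (Suc j) c = coef j c * ((1 + \<gamma>) * (real (c - j) + \<beta> * (card K + 1)))"
        by (simp add: coef_def)
      ultimately show "?t c = coef (Suc j) c * (vdm B x * (W x $ (m - c) * \<Phi> x $ (c - Suc j)))"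
        by (simp only: mult.assoc)
    qed
    finally show "(\<Sum>c\<in>{j..m}. ?t c) = F (Suc j) x" .
  qed
  finally show ?thesis .
qed

lemma V_eq_vdm:
  obtains \<sigma> where "\<sigma> * \<sigma> = (1::real)" "\<And>x. V x = \<sigma> * vdm (insert a B) x"
proof -
  obtain \<sigma> where \<sigma>: "\<sigma> * \<sigma> = (1::real)"
    "\<And>x. vdm (insert a B) x = \<sigma> * (\<Prod>j\<in>insert a B - {a}. x a - x j) * vdm (insert a B - {a}) x"
    using vdm_remove[of "insert a B" a] fin by blast
  have "insert a B - {a} = B" by auto
  then have "\<sigma> * vdm (insert a B) x = \<sigma> * \<sigma> * V x" for x unfolding \<sigma>(2) V_def by (simp add: mult_ac)
  then show thesis using that[of \<sigma>] \<sigma>(1) by simp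
qed

end

section \<open>Gaussian integration by parts\<close>

definition std_normal_measure :: "real measure" where
  "std_normal_measure = density lborel std_normal_density"

lemma prob_space_std_normal_measure: "prob_space std_normal_measure"
  unfolding std_normal_measure_def by (rule prob_space_normal_density) simp

lemma sets_std_normal_measure [simp, measurable_cong]: "sets std_normal_measure = sets borel"
  and space_std_normal_measure [simp]: "space std_normal_measure = UNIV"
  by (simp_all add: std_normal_measure_def)

lemma integral_std_normal_measure:
  fixes f :: "real \<Rightarrow> real"
  assumes "f \<in> borel_measurable borel"
  shows "integral\<^sup>L std_normal_measure f = (\<integral>x. std_normal_density x * f x \<partial>lborel)"
  unfolding std_normal_measure_def
  using integral_density[of f lborel std_normal_density] assms by simp

lemma integrable_std_normal_measure:
  fixes f :: "real \<Rightarrow> real"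
  assumes "f \<in> borel_measurable borel"
  shows "integrable std_normal_measure f \<longleftrightarrow> integrable lborel (\<lambda>x. std_normal_density x * f x)"
  unfolding std_normal_measure_def
  using integrable_density[of f lborel std_normal_density] assms by simp

lemma integrable_std_normal_power: "integrable std_normal_measure (\<lambda>u. (1 + \<bar>u\<bar>) ^ N)"
proof -
  have "integrable lborel (\<lambda>u. \<Sum>k\<le>N. of_nat (N choose k) * (std_normal_density u * \<bar>u\<bar> ^ (N - k)))"
    by (intro Bochner_Integration.integrable_sum integrable_mult_right integrable_std_normal_moment_abs)
  moreover have "(\<Sum>k\<le>N. of_nat (N choose k) * (std_normal_density u * \<bar>u\<bar> ^ (N - k)))
      = std_normal_density u * (1 + \<bar>u\<bar>) ^ N" for u
    by (simp add: binomial_ring sum_distrib_left mult_ac)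
  ultimately show ?thesis by (subst integrable_std_normal_measure) simp_all
qed

lemma std_normal_density_DERIV:
  "(std_normal_density has_real_derivative - u * std_normal_density u) (at u)"
proof -
  define c where "c = 1 / sqrt (2 * pi)"
  have "((\<lambda>u. c * exp (- u\<^sup>2 / 2)) has_real_derivative c * (exp (- u\<^sup>2 / 2) * (- u))) (at u)"
    by (rule DERIV_cmult) (auto intro!: derivative_eq_intros)
  then show ?thesis unfolding std_normal_density_def[abs_def] c_def[symmetric] by (simp add: mult_ac)
qed

text \<open>Multiplied by the density, the integrand is the derivative of density times
  \<open>K\<close>, which tends to zero at both ends by the growth bound.\<close>

lemma stein_identity:
  fixes K K' :: "real \<Rightarrow> real"
  assumes K: "\<And>u. (K has_real_derivative K' u) (at u)" and cont: "\<And>u. isCont K' u"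
    and bound: "\<And>u. \<bar>K u\<bar> \<le> C * (1 + \<bar>u\<bar>) ^ N"
  shows "(\<integral>u. K' u - u * K u \<partial>std_normal_measure) = 0"
proof -
  define g where "g u = std_normal_density u * (K' u - u * K u)" for u
  have contK: "isCont K u" for u using K by (rule DERIV_isCont)
  have cont_phi: "isCont std_normal_density u" for u
    using std_normal_density_DERIV by (rule DERIV_isCont)
  have contg: "isCont g u" for u unfolding g_def by (intro continuous_intros cont contK cont_phi)
  have meas: "(\<lambda>u. K' u - u * K u) \<in> borel_measurable borel"
    by (intro borel_measurable_continuous_onI continuous_at_imp_continuous_on ballI continuous_intros cont contK)
  define G where "G u = std_normal_density u * K u" for u
  have DG: "(G has_real_derivative g u) (at u)" for u
    unfolding G_def[abs_def] g_def
    using DERIV_mult[OF std_normal_density_DERIV[of u] K[of u]] by (simp add: algebra_simps)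
  have C: "C \<ge> 0"
    using order.trans[OF abs_ge_zero bound[of 0]] by simp
  have Gb: "\<bar>G u\<bar> \<le> C * (1 / sqrt (2 * pi) * exp (- u\<^sup>2 / 2) * (1 + \<bar>u\<bar>) ^ N)" for u
    using mult_left_mono[OF bound[of u], of "std_normal_density u"]
    by (simp add: G_def abs_mult std_normal_density_def mult_ac divide_right_mono)
  have Gtop: "(G \<longlongrightarrow> 0) at_top" and Gbot: "(G \<longlongrightarrow> 0) at_bot"
  proof -
    have "((\<lambda>u::real. C * (1 / sqrt (2 * pi) * exp (- u\<^sup>2 / 2) * (1 + u) ^ N)) \<longlongrightarrow> 0) at_top"
      by (rule tendsto_mult_right_zero) real_asymp
    then have *: "((\<lambda>u::real. C * (1 / sqrt (2 * pi) * exp (- u\<^sup>2 / 2) * (1 + \<bar>u\<bar>) ^ N)) \<longlongrightarrow> 0) at_top"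
      by (rule Lim_transform_eventually) (use eventually_ge_at_top[of 0] in eventually_elim, simp)
    show "(G \<longlongrightarrow> 0) at_top"
      by (rule Lim_null_comparison[OF always_eventually *]) (simp only: real_norm_def Gb simp_thms)
    show "(G \<longlongrightarrow> 0) at_bot"
      unfolding filterlim_at_bot_mirror
    proof (rule Lim_null_comparison[OF always_eventually *], intro allI)
      show "norm (G (- u)) \<le> C * (1 / sqrt (2 * pi) * exp (- u\<^sup>2 / 2) * (1 + \<bar>u\<bar>) ^ N)" for u
        using Gb[of "- u"] by (simp only: real_norm_def power2_minus abs_minus_cancel)
    qed
  qed
  have "(\<integral>u. g u \<partial>lborel) = 0"
  \<comment> \<open>For a function that is not integrable the Bochner integral is zero by
    convention, so the claim holds in that case too.\<close>
  proof (cases "integrable lborel g")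
    case True
    have "(LBINT u=-\<infinity>..\<infinity>. g u) = 0 - 0"
    proof (rule interval_integral_FTC_integrable[where F = G])
      show "(G has_vector_derivative g u) (at u)" for u
        using DG by (simp add: has_real_derivative_iff_has_vector_derivative)
      show "set_integrable lborel (einterval (- \<infinity>) \<infinity>) g"
        using True by (simp add: einterval_eq_UNIV set_integrable_def)
      show "((G \<circ> real_of_ereal) \<longlongrightarrow> 0) (at_right (- \<infinity>))" "((G \<circ> real_of_ereal) \<longlongrightarrow> 0) (at_left \<infinity>)"
        using Gtop Gbot by (simp_all add: ereal_tendsto_simps)
    qed (use contg in auto)
    then show ?thesis
      by (simp add: interval_lebesgue_integral_def einterval_eq_UNIV set_lebesgue_integral_def)
  qed (simp add: not_integrable_integral_eq)
  then show ?thesis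
    unfolding integral_std_normal_measure[OF meas] g_def .
qed

section \<open>Product Gaussian measures and functions of polynomial growth\<close>

definition gauss_prod :: "'i set \<Rightarrow> ('i \<Rightarrow> real) measure" where
  "gauss_prod I = (\<Pi>\<^sub>M i\<in>I. std_normal_measure)"

lemma prob_space_gauss_prod: "prob_space (gauss_prod I)"
  unfolding gauss_prod_def by (intro prob_space_PiM prob_space_std_normal_measure)

lemma space_gauss_prod: "space (gauss_prod I) = PiE I (\<lambda>_. UNIV)"
  by (simp add: gauss_prod_def space_PiM)

lemma measurable_gauss_prod_component: "i \<in> I \<Longrightarrow> (\<lambda>x. x i) \<in> borel_measurable (gauss_prod I)"
  unfolding gauss_prod_def using measurable_component_singleton[of i I "\<lambda>_. std_normal_measure"]
  by (simp cong: measurable_cong_sets)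

interpretation std_normal: product_sigma_finite "\<lambda>_. std_normal_measure"
  by (simp add: product_sigma_finite_def prob_space_std_normal_measure prob_space_imp_sigma_finite)

lemma distr_gauss_prod_transpose:
  assumes ab: "a \<in> I" "b \<in> I"
  shows "(\<lambda>x. x \<circ> transpose a b) \<in> measurable (gauss_prod I) (gauss_prod I)"
    and "distr (gauss_prod I) (gauss_prod I) (\<lambda>x. x \<circ> transpose a b) = gauss_prod I"
proof -
  have I: "transpose a b i \<in> I \<longleftrightarrow> i \<in> I" for i
    using ab by (cases "i = a"; cases "i = b") auto
  have eq: "x \<circ> transpose a b = (\<lambda>n\<in>I. x (transpose a b n))" if "x \<in> space (gauss_prod I)" for x
  proof
    fix n
    have "x (transpose a b n) = undefined" if "n \<notin> I"
      using \<open>x \<in> space (gauss_prod I)\<close> I[of n] that unfolding space_gauss_prod by (metis PiE_arb)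
    then show "(x \<circ> transpose a b) n = (\<lambda>n\<in>I. x (transpose a b n)) n" by simp
  qed
  have "(\<lambda>x. \<lambda>n\<in>I. x (transpose a b n)) \<in> measurable (gauss_prod I) (gauss_prod I)"
    unfolding gauss_prod_def by (rule measurable_restrict) (use I in \<open>auto intro: measurable_component_singleton\<close>)
  then show *: "(\<lambda>x. x \<circ> transpose a b) \<in> measurable (gauss_prod I) (gauss_prod I)"
    by (subst measurable_cong[where g = "\<lambda>x. \<lambda>n\<in>I. x (transpose a b n)", OF eq])
  have "distr (gauss_prod I) (gauss_prod I) (\<lambda>x. x \<circ> transpose a b)
      = distr (gauss_prod I) (gauss_prod I) (\<lambda>x. \<lambda>n\<in>I. x (transpose a b n))"
    by (rule distr_cong) (simp_all add: eq)
  also have "\<dots> = gauss_prod I"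
    unfolding gauss_prod_def
    by (rule distr_PiM_reindex) (use I in \<open>auto simp: prob_space_std_normal_measure intro: inj_on_subset[OF inj_transpose]\<close>)
  finally show "distr (gauss_prod I) (gauss_prod I) (\<lambda>x. x \<circ> transpose a b) = gauss_prod I" .
qed

lemma integral_gauss_prod_transpose:
  fixes f :: "('i \<Rightarrow> real) \<Rightarrow> real"
  assumes "a \<in> I" "b \<in> I" "f \<in> borel_measurable (gauss_prod I)"
  shows "(\<integral>x. f (x \<circ> transpose a b) \<partial>gauss_prod I) = integral\<^sup>L (gauss_prod I) f"
  using integral_distr[OF distr_gauss_prod_transpose(1)[OF assms(1,2)] assms(3)]
  unfolding distr_gauss_prod_transpose(2)[OF assms(1,2)] by (rule sym)

text \<open>A bound of product form factorizes into one-variable moments, is invariant under swaps,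
  and remains a polynomial bound in one variable when the others are fixed.\<close>

definition tempered :: "'i set \<Rightarrow> (('i \<Rightarrow> real) \<Rightarrow> real) \<Rightarrow> bool" where
  "tempered I f \<longleftrightarrow> f \<in> borel_measurable (gauss_prod I) \<and>
     (\<exists>C N. \<forall>x. \<bar>f x\<bar> \<le> C * (\<Prod>i\<in>I. 1 + \<bar>x i\<bar>) ^ N)"

lemma tempered_measurable: "tempered I f \<Longrightarrow> f \<in> borel_measurable (gauss_prod I)"
  unfolding tempered_def by (rule conjunct1)

lemma temperedI:
  "f \<in> borel_measurable (gauss_prod I) \<Longrightarrow> (\<And>x. \<bar>f x\<bar> \<le> C * (\<Prod>i\<in>I. 1 + \<bar>x i\<bar>) ^ N) \<Longrightarrow> tempered I f"
  unfolding tempered_def by (intro conjI exI allI)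

lemma prod_ge_one_abs: "1 \<le> (\<Prod>i\<in>I. 1 + \<bar>x i\<bar> :: real)"
  by (rule prod_ge_1) simp

lemma temperedE:
  assumes "tempered I f"
  obtains C N where "0 \<le> C" "\<And>x M. N \<le> M \<Longrightarrow> \<bar>f x\<bar> \<le> C * (\<Prod>i\<in>I. 1 + \<bar>x i\<bar>) ^ M"
proof -
  obtain C N where b: "\<And>x. \<bar>f x\<bar> \<le> C * (\<Prod>i\<in>I. 1 + \<bar>x i\<bar>) ^ N" using assms unfolding tempered_def by blast
  have C: "C \<ge> 0" using order.trans[OF abs_ge_zero b[of "\<lambda>_. 0"]] by simp
  have "\<bar>f x\<bar> \<le> C * (\<Prod>i\<in>I. 1 + \<bar>x i\<bar>) ^ M" if "N \<le> M" for x M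
    by (rule order.trans[OF b]) (intro mult_left_mono power_increasing that prod_ge_one_abs C)
  with C show thesis by (rule that)
qed

lemma tempered_integrable:
  assumes "finite I" "tempered I f"
  shows "integrable (gauss_prod I) f"
proof -
  obtain C N where "\<And>x M. N \<le> M \<Longrightarrow> \<bar>f x\<bar> \<le> C * (\<Prod>i\<in>I. 1 + \<bar>x i\<bar>) ^ M"
    using assms(2) by (rule temperedE) blast
  then have b: "\<bar>f x\<bar> \<le> C * (\<Prod>i\<in>I. 1 + \<bar>x i\<bar>) ^ N" for x by blast
  have "integrable (gauss_prod I) (\<lambda>x. C * (\<Prod>i\<in>I. (1 + \<bar>x i\<bar>) ^ N))"
    unfolding gauss_prod_def
    by (intro integrable_mult_right std_normal.product_integrable_prod assms integrable_std_normal_power)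
  then show ?thesis
    by (rule Bochner_Integration.integrable_bound)
      (use assms b in \<open>auto simp: tempered_measurable prod_power_distrib intro!: AE_I2 order.trans[OF b]\<close>)
qed

lemma tempered_const: "tempered I (\<lambda>_. c)"
  by (rule temperedI[where C = "\<bar>c\<bar>" and N = 0]) simp_all

lemma tempered_add:
  assumes "tempered I f" "tempered I g"
  shows "tempered I (\<lambda>x. f x + g x)"
proof -
  obtain C N where 1: "\<And>x M. N \<le> M \<Longrightarrow> \<bar>f x\<bar> \<le> C * (\<Prod>i\<in>I. 1 + \<bar>x i\<bar>) ^ M"
    using assms(1) by (rule temperedE) blast
  obtain D L where 2: "\<And>x M. L \<le> M \<Longrightarrow> \<bar>g x\<bar> \<le> D * (\<Prod>i\<in>I. 1 + \<bar>x i\<bar>) ^ M"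
    using assms(2) by (rule temperedE) blast
  have "\<bar>f x + g x\<bar> \<le> (C + D) * (\<Prod>i\<in>I. 1 + \<bar>x i\<bar>) ^ (N + L)" for x
    using 1[of "N + L" x] 2[of "N + L" x] by (simp add: distrib_right)
  then show ?thesis by (rule temperedI[rotated]) (intro borel_measurable_add tempered_measurable assms)
qed

lemma tempered_mult:
  assumes "tempered I f" "tempered I g"
  shows "tempered I (\<lambda>x. f x * g x)"
proof -
  obtain C N where 1: "0 \<le> C" "\<And>x M. N \<le> M \<Longrightarrow> \<bar>f x\<bar> \<le> C * (\<Prod>i\<in>I. 1 + \<bar>x i\<bar>) ^ M"
    using assms(1) by (rule temperedE) blast
  obtain D L where 2: "\<And>x M. L \<le> M \<Longrightarrow> \<bar>g x\<bar> \<le> D * (\<Prod>i\<in>I. 1 + \<bar>x i\<bar>) ^ M"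
    using assms(2) by (rule temperedE) blast
  have "\<bar>f x * g x\<bar> \<le> (C * D) * (\<Prod>i\<in>I. 1 + \<bar>x i\<bar>) ^ (N + L)" for x
    using mult_mono[OF 1(2)[OF order.refl, of x] 2[OF order.refl, of x]] 1(1)
    by (simp add: abs_mult power_add mult_ac prod_nonneg)
  then show ?thesis by (rule temperedI[rotated]) (intro borel_measurable_times tempered_measurable assms)
qed

lemma tempered_cmult: "tempered I f \<Longrightarrow> tempered I (\<lambda>x. c * f x)"
  by (intro tempered_mult tempered_const)

lemma tempered_diff: "tempered I f \<Longrightarrow> tempered I g \<Longrightarrow> tempered I (\<lambda>x. f x - g x)"
  using tempered_add[OF _ tempered_cmult[of I g "-1"]] by simp

lemma tempered_sum: "(\<And>j. j \<in> S \<Longrightarrow> tempered I (f j)) \<Longrightarrow> tempered I (\<lambda>x. \<Sum>j\<in>S. f j x)"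
  by (induction S rule: infinite_finite_induct) (auto intro: tempered_add tempered_const)

lemma tempered_prod: "(\<And>j. j \<in> S \<Longrightarrow> tempered I (f j)) \<Longrightarrow> tempered I (\<lambda>x. \<Prod>j\<in>S. f j x)"
  by (induction S rule: infinite_finite_induct) (auto intro: tempered_mult tempered_const)

lemma tempered_var:
  assumes "finite I" "i \<in> I" shows "tempered I (\<lambda>x. x i)"
proof -
  have "\<bar>x i\<bar> \<le> 1 * (\<Prod>i\<in>I. 1 + \<bar>x i\<bar>) ^ 1" for x :: "'a \<Rightarrow> real"
  proof -
    have "1 + \<bar>x i\<bar> \<le> (1 + \<bar>x i\<bar>) * (\<Prod>i\<in>I - {i}. 1 + \<bar>x i\<bar>)"
      using mult_left_mono[OF prod_ge_one_abs, of "1 + \<bar>x i\<bar>"] by simp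
    then show ?thesis using prod.remove[OF assms, of "\<lambda>i. 1 + \<bar>x i\<bar>"] by simp
  qed
  then show ?thesis by (rule temperedI[rotated]) (rule measurable_gauss_prod_component[OF assms(2)])
qed

lemma polyf_tempered: "polyf I d f \<Longrightarrow> finite I \<Longrightarrow> tempered I f"
  by (induction rule: polyf.induct) (auto intro: tempered_const tempered_add tempered_mult tempered_var)

lemma tempered_transpose:
  assumes "tempered I f" "a \<in> I" "b \<in> I"
  shows "tempered I (\<lambda>x. f (x \<circ> transpose a b))"
proof -
  obtain C N where b: "\<And>x. \<bar>f x\<bar> \<le> C * (\<Prod>i\<in>I. 1 + \<bar>x i\<bar>) ^ N" using assms unfolding tempered_def by blast
  have "(\<Prod>i\<in>I. 1 + \<bar>(x \<circ> transpose a b) i\<bar>) = (\<Prod>i\<in>I. 1 + \<bar>x i\<bar>)" for x :: "'a \<Rightarrow> real"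
    by (rule prod_transpose_cong) (use assms in auto)
  then have "\<bar>f (x \<circ> transpose a b)\<bar> \<le> C * (\<Prod>i\<in>I. 1 + \<bar>x i\<bar>) ^ N" for x
    using b[of "x \<circ> transpose a b"] by simp
  moreover have "(\<lambda>x. f (x \<circ> transpose a b)) \<in> borel_measurable (gauss_prod I)"
    using measurable_comp[OF distr_gauss_prod_transpose(1)[OF assms(2,3)] tempered_measurable[OF assms(1)]]
    by (simp add: o_def)
  ultimately show ?thesis by (rule temperedI[rotated])
qed

text \<open>Fubini, with the coordinate \<open>a\<close> integrated first.\<close>

lemma integral_gauss_prod_insert_zero:
  fixes f :: "('i \<Rightarrow> real) \<Rightarrow> real"
  assumes "finite I" "a \<in> I" "tempered I f"
    and "\<And>x. (\<integral>u. f (x(a := u)) \<partial>std_normal_measure) = 0"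
  shows "integral\<^sup>L (gauss_prod I) f = 0"
proof -
  have I: "insert a (I - {a}) = I" using assms by auto
  have "integrable (gauss_prod I) f" by (rule tempered_integrable) fact+
  then show ?thesis
    using std_normal.product_integral_insert[of "I - {a}" a f] assms
    unfolding I by (simp add: gauss_prod_def)
qed

section \<open>The weight, its derivative and integration by parts\<close>

lemma abs_powr_DERIV:
  fixes s u :: real
  assumes "1 < s"
  shows "((\<lambda>u. \<bar>u\<bar> powr s) has_real_derivative s * (\<bar>u\<bar> powr s / u)) (at u)"
proof -
  consider "u > 0" | "u < 0" | "u = 0" by linarith
  then show ?thesis
  proof cases
    case 1
    have "((\<lambda>u. u powr s) has_real_derivative s * u powr (s - 1)) (at u)"
      using has_real_derivative_powr[OF 1, of s] by simp
    then have "((\<lambda>u. \<bar>u\<bar> powr s) has_real_derivative s * u powr (s - 1)) (at u)"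
      by (rule has_field_derivative_transform_within_open[where S = "{0<..}"]) (use 1 in auto)
    then show ?thesis using 1 by (simp add: powr_diff)
  next
    case 2
    have "((\<lambda>u. (- u) powr s) has_real_derivative s * (- u) powr (s - 1) * (- 1)) (at u)"
      by (rule DERIV_chain2[OF has_real_derivative_powr]) (use 2 in \<open>auto intro!: derivative_eq_intros\<close>)
    then have "((\<lambda>u. \<bar>u\<bar> powr s) has_real_derivative s * (- u) powr (s - 1) * (- 1)) (at u)"
      by (rule has_field_derivative_transform_within_open[where S = "{..<0}"]) (use 2 in auto)
    then show ?thesis using 2 by (simp add: powr_diff)
  next
    \<comment> \<open>Division by zero gives the asserted derivative the value \<open>0\<close>
      here, which is correct because \<open>1 < s\<close>.\<close>
    case 3
    have "((\<lambda>h::real. \<bar>h\<bar> powr (s - 1)) \<longlongrightarrow> 0) (at 0)"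
    proof -
      have "((\<lambda>h::real. \<bar>h\<bar> powr (s - 1)) \<longlongrightarrow> \<bar>0\<bar> powr (s - 1)) (at 0)"
        using assms by (intro tendsto_powr' tendsto_intros) auto
      then show ?thesis using assms by simp
    qed
    then have "((\<lambda>h. \<bar>h\<bar> powr s / h) \<longlongrightarrow> 0) (at 0)"
    proof (rule Lim_null_comparison[rotated], intro eventuallyI)
      show "norm (\<bar>h\<bar> powr s / h) \<le> \<bar>h\<bar> powr (s - 1)" for h
        by (cases "h = 0") (auto simp: abs_divide powr_diff)
    qed
    then show ?thesis using 3 by (simp add: DERIV_def)
  qed
qed

lemma abs_powr_div_isCont:
  fixes s u :: real
  assumes "1 < s"
  shows "isCont (\<lambda>u. \<bar>u\<bar> powr s / u) u"
proof (cases "u = 0")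
  case True
  have "((\<lambda>h. \<bar>h\<bar> powr s / h) \<longlongrightarrow> 0) (at 0)"
    using abs_powr_DERIV[OF assms, of 0] by (simp add: DERIV_def)
  then show ?thesis using True by (simp add: isCont_def)
next
  case False
  have "isCont (\<lambda>u. \<bar>u\<bar> powr s) u" using abs_powr_DERIV[OF assms] by (rule DERIV_isCont)
  then show ?thesis using False by (intro continuous_intros) auto
qed

lemma abs_powr_le:
  fixes s u :: real
  assumes "0 \<le> s"
  shows "\<bar>u\<bar> powr s \<le> (1 + \<bar>u\<bar>) ^ nat \<lceil>s\<rceil>"
proof -
  have "\<bar>u\<bar> powr s \<le> (1 + \<bar>u\<bar>) powr s" using assms by (intro powr_mono2) auto
  also have "\<dots> \<le> (1 + \<bar>u\<bar>) powr real (nat \<lceil>s\<rceil>)" using assms by (intro powr_mono) auto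
  also have "\<dots> = (1 + \<bar>u\<bar>) ^ nat \<lceil>s\<rceil>" by (rule powr_realpow) auto
  finally show ?thesis .
qed

lemma abs_powr_div_le:
  fixes s u :: real
  assumes "1 \<le> s"
  shows "\<bar>\<bar>u\<bar> powr s / u\<bar> \<le> (1 + \<bar>u\<bar>) ^ nat \<lceil>s - 1\<rceil>"
proof -
  have "\<bar>\<bar>u\<bar> powr s / u\<bar> \<le> \<bar>u\<bar> powr (s - 1)"
    by (cases "u = 0") (auto simp: abs_divide powr_diff)
  also have "\<dots> \<le> (1 + \<bar>u\<bar>) ^ nat \<lceil>s - 1\<rceil>" using assms by (intro abs_powr_le) simp
  finally show ?thesis .
qed

lemma tempered_le:
  assumes "tempered I f" "g \<in> borel_measurable (gauss_prod I)" "\<And>x. \<bar>g x\<bar> \<le> \<bar>f x\<bar>"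
  shows "tempered I g"
proof -
  obtain C N where "\<And>x M. N \<le> M \<Longrightarrow> \<bar>f x\<bar> \<le> C * (\<Prod>i\<in>I. 1 + \<bar>x i\<bar>) ^ M"
    using assms(1) by (rule temperedE) blast
  then have "\<bar>g x\<bar> \<le> C * (\<Prod>i\<in>I. 1 + \<bar>x i\<bar>) ^ N" for x using assms(3)[of x] by (meson order.refl order.trans)
  with assms(2) show ?thesis by (rule temperedI)
qed

lemma tempered_abs: "tempered I f \<Longrightarrow> tempered I (\<lambda>x. \<bar>f x\<bar>)"
  by (rule tempered_le) (auto intro: borel_measurable_abs tempered_measurable)

lemma tempered_power: "tempered I f \<Longrightarrow> tempered I (\<lambda>x. f x ^ k)"
  by (induction k) (auto intro: tempered_const tempered_mult)

lemma tempered_abs_powr: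
  assumes "tempered I f" "0 \<le> s"
  shows "tempered I (\<lambda>x. \<bar>f x\<bar> powr s)"
proof (rule tempered_le)
  show "tempered I (\<lambda>x. (1 + \<bar>f x\<bar>) ^ nat \<lceil>s\<rceil>)"
    by (intro tempered_power tempered_add tempered_const tempered_abs assms)
  have [measurable]: "f \<in> borel_measurable (gauss_prod I)" using assms(1) by (rule tempered_measurable)
  show "(\<lambda>x. \<bar>f x\<bar> powr s) \<in> borel_measurable (gauss_prod I)" by measurable
  show "\<bar>\<bar>f x\<bar> powr s\<bar> \<le> \<bar>(1 + \<bar>f x\<bar>) ^ nat \<lceil>s\<rceil>\<bar>" for x using abs_powr_le[OF assms(2)] by simp
qed

lemma tempered_abs_powr_div:
  assumes "tempered I f" "1 \<le> s"
  shows "tempered I (\<lambda>x. \<bar>f x\<bar> powr s / f x)"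
proof (rule tempered_le)
  show "tempered I (\<lambda>x. (1 + \<bar>f x\<bar>) ^ nat \<lceil>s - 1\<rceil>)"
    by (intro tempered_power tempered_add tempered_const tempered_abs assms)
  have [measurable]: "f \<in> borel_measurable (gauss_prod I)" using assms(1) by (rule tempered_measurable)
  show "(\<lambda>x. \<bar>f x\<bar> powr s / f x) \<in> borel_measurable (gauss_prod I)" by measurable
  show "\<bar>\<bar>f x\<bar> powr s / f x\<bar> \<le> \<bar>(1 + \<bar>f x\<bar>) ^ nat \<lceil>s - 1\<rceil>\<bar>" for x
    using abs_powr_div_le[OF assms(2), of "f x"] by simp
qed

definition wt :: "'i::linorder set \<Rightarrow> real \<Rightarrow> ('i \<Rightarrow> real) \<Rightarrow> real" where
  "wt S \<gamma> x = pair_prod S (\<lambda>i j. \<bar>x i - x j\<bar> powr (2 * \<gamma>))"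

lemma wt_nonneg: "0 \<le> wt S \<gamma> x"
  unfolding wt_def pair_prod_def by (rule prod_nonneg) auto

lemma wt_remove:
  assumes "finite S" "a \<in> S"
  shows "wt S \<gamma> x = (\<Prod>j\<in>S - {a}. \<bar>x a - x j\<bar> powr (2 * \<gamma>)) * wt (S - {a}) \<gamma> x"
proof -
  have "(\<Prod>j\<in>S - {a}. if a < j then \<bar>x a - x j\<bar> powr (2 * \<gamma>) else \<bar>x j - x a\<bar> powr (2 * \<gamma>))
      = (\<Prod>j\<in>S - {a}. \<bar>x a - x j\<bar> powr (2 * \<gamma>))"
    by (rule prod.cong) (auto simp: abs_minus_commute)
  then show ?thesis unfolding wt_def pair_prod_remove[OF assms] by simp
qed

lemma wt_transpose:
  assumes "finite S" "a \<in> S" "b \<in> S"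
  shows "wt S \<gamma> (x \<circ> transpose a b) = wt S \<gamma> x"
  unfolding wt_def
  using pair_prod_transpose[OF assms, of "\<lambda>i j. \<bar>x i - x j\<bar> powr (2 * \<gamma>)"] by (simp add: abs_minus_commute)

text \<open>Two equal coordinates produce a factor \<open>0 powr (2 * \<gamma>)\<close>, which is
  zero in HOL even for \<open>\<gamma> = 0\<close>. Identities under the weight thus have to be
  checked only at points with distinct coordinates.\<close>

lemma wt_not_inj:
  assumes "finite S" "\<not> inj_on x S"
  shows "wt S \<gamma> x = 0"
proof -
  obtain a b where ab: "a \<in> S" "b \<in> S" "a \<noteq> b" "x a = x b" using assms(2) by (auto simp: inj_on_def)
  have "(\<Prod>j\<in>S - {a}. \<bar>x a - x j\<bar> powr (2 * \<gamma>)) = 0"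
    by (rule prod_zero) (use assms(1) ab in auto)
  then show ?thesis unfolding wt_remove[OF assms(1) ab(1)] by simp
qed

lemma wt_upd:
  assumes "finite S" "a \<in> S"
  shows "wt S \<gamma> (x(a := u)) = (\<Prod>j\<in>S - {a}. \<bar>u - x j\<bar> powr (2 * \<gamma>)) * wt (S - {a}) \<gamma> x"
proof -
  have "wt (S - {a}) \<gamma> (x(a := u)) = wt (S - {a}) \<gamma> x"
    unfolding wt_def by (rule pair_prod_cong) auto
  moreover have "(\<Prod>j\<in>S - {a}. \<bar>(x(a := u)) a - (x(a := u)) j\<bar> powr (2 * \<gamma>)) = (\<Prod>j\<in>S - {a}. \<bar>u - x j\<bar> powr (2 * \<gamma>))"
    by (rule prod.cong) auto
  ultimately show ?thesis unfolding wt_remove[OF assms] by simp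
qed

lemma wt_tempered:
  assumes "finite I" "S \<subseteq> I" "0 \<le> \<gamma>"
  shows "tempered I (wt S \<gamma>)"
proof -
  have "tempered I (\<lambda>x. \<Prod>p\<in>{(i, j). i \<in> S \<and> j \<in> S \<and> i < j}. \<bar>x (fst p) - x (snd p)\<bar> powr (2 * \<gamma>))"
    using assms by (intro tempered_prod tempered_abs_powr tempered_diff tempered_var) auto
  then show ?thesis by (simp add: wt_def[abs_def] pair_prod_def case_prod_unfold)
qed

text \<open>The division concerns a single factor
  \<open>\<bar>u\<bar> powr (2 * \<gamma>) / u\<close>, whose growth is polynomial because the
  exponent is at least \<open>1\<close>.\<close>

lemma wt_div_tempered:
  assumes "finite I" "a \<in> I" "j \<in> I - {a}" "1 \<le> \<gamma>"
  shows "tempered I (\<lambda>x. wt I \<gamma> x / (x a - x j))"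
proof -
  have eq: "wt I \<gamma> x / (x a - x j) = \<bar>x a - x j\<bar> powr (2 * \<gamma>) / (x a - x j) *
      ((\<Prod>k\<in>I - {a} - {j}. \<bar>x a - x k\<bar> powr (2 * \<gamma>)) * wt (I - {a}) \<gamma> x)" for x
    unfolding wt_remove[OF assms(1,2)]
    using prod.remove[of "I - {a}" j "\<lambda>k. \<bar>x a - x k\<bar> powr (2 * \<gamma>)"] assms by simp
  show ?thesis unfolding eq
    using assms by (intro tempered_mult tempered_abs_powr_div tempered_prod tempered_abs_powr tempered_diff
        tempered_var wt_tempered) auto
qed

lemma wt_upd_DERIV:
  assumes "finite I" "a \<in> I" "1 \<le> \<gamma>"
  shows "((\<lambda>u. wt I \<gamma> (x(a := u))) has_real_derivative
      (\<Sum>j\<in>I - {a}. 2 * \<gamma> * (wt I \<gamma> (x(a := u)) / (u - x j)))) (at u)"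
    and "isCont (\<lambda>u. \<Sum>j\<in>I - {a}. 2 * \<gamma> * (wt I \<gamma> (x(a := u)) / (u - x j))) u"
proof -
  have s: "1 < 2 * \<gamma>" using assms by simp
  define r where "r j u = \<bar>u - x j\<bar> powr (2 * \<gamma>) / (u - x j)" for j u
  have eq: "2 * \<gamma> * (wt I \<gamma> (x(a := u)) / (u - x j))
      = 2 * \<gamma> * r j u * (\<Prod>k\<in>I - {a} - {j}. \<bar>u - x k\<bar> powr (2 * \<gamma>)) * wt (I - {a}) \<gamma> x"
    if "j \<in> I - {a}" for j u
    unfolding wt_upd[OF assms(1,2)] r_def
    using prod.remove[of "I - {a}" j "\<lambda>k. \<bar>u - x k\<bar> powr (2 * \<gamma>)"] assms that by simp
  have d: "((\<lambda>u. \<bar>u - x j\<bar> powr (2 * \<gamma>)) has_real_derivative 2 * \<gamma> * r j u) (at u)" for j u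
    unfolding r_def by (rule DERIV_chain2[OF abs_powr_DERIV[OF s], THEN DERIV_cong]) (auto intro!: derivative_eq_intros)
  have "((\<lambda>u. (\<Prod>j\<in>I - {a}. \<bar>u - x j\<bar> powr (2 * \<gamma>)) * wt (I - {a}) \<gamma> x) has_real_derivative
    (\<Sum>j\<in>I - {a}. 2 * \<gamma> * r j u * (\<Prod>k\<in>I - {a} - {j}. \<bar>u - x k\<bar> powr (2 * \<gamma>))) * wt (I - {a}) \<gamma> x) (at u)"
    by (rule DERIV_cmult_right[OF has_field_derivative_prod[OF d]])
  also have "(\<Sum>j\<in>I - {a}. 2 * \<gamma> * r j u * (\<Prod>k\<in>I - {a} - {j}. \<bar>u - x k\<bar> powr (2 * \<gamma>))) * wt (I - {a}) \<gamma> x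
      = (\<Sum>j\<in>I - {a}. 2 * \<gamma> * (wt I \<gamma> (x(a := u)) / (u - x j)))"
    unfolding sum_distrib_right by (rule sum.cong[OF refl]) (simp only: eq)
  finally show "((\<lambda>u. wt I \<gamma> (x(a := u))) has_real_derivative
      (\<Sum>j\<in>I - {a}. 2 * \<gamma> * (wt I \<gamma> (x(a := u)) / (u - x j)))) (at u)"
    unfolding wt_upd[OF assms(1,2)] .
  have "isCont (r j) u" for j
    unfolding r_def[abs_def] by (rule continuous_within_compose3[OF abs_powr_div_isCont[OF s]]) (intro continuous_intros)
  moreover have "isCont (\<lambda>u. \<bar>u - x k\<bar> powr (2 * \<gamma>)) u" for k
    using d by (rule DERIV_isCont)
  ultimately have "isCont (\<lambda>u. \<Sum>j\<in>I - {a}. 2 * \<gamma> * r j u * (\<Prod>k\<in>I - {a} - {j}. \<bar>u - x k\<bar> powr (2 * \<gamma>)) * wt (I - {a}) \<gamma> x) u"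
    by (intro continuous_sum continuous_mult continuous_prod continuous_const)
  moreover have "(\<lambda>u. \<Sum>j\<in>I - {a}. 2 * \<gamma> * r j u * (\<Prod>k\<in>I - {a} - {j}. \<bar>u - x k\<bar> powr (2 * \<gamma>)) * wt (I - {a}) \<gamma> x)
      = (\<lambda>u. \<Sum>j\<in>I - {a}. 2 * \<gamma> * (wt I \<gamma> (x(a := u)) / (u - x j)))"
    by (intro ext sum.cong refl eq[symmetric])
  ultimately show "isCont (\<lambda>u. \<Sum>j\<in>I - {a}. 2 * \<gamma> * (wt I \<gamma> (x(a := u)) / (u - x j))) u"
    by (simp only:)
qed

text \<open>This is \<open>stein_identity\<close> for \<open>h\<close> times the weight along the
  coordinate \<open>a\<close>; the sum over \<open>j\<close> comes from the derivative of the
  weight.\<close>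

lemma integration_by_parts:
  assumes I: "finite I" "a \<in> I" and \<gamma>: "1 \<le> \<gamma>" and h: "polyf I d h" and p: "polyf I e p"
    and D: "\<And>x. ((\<lambda>u. h (x(a := u))) has_real_derivative p x) (at (x a))"
  shows "(\<integral>x. p x * wt I \<gamma> x + (\<Sum>j\<in>I - {a}. 2 * \<gamma> * (h x * (wt I \<gamma> x / (x a - x j))))
      - x a * (h x * wt I \<gamma> x) \<partial>gauss_prod I) = 0"
proof (rule integral_gauss_prod_insert_zero[OF I])
  note t = polyf_tempered[OF h I(1)] polyf_tempered[OF p I(1)] wt_tempered[OF I(1) order.refl, of \<gamma>]
  show "tempered I (\<lambda>x. p x * wt I \<gamma> x + (\<Sum>j\<in>I - {a}. 2 * \<gamma> * (h x * (wt I \<gamma> x / (x a - x j))))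
      - x a * (h x * wt I \<gamma> x))"
    using \<gamma> I by (intro tempered_diff tempered_add tempered_sum tempered_cmult tempered_mult t wt_div_tempered
        tempered_var) auto
  fix x :: "'a \<Rightarrow> real"
  let ?w = "\<lambda>u. wt I \<gamma> (x(a := u))"
  let ?w' = "\<lambda>u. \<Sum>j\<in>I - {a}. 2 * \<gamma> * (wt I \<gamma> (x(a := u)) / (u - x j))"
  have D': "((\<lambda>u. h (x(a := u))) has_real_derivative p (x(a := u))) (at u)" for u
    using D[of "x(a := u)"] by simp
  obtain q where q: "\<And>x. ((\<lambda>u. p (x(a := u))) has_real_derivative q x) (at (x a))"
    using polyf_deriv[OF I p] by blast
  have contp: "isCont (\<lambda>u. p (x(a := u))) u" for u
    using DERIV_isCont[OF q[of "x(a := u)"]] by simp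
  have conth: "isCont (\<lambda>u. h (x(a := u))) u" for u using D' by (rule DERIV_isCont)
  have contw: "isCont ?w u" for u using wt_upd_DERIV(1)[OF I \<gamma>] by (rule DERIV_isCont)
  have "tempered I (\<lambda>x. h x * wt I \<gamma> x)" using \<gamma> by (intro tempered_mult t) auto
  then obtain C N where b: "\<And>x. \<bar>h x * wt I \<gamma> x\<bar> \<le> C * (\<Prod>i\<in>I. 1 + \<bar>x i\<bar>) ^ N"
    unfolding tempered_def by blast
  have S: "(\<integral>u. (h (x(a := u)) * ?w' u + p (x(a := u)) * ?w u) - u * (h (x(a := u)) * ?w u) \<partial>std_normal_measure) = 0"
  proof (rule stein_identity)
    show "((\<lambda>u. h (x(a := u)) * ?w u) has_real_derivative h (x(a := u)) * ?w' u + p (x(a := u)) * ?w u) (at u)" for u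
      by (rule DERIV_mult'[OF D' wt_upd_DERIV(1)[OF I \<gamma>]])
    show "isCont (\<lambda>u. h (x(a := u)) * ?w' u + p (x(a := u)) * ?w u) u" for u
      by (intro isCont_add isCont_mult conth contp contw wt_upd_DERIV(2)[OF I \<gamma>])
    show "\<bar>h (x(a := u)) * ?w u\<bar> \<le> (C * (\<Prod>i\<in>I - {a}. 1 + \<bar>x i\<bar>) ^ N) * (1 + \<bar>u\<bar>) ^ N" for u
    proof -
      have "(\<Prod>i\<in>I. 1 + \<bar>(x(a := u)) i\<bar>) = (1 + \<bar>u\<bar>) * (\<Prod>i\<in>I - {a}. 1 + \<bar>x i\<bar>)"
        unfolding prod.remove[OF I] by (auto intro!: prod.cong)
      then show ?thesis using b[of "x(a := u)"] by (simp add: power_mult_distrib mult_ac)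
    qed
  qed
  have eq: "p (x(a := u)) * ?w u + (\<Sum>j\<in>I - {a}. 2 * \<gamma> * (h (x(a := u)) * (?w u / ((x(a := u)) a - (x(a := u)) j))))
      - (x(a := u)) a * (h (x(a := u)) * ?w u)
    = (h (x(a := u)) * ?w' u + p (x(a := u)) * ?w u) - u * (h (x(a := u)) * ?w u)" for u
  proof -
    have "(\<Sum>j\<in>I - {a}. 2 * \<gamma> * (h (x(a := u)) * (?w u / ((x(a := u)) a - (x(a := u)) j)))) = h (x(a := u)) * ?w' u"
      unfolding sum_distrib_left by (rule sum.cong) auto
    then show ?thesis by simp
  qed
  show "(\<integral>u. p (x(a := u)) * ?w u + (\<Sum>j\<in>I - {a}. 2 * \<gamma> * (h (x(a := u)) * (?w u / ((x(a := u)) a - (x(a := u)) j))))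
      - (x(a := u)) a * (h (x(a := u)) * ?w u) \<partial>std_normal_measure) = 0"
    unfolding eq by (rule S)
qed

section \<open>The recursion in the size of the block\<close>

text \<open>Not normalized: the average of the constant \<open>1\<close> is Mehta's
  integral.\<close>

definition avg :: "'i::linorder set \<Rightarrow> real \<Rightarrow> (('i \<Rightarrow> real) \<Rightarrow> real) \<Rightarrow> real" where
  "avg I \<gamma> f = (\<integral>x. f x * wt I \<gamma> x \<partial>gauss_prod I)"

lemma avg_cong:
  assumes "finite I" "\<And>x. inj_on x I \<Longrightarrow> f x = g x"
  shows "avg I \<gamma> f = avg I \<gamma> g"
proof -
  have "f x * wt I \<gamma> x = g x * wt I \<gamma> x" for x
    using assms(2)[of x] wt_not_inj[OF assms(1), of x \<gamma>] by (cases "inj_on x I") auto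
  then show ?thesis by (simp only: avg_def)
qed

lemma avg_integrable:
  assumes "finite I" "0 \<le> \<gamma>" "tempered I f"
  shows "integrable (gauss_prod I) (\<lambda>x. f x * wt I \<gamma> x)"
  using assms by (intro tempered_integrable tempered_mult wt_tempered) auto

lemma avg_add:
  assumes "finite I" "0 \<le> \<gamma>" "tempered I f" "tempered I g"
  shows "avg I \<gamma> (\<lambda>x. f x + g x) = avg I \<gamma> f + avg I \<gamma> g"
  unfolding avg_def distrib_right
  by (intro Bochner_Integration.integral_add avg_integrable assms)

lemma avg_cmult: "avg I \<gamma> (\<lambda>x. c * f x) = c * avg I \<gamma> f"
  unfolding avg_def by (simp add: mult.assoc)

lemma avg_sum:
  assumes "finite I" "0 \<le> \<gamma>" "\<And>j. j \<in> S \<Longrightarrow> tempered I (f j)"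
  shows "avg I \<gamma> (\<lambda>x. \<Sum>j\<in>S. f j x) = (\<Sum>j\<in>S. avg I \<gamma> (f j))"
  unfolding avg_def sum_distrib_right
  by (intro Bochner_Integration.integral_sum avg_integrable assms)

lemma avg_transpose:
  assumes "finite I" "0 \<le> \<gamma>" "a \<in> I" "b \<in> I" "tempered I f"
  shows "avg I \<gamma> (\<lambda>x. f (x \<circ> transpose a b)) = avg I \<gamma> f"
  unfolding avg_def
  using integral_gauss_prod_transpose[OF assms(3,4) tempered_measurable, of "\<lambda>x. f x * wt I \<gamma> x"]
    tempered_mult[OF assms(5) wt_tempered[OF assms(1) order.refl assms(2)]]
  by (simp only: wt_transpose[OF assms(1,3,4)])

lemma integral_antisymmetric:
  fixes f :: "('i \<Rightarrow> real) \<Rightarrow> real"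
  assumes "a \<in> I" "b \<in> I" "f \<in> borel_measurable (gauss_prod I)" "\<And>x. f (x \<circ> transpose a b) = - f x"
  shows "integral\<^sup>L (gauss_prod I) f = 0"
  using integral_gauss_prod_transpose[OF assms(1-3)] by (simp add: assms(4))

lemma transpose_comp_twice: "x \<circ> transpose a b \<circ> transpose a b = x"
  by (simp add: comp_assoc)

text \<open>A Dunkl operator is no derivation. Once the difference quotients are compared with the
  term from the derivative of the weight, the defect at \<open>j\<close> is \<open>A j\<close>,
  which is odd under the swap of \<open>a\<close> and \<open>j\<close> and integrates to
  zero.\<close>

lemma avg_dunkl:
  assumes I: "finite I" "a \<in> I" and \<gamma>: "1 \<le> \<gamma>"
    and f: "polyf I d f" "dunkl I \<gamma> a f f'" "tempered I f'"
    and g: "polyf I e g" "dunkl I \<gamma> a g g'" "tempered I g'"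
  shows "avg I \<gamma> (\<lambda>x. x a * (g x * f x)) = avg I \<gamma> (\<lambda>x. g' x * f x) + avg I \<gamma> (\<lambda>x. g x * f' x)"
proof -
  obtain pf where pf: "polyf I d pf" "\<And>x. ((\<lambda>u. f (x(a := u))) has_real_derivative pf x) (at (x a))"
    using polyf_deriv[OF I f(1)] by blast
  obtain pg where pg: "polyf I e pg" "\<And>x. ((\<lambda>u. g (x(a := u))) has_real_derivative pg x) (at (x a))"
    using polyf_deriv[OF I g(1)] by blast
  let ?s = "\<lambda>j x. x \<circ> transpose a j"
  \<comment> \<open>\<open>dunkl\<close> asserts only that some partial derivative exists;
    uniqueness of derivatives identifies it with the polynomial \<open>pf\<close>.\<close>
  have f': "f' x = pf x + \<gamma> * (\<Sum>j\<in>I - {a}. (f x - f (?s j x)) / (x a - x j))" if "inj_on x I" for x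
    using f(2) pf(2) that unfolding dunkl_def by (metis DERIV_unique)
  have g': "g' x = pg x + \<gamma> * (\<Sum>j\<in>I - {a}. (g x - g (?s j x)) / (x a - x j))" if "inj_on x I" for x
    using g(2) pg(2) that unfolding dunkl_def by (metis DERIV_unique)
  define h where "h x = g x * f x" for x
  define p where "p x = g x * pf x + pg x * f x" for x
  have h: "polyf I (e + d) h" unfolding h_def[abs_def] by (intro polyf_mult f g)
  have p: "polyf I (e + d) p" unfolding p_def[abs_def] by (intro polyf_add polyf_mult pf pg f g)
  have D: "((\<lambda>u. h (x(a := u))) has_real_derivative p x) (at (x a))" for x
  proof -
    have "((\<lambda>u. g (x(a := u)) * f (x(a := u))) has_real_derivative
        g (x(a := x a)) * pf x + pg x * f (x(a := x a))) (at (x a))"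
      by (rule DERIV_mult'[OF pg(2) pf(2)])
    then show ?thesis unfolding h_def[abs_def] p_def fun_upd_triv .
  qed
  let ?w = "wt I \<gamma>"
  define A where "A j x = (g (?s j x) * f x + g x * f (?s j x)) * (?w x / (x a - x j))" for j x
  define L where "L x = p x * ?w x + (\<Sum>j\<in>I - {a}. 2 * \<gamma> * (h x * (?w x / (x a - x j)))) - x a * (h x * ?w x)" for x
  note t = polyf_tempered[OF f(1) I(1)] polyf_tempered[OF g(1) I(1)] polyf_tempered[OF h I(1)]
    polyf_tempered[OF p I(1)] f(3) g(3)
  have tw: "tempered I ?w" using \<gamma> by (intro wt_tempered I) auto
  have tA: "tempered I (A j)" if "j \<in> I - {a}" for j
    unfolding A_def[abs_def] using that
    by (intro tempered_mult tempered_add tempered_transpose t wt_div_tempered I \<gamma>) auto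
  have tL: "tempered I L"
    unfolding L_def[abs_def]
    by (intro tempered_diff tempered_add tempered_sum tempered_cmult tempered_mult t tw wt_div_tempered I \<gamma> tempered_var)
  have A0: "integral\<^sup>L (gauss_prod I) (A j) = 0" if j: "j \<in> I - {a}" for j
  proof (rule integral_antisymmetric)
    fix x
    have "?w (?s j x) = ?w x" using j by (intro wt_transpose I) auto
    moreover have "?w x / (x j - x a) = - (?w x / (x a - x j))"
      by (metis minus_diff_eq minus_divide_right)
    ultimately show "A j (?s j x) = - A j x"
      unfolding A_def transpose_comp_twice by (simp add: algebra_simps)
  qed (use j I tA[THEN tempered_measurable] in auto)
  have eq: "(g' x * f x + g x * f' x) * ?w x = L x + x a * (h x * ?w x) - \<gamma> * (\<Sum>j\<in>I - {a}. A j x)" for x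
  proof (cases "inj_on x I")
    case True
    have "2 * (h x * (?w x / (x a - x j))) - A j x
        = ((g x - g (?s j x)) / (x a - x j)) * (f x * ?w x) + (f x - f (?s j x)) / (x a - x j) * (g x * ?w x)" for j
      unfolding A_def h_def by (simp add: algebra_simps add_divide_distrib diff_divide_distrib)
    then have "(\<Sum>j\<in>I - {a}. 2 * (h x * (?w x / (x a - x j)))) - (\<Sum>j\<in>I - {a}. A j x)
      = (\<Sum>j\<in>I - {a}. (g x - g (?s j x)) / (x a - x j)) * (f x * ?w x)
        + (\<Sum>j\<in>I - {a}. (f x - f (?s j x)) / (x a - x j)) * (g x * ?w x)"
      by (simp only: sum_subtractf[symmetric] sum.distrib sum_distrib_right)
    then have "\<gamma> * (\<Sum>j\<in>I - {a}. 2 * (h x * (?w x / (x a - x j)))) - \<gamma> * (\<Sum>j\<in>I - {a}. A j x)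
      = (\<gamma> * (\<Sum>j\<in>I - {a}. (g x - g (?s j x)) / (x a - x j))) * (f x * ?w x)
        + (\<gamma> * (\<Sum>j\<in>I - {a}. (f x - f (?s j x)) / (x a - x j))) * (g x * ?w x)"
      by (metis (no_types, lifting) distrib_left mult.assoc right_diff_distrib)
    moreover have "(\<Sum>j\<in>I - {a}. 2 * \<gamma> * (h x * (?w x / (x a - x j)))) = \<gamma> * (\<Sum>j\<in>I - {a}. 2 * (h x * (?w x / (x a - x j))))"
      by (simp add: sum_distrib_left mult_ac)
    ultimately show ?thesis
      unfolding L_def f'[OF True] g'[OF True] by (simp add: p_def algebra_simps)
  next
    case False
    then show ?thesis by (simp add: L_def A_def wt_not_inj[OF I(1)])
  qed
  have "avg I \<gamma> (\<lambda>x. g' x * f x) + avg I \<gamma> (\<lambda>x. g x * f' x) = avg I \<gamma> (\<lambda>x. g' x * f x + g x * f' x)"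
    using \<gamma> by (intro avg_add[symmetric] I tempered_mult t) auto
  also have "\<dots> = (\<integral>x. L x + x a * (h x * ?w x) - \<gamma> * (\<Sum>j\<in>I - {a}. A j x) \<partial>gauss_prod I)"
    unfolding avg_def eq ..
  also have "\<dots> = integral\<^sup>L (gauss_prod I) L + (\<integral>x. x a * (h x * ?w x) \<partial>gauss_prod I)
      - \<gamma> * (\<Sum>j\<in>I - {a}. integral\<^sup>L (gauss_prod I) (A j))"
  proof -
    have i1: "integrable (gauss_prod I) L" by (rule tempered_integrable[OF I(1) tL])
    have i2: "integrable (gauss_prod I) (\<lambda>x. x a * (h x * ?w x))"
      by (intro tempered_integrable tempered_mult tempered_var I t tw)
    have i3: "integrable (gauss_prod I) (A j)" if "j \<in> I - {a}" for j
      by (rule tempered_integrable[OF I(1) tA[OF that]])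
    have "(\<integral>x. L x + x a * (h x * ?w x) - \<gamma> * (\<Sum>j\<in>I - {a}. A j x) \<partial>gauss_prod I)
      = (\<integral>x. L x + x a * (h x * ?w x) \<partial>gauss_prod I) - (\<integral>x. \<gamma> * (\<Sum>j\<in>I - {a}. A j x) \<partial>gauss_prod I)"
      by (intro Bochner_Integration.integral_diff Bochner_Integration.integrable_add i1 i2
          integrable_mult_right Bochner_Integration.integrable_sum i3)
    also have "(\<integral>x. L x + x a * (h x * ?w x) \<partial>gauss_prod I)
      = integral\<^sup>L (gauss_prod I) L + (\<integral>x. x a * (h x * ?w x) \<partial>gauss_prod I)"
      by (intro Bochner_Integration.integral_add i1 i2)
    also have "(\<integral>x. \<gamma> * (\<Sum>j\<in>I - {a}. A j x) \<partial>gauss_prod I) = \<gamma> * (\<Sum>j\<in>I - {a}. integral\<^sup>L (gauss_prod I) (A j))"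
      using Bochner_Integration.integral_sum[of "I - {a}" "gauss_prod I" A, OF i3] by simp
    finally show ?thesis .
  qed
  also have "integral\<^sup>L (gauss_prod I) L = 0"
    unfolding L_def[abs_def] by (rule integration_by_parts[OF I \<gamma> h p D])
  also have "(\<Sum>j\<in>I - {a}. integral\<^sup>L (gauss_prod I) (A j)) = 0"
    by (rule sum.neutral) (use A0 in auto)
  finally show ?thesis by (simp add: avg_def h_def mult.assoc)
qed

text \<open>The bound is \<open>0 + 1 + ... + (card A - 1)\<close>, since a maximum is at least the
  number of smaller elements.\<close>

lemma choose_2_le_sum:
  fixes A :: "nat set"
  shows "finite A \<Longrightarrow> card A choose 2 \<le> \<Sum>A"
proof (induction rule: finite_linorder_max_induct)
  case (insert b A)
  have "card A \<le> card {..<b}" by (rule card_mono) (use insert in auto)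
  moreover have "b \<notin> A" using insert by auto
  ultimately show ?case using insert by (simp add: numeral_2_eq_2)
qed simp

lemma not_inj_on_of_sum_less:
  fixes \<alpha> :: "'i \<Rightarrow> nat"
  assumes "finite S" "sum \<alpha> S < card S choose 2"
  obtains i j where "i \<in> S" "j \<in> S" "i \<noteq> j" "\<alpha> i = \<alpha> j"
proof -
  have "\<not> inj_on \<alpha> S"
  proof
    assume inj: "inj_on \<alpha> S"
    then show False using choose_2_le_sum[of "\<alpha> ` S"] assms by (simp add: card_image sum.reindex)
  qed
  then show thesis using that unfolding inj_on_def by blast
qed


context dunkl_block begin

lemma finite_I: "finite I" and a_in_I: "a \<in> I" by simp_all

lemma tempered_F: "j \<le> m \<Longrightarrow> tempered I (F j)"
  using polyf_tempered[OF polyf_F finite_I] .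

text \<open>
  A monomial of too low degree has equal exponents at two indices of the block, so swapping these
  indices fixes it and changes the sign of \<open>V\<close>.
\<close>
lemma avg_orthogonal:
  assumes \<gamma>: "1 \<le> \<gamma>"
  shows "j \<le> m \<Longrightarrow> polyf I d g \<Longrightarrow> d + j < (m choose 2) + m \<Longrightarrow> avg I \<gamma> (\<lambda>x. g x * F j x) = 0"
proof (induction j arbitrary: d g)
  case 0
  have tV: "tempered I V" using tempered_F[of 0] by (simp add: F_0[abs_def])
  obtain \<sigma> where \<sigma>: "\<And>x. V x = \<sigma> * vdm (insert a B) x" using V_eq_vdm by blast
  have "tempered I g \<and> avg I \<gamma> (\<lambda>x. g x * V x) = 0"
  proof (rule polyf_monomials[OF finite_I 0(2)])
    fix c and \<alpha> :: "'i \<Rightarrow> nat" assume \<alpha>: "sum \<alpha> I \<le> d"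
    let ?M = "\<lambda>x :: 'i \<Rightarrow> real. c * (\<Prod>i\<in>I. x i ^ \<alpha> i)"
    have tM: "tempered I ?M" by (intro tempered_cmult tempered_prod tempered_power tempered_var finite_I)
    have "sum \<alpha> (insert a B) \<le> sum \<alpha> I" by (rule sum_mono2) (use finite_I in auto)
    then have "sum \<alpha> (insert a B) < card (insert a B) choose 2"
      using \<alpha> 0(3) by (simp add: numeral_2_eq_2)
    then obtain i j where ij: "i \<in> insert a B" "j \<in> insert a B" "i \<noteq> j" "\<alpha> i = \<alpha> j"
      using not_inj_on_of_sum_less[of "insert a B" \<alpha>] fin by blast
    then have ijI: "i \<in> I" "j \<in> I" by auto
    have "(\<integral>x. (?M x * V x) * wt I \<gamma> x \<partial>gauss_prod I) = 0"
    proof (rule integral_antisymmetric[OF ijI])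
      show "(\<lambda>x. ?M x * V x * wt I \<gamma> x) \<in> borel_measurable (gauss_prod I)"
        using \<gamma> by (intro tempered_measurable tempered_mult tM tV wt_tempered finite_I) auto
      fix x :: "'i \<Rightarrow> real"
      have bij: "bij_betw (transpose i j) I I" using ijI by (simp add: bij_betw_transpose_iff)
      have \<alpha>ij: "\<alpha> (transpose i j k) = \<alpha> k" for k
        using ij(4) by (cases "k = i"; cases "k = j") auto
      have "(\<Prod>k\<in>I. (x \<circ> transpose i j) k ^ \<alpha> k) = (\<Prod>k\<in>I. x (transpose i j k) ^ \<alpha> (transpose i j k))"
        by (simp add: \<alpha>ij)
      also have "\<dots> = (\<Prod>k\<in>I. x k ^ \<alpha> k)"
        by (rule prod.reindex_bij_betw[OF bij])
      finally have "(\<Prod>k\<in>I. (x \<circ> transpose i j) k ^ \<alpha> k) = (\<Prod>k\<in>I. x k ^ \<alpha> k)" .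
      moreover have "V (x \<circ> transpose i j) = - V x"
        unfolding \<sigma> using vdm_transpose[OF _ ij(1,2,3), of x] fin by simp
      moreover have "wt I \<gamma> (x \<circ> transpose i j) = wt I \<gamma> x" by (rule wt_transpose[OF finite_I ijI])
      ultimately show "?M (x \<circ> transpose i j) * V (x \<circ> transpose i j) * wt I \<gamma> (x \<circ> transpose i j) = - (?M x * V x * wt I \<gamma> x)"
        by simp
    qed
    with tM show "tempered I ?M \<and> avg I \<gamma> (\<lambda>x. ?M x * V x) = 0" by (simp add: avg_def)
  next
    fix f g assume fg: "tempered I f \<and> avg I \<gamma> (\<lambda>x. f x * V x) = 0" "tempered I g \<and> avg I \<gamma> (\<lambda>x. g x * V x) = 0"
    have "avg I \<gamma> (\<lambda>x. f x * V x + g x * V x) = avg I \<gamma> (\<lambda>x. f x * V x) + avg I \<gamma> (\<lambda>x. g x * V x)"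
      using fg \<gamma> by (intro avg_add finite_I tempered_mult tV) auto
    then show "tempered I (\<lambda>x. f x + g x) \<and> avg I \<gamma> (\<lambda>x. (f x + g x) * V x) = 0"
      using fg by (simp add: distrib_right tempered_add)
  qed
  then show ?case by (simp add: F_0)
next
  case (Suc j)
  obtain g' where g': "polyf I (d - 1) g'" "dunkl I \<gamma> a g g'"
    using polyf_dunkl[OF finite_I a_in_I Suc.prems(2)] by blast
  have j: "j < m" using Suc.prems by simp
  \<comment> \<open>Passing from \<open>F (Suc j)\<close> back to \<open>F j\<close> costs one
    factor \<open>x a\<close>: the degree rises by one while \<open>j\<close> drops by one, so the
    bound on \<open>d + j\<close> is preserved.\<close>
  have "avg I \<gamma> (\<lambda>x. x a * (g x * F j x)) = avg I \<gamma> (\<lambda>x. g' x * F j x) + avg I \<gamma> (\<lambda>x. g x * F (Suc j) x)"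
    using j by (intro avg_dunkl[OF finite_I a_in_I \<gamma> polyf_F dunkl_F tempered_F Suc.prems(2) g'(2)]
        polyf_tempered[OF g'(1) finite_I]) auto
  moreover have "avg I \<gamma> (\<lambda>x. (x a * g x) * F j x) = 0"
    by (rule Suc.IH[OF _ polyf_var_mult[OF a_in_I Suc.prems(2)]]) (use Suc.prems in auto)
  moreover have "avg I \<gamma> (\<lambda>x. g' x * F j x) = 0"
    by (rule Suc.IH[OF _ g'(1)]) (use Suc.prems in auto)
  ultimately show ?case by (simp add: mult.assoc)
qed

text \<open>One factor \<open>x a\<close> is traded for one more Dunkl operator on \<open>V\<close>.
  The operator also falls on the remaining polynomial, but lowers its degree so far that the result
  is orthogonal to \<open>F j\<close>.\<close>

lemma avg_descent:
  assumes \<gamma>: "1 \<le> \<gamma>" and j: "j < m"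
  shows "avg I \<gamma> (\<lambda>x. x a ^ (m - j) * vdm B x * F j x) = avg I \<gamma> (\<lambda>x. x a ^ (m - Suc j) * vdm B x * F (Suc j) x)"
proof -
  let ?g = "\<lambda>x. x a ^ (m - Suc j) * vdm B x" and ?d = "(m - Suc j) + (m choose 2)"
  have g: "polyf I ?d ?g" by (intro polyf_mult polyf_power polyf_vdm) auto
  obtain g' where g': "polyf I (?d - 1) g'" "dunkl I \<gamma> a ?g g'" "?d = 0 \<longrightarrow> g' = (\<lambda>_. 0)"
    using polyf_dunkl[OF finite_I a_in_I g, where \<gamma> = \<gamma>] by (elim exE conjE) (rule that)
  have "avg I \<gamma> (\<lambda>x. x a * (?g x * F j x)) = avg I \<gamma> (\<lambda>x. g' x * F j x) + avg I \<gamma> (\<lambda>x. ?g x * F (Suc j) x)"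
    using j by (intro avg_dunkl[OF finite_I a_in_I \<gamma> polyf_F dunkl_F tempered_F g g'(2)]
        polyf_tempered[OF g'(1) finite_I]) auto
  moreover have "avg I \<gamma> (\<lambda>x. g' x * F j x) = 0"
  proof (cases "?d = 0")
    case True
    then show ?thesis using g'(3) by (simp add: avg_def)
  next
    case False
    show ?thesis by (rule avg_orthogonal[OF \<gamma> _ g'(1)]) (use j False in auto)
  qed
  moreover have "x a ^ (m - j) = x a * x a ^ (m - Suc j)" for x :: "'i \<Rightarrow> real"
    using j by (metis Suc_diff_Suc power_Suc)
  ultimately show ?thesis by (simp add: mult.assoc)
qed

lemma avg_power_V:
  assumes \<gamma>: "1 \<le> \<gamma>"
  shows "avg I \<gamma> (\<lambda>x. x a ^ m * vdm B x * V x)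
    = (\<Prod>i=1..m. real i * (1 + \<gamma>) + \<gamma> * (card K + 1)) * avg I \<gamma> (\<lambda>x. (vdm B x)\<^sup>2)"
proof -
  have "j \<le> m \<Longrightarrow> avg I \<gamma> (\<lambda>x. x a ^ (m - j) * vdm B x * F j x) = avg I \<gamma> (\<lambda>x. x a ^ m * vdm B x * V x)" for j
    by (induction j) (auto simp: F_0 avg_descent[OF \<gamma>, symmetric])
  from this[OF order.refl] have "avg I \<gamma> (\<lambda>x. x a ^ m * vdm B x * V x)
      = avg I \<gamma> (\<lambda>x. (\<Prod>i=1..m. real i * (1 + \<gamma>) + \<gamma> * (card K + 1)) * (vdm B x)\<^sup>2)"
    by (simp add: F_m power2_eq_square mult_ac)
  then show ?thesis by (simp only: avg_cmult)
qed

text \<open>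
  By Lagrange interpolation of the \<open>m\<close>-th power, the square is a sum over the block of images of
  \<open>x a ^ m * vdm B x * V x\<close> under transpositions.
\<close>
lemma avg_vdm_square_expand:
  assumes \<gamma>: "1 \<le> \<gamma>"
  shows "avg I \<gamma> (\<lambda>x. (vdm (insert a B) x)\<^sup>2) = (real m + 1) * avg I \<gamma> (\<lambda>x. x a ^ m * vdm B x * V x)"
proof -
  let ?S = "insert a B"
  have finS: "finite ?S" by simp
  have "\<exists>\<sigma>. \<forall>x. vdm ?S x = \<sigma> * (\<Prod>j\<in>?S - {i}. x i - x j) * vdm (?S - {i}) x \<and> \<sigma> * \<sigma> = (1::real)" if "i \<in> ?S" for i
    using vdm_remove[OF finS that] by metis
  then obtain \<sigma> where \<sigma>: "\<And>i x. i \<in> ?S \<Longrightarrow> vdm ?S x = \<sigma> i * (\<Prod>j\<in>?S - {i}. x i - x j) * vdm (?S - {i}) x"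
    and \<sigma>2: "\<And>i. i \<in> ?S \<Longrightarrow> \<sigma> i * \<sigma> i = (1::real)" by metis
  \<comment> \<open>At distinct coordinates this is the square times the \<open>i\<close>-th term of
    \<open>sum_power_div_prod_diff\<close>; written without division it is a polynomial
    everywhere.\<close>
  define U where "U i x = x i ^ m * (vdm ?S x * (\<sigma> i * vdm (?S - {i}) x))" for i x
  have tU: "tempered I (U i)" if "i \<in> ?S" for i
    unfolding U_def[abs_def] using that
    by (intro tempered_mult tempered_power tempered_var tempered_const polyf_tempered[OF polyf_vdm] finite_I) auto
  have U: "U i x = x i ^ m / (\<Prod>j\<in>?S - {i}. x i - x j) * (vdm ?S x)\<^sup>2" if "inj_on x I" "i \<in> ?S" for i x
  proof -
    have "x i \<noteq> x j" if j: "j \<in> ?S - {i}" for j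
    proof -
      have "i \<in> I" "j \<in> I" "i \<noteq> j" using \<open>i \<in> ?S\<close> j by auto
      with \<open>inj_on x I\<close> show ?thesis by (metis inj_onD)
    qed
    then have "(\<Prod>j\<in>?S - {i}. x i - x j) \<noteq> 0" using finS by auto
    then have "\<sigma> i * vdm (?S - {i}) x = vdm ?S x / (\<Prod>j\<in>?S - {i}. x i - x j)"
      unfolding \<sigma>[OF \<open>i \<in> ?S\<close>] by simp
    then show ?thesis by (simp add: U_def power2_eq_square)
  qed
  have "avg I \<gamma> (\<lambda>x. (vdm ?S x)\<^sup>2) = avg I \<gamma> (\<lambda>x. \<Sum>i\<in>?S. U i x)"
  proof (rule avg_cong[OF finite_I])
    fix x :: "'i \<Rightarrow> real" assume inj: "inj_on x I"
    then have "inj_on x ?S" by (rule inj_on_subset) auto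
    then have "(\<Sum>i\<in>?S. x i ^ m / (\<Prod>j\<in>?S - {i}. x i - x j)) = 1"
      by (rule sum_power_div_prod_diff) simp
    then show "(vdm ?S x)\<^sup>2 = (\<Sum>i\<in>?S. U i x)"
      by (simp only: U[OF inj] sum_distrib_right[symmetric] cong: sum.cong)
  qed
  also have "\<dots> = (\<Sum>i\<in>?S. avg I \<gamma> (U i))"
    using \<gamma> by (intro avg_sum finite_I tU) auto
  also have "\<dots> = (\<Sum>i\<in>?S. avg I \<gamma> (U a))"
  proof (rule sum.cong[OF refl])
    fix i assume i: "i \<in> ?S"
    have "avg I \<gamma> (U i) = avg I \<gamma> (\<lambda>x. U i (x \<circ> transpose a i))"
      using \<gamma> i by (intro avg_transpose[symmetric] finite_I tU) auto
    also have "\<dots> = avg I \<gamma> (U a)"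
    proof (rule avg_cong[OF finite_I])
      fix x :: "'i \<Rightarrow> real" assume inj: "inj_on x I"
      have "i \<in> I" using i by auto
      then have "transpose a i ` I = I" using transpose_image_eq[where a = a and b = i and A = I] a_in_I by (simp only:)
      then have inj': "inj_on (x \<circ> transpose a i) I"
        using inj by (intro comp_inj_on) auto
      have "(\<Prod>j\<in>?S - {i}. (x \<circ> transpose a i) i - (x \<circ> transpose a i) j) = (\<Prod>j\<in>?S - {a}. x a - x j)"
      proof -
        have "transpose a i ` ?S = ?S" by (rule transpose_image_eq) (use i in simp)
        then have "bij_betw (transpose a i) (?S - {i}) (?S - {a})"
          unfolding bij_betw_def by (simp only: image_set_diff[OF inj_transpose] inj_on_transpose
              image_insert image_empty transpose_apply_second simp_thms)
        from prod.reindex_bij_betw[OF this, of "\<lambda>j. x a - x j"] show ?thesis by simp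
      qed
      moreover have "(vdm ?S (x \<circ> transpose a i))\<^sup>2 = (vdm ?S x)\<^sup>2"
        using vdm_transpose[OF finS _ i, of a x] by (cases "i = a") auto
      ultimately show "U i (x \<circ> transpose a i) = U a x"
        unfolding U[OF inj' i] U[OF inj insertI1] by simp
    qed
    finally show "avg I \<gamma> (U i) = avg I \<gamma> (U a)" .
  qed
  also have "\<dots> = (real m + 1) * avg I \<gamma> (U a)" by simp
  also have "U a = (\<lambda>x. x a ^ m * vdm B x * V x)"
  proof
    fix x
    have S: "?S - {a} = B" by auto
    have "vdm ?S x = \<sigma> a * V x" using \<sigma>[of a x] unfolding S V_def by (simp add: mult_ac)
    then have "U a x = (\<sigma> a * \<sigma> a) * (x a ^ m * vdm B x * V x)" unfolding U_def S by (simp add: mult_ac)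
    then show "U a x = x a ^ m * vdm B x * V x" using \<sigma>2[of a] by simp
  qed
  finally show ?thesis .
qed

theorem avg_vdm_square:
  assumes "1 \<le> \<gamma>"
  shows "avg I \<gamma> (\<lambda>x. (vdm (insert a B) x)\<^sup>2) = (real m + 1) *
    (\<Prod>i=1..m. real i * (1 + \<gamma>) + \<gamma> * (card K + 1)) * avg I \<gamma> (\<lambda>x. (vdm B x)\<^sup>2)"
  unfolding avg_vdm_square_expand[OF assms] avg_power_V[OF assms] by simp

end

section \<open>Mehta's integral\<close>

text \<open>The inner product is \<open>Gamma (j + (n\<^sub>0 + j) * z) / Gamma (1 + (n\<^sub>0 + j)
  * z)\<close>, in the polynomial form in which the recursion delivers it.\<close>

definition vdm_factor :: "nat \<Rightarrow> nat \<Rightarrow> 'a::field_char_0 \<Rightarrow> 'a" where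
  "vdm_factor n\<^sub>0 n\<^sub>1 z = (\<Prod>j=1..n\<^sub>1. of_nat j * (\<Prod>l=1..<j. of_nat l + of_nat (n\<^sub>0 + j) * z))"

text \<open>The closed form for Mehta's integral, polymorphic so that the real Bohr-Mollerup
  argument and the complex continuation can share it.\<close>

definition mehta :: "nat \<Rightarrow> 'a::Gamma \<Rightarrow> 'a" where
  "mehta n z = (\<Prod>j=1..n. Gamma (1 + of_nat j * z) / Gamma (1 + z))"

text \<open>Because \<open>n\<^sub>0 + Suc j = Suc n\<^sub>0 + j\<close>, the inner product at
  \<open>Suc j\<close> is the one at \<open>j\<close> for \<open>Suc n\<^sub>0\<close> with the
  single new factor \<open>l = j\<close>.\<close>

lemma vdm_factor_Suc:
  fixes z :: "'a::field_char_0"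
  shows "vdm_factor n\<^sub>0 (Suc m) z = of_nat (Suc m) * (\<Prod>i=1..m. of_nat i + of_nat (n\<^sub>0 + 1 + i) * z) * vdm_factor (Suc n\<^sub>0) m z"
proof -
  let ?t = "\<lambda>j. \<Prod>l=1..<j. of_nat l + of_nat (n\<^sub>0 + 1 + j) * z"
  let ?r = "\<lambda>j. of_nat j + of_nat (n\<^sub>0 + 1 + j) * z"
  have split: "(\<Prod>l=1..<Suc j. of_nat l + of_nat (n\<^sub>0 + Suc j) * z) = ?t j * ?r j" if "1 \<le> j" for j
    using that by (simp add: prod.atLeastLessThan_Suc add_ac)
  have fact: "(\<Prod>j=1..m. of_nat (Suc j)) = of_nat (Suc m) * (\<Prod>j=1..m. of_nat j :: 'a)"
    by (induction m) (auto simp: algebra_simps)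
  have "vdm_factor n\<^sub>0 (Suc m) z = (\<Prod>j=1..m. of_nat (Suc j) * (\<Prod>l=1..<Suc j. of_nat l + of_nat (n\<^sub>0 + Suc j) * z))"
  proof -
    have "(\<Prod>j=1..Suc m. f j) = f 1 * (\<Prod>j=1..m. f (Suc j))" for f :: "nat \<Rightarrow> 'a"
      by (induction m) (auto simp: mult_ac)
    then show ?thesis unfolding vdm_factor_def by (simp only:) simp
  qed
  also have "\<dots> = (\<Prod>j=1..m. of_nat (Suc j) * (?t j * ?r j))"
    by (rule prod.cong[OF refl]) (simp only: split atLeastAtMost_iff)
  also have "\<dots> = (\<Prod>j=1..m. of_nat (Suc j)) * (\<Prod>j=1..m. ?t j) * (\<Prod>j=1..m. ?r j)"
    by (simp only: prod.distrib mult.assoc)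
  also have "\<dots> = of_nat (Suc m) * (\<Prod>j=1..m. ?r j) * ((\<Prod>j=1..m. of_nat j) * (\<Prod>j=1..m. ?t j))"
    unfolding fact by (simp only: mult_ac)
  also have "(\<Prod>j=1..m. of_nat j) * (\<Prod>j=1..m. ?t j) = vdm_factor (Suc n\<^sub>0) m z"
    unfolding vdm_factor_def prod.distrib[symmetric] by simp
  finally show ?thesis .
qed

lemma gamma_arg_not_nonpos:
  fixes z :: complex
  assumes "0 < Re z" shows "z \<notin> \<int>\<^sub>\<le>\<^sub>0"
  using assms by (auto elim!: nonpos_Ints_cases)

text \<open>The argument \<open>1 + j * x\<close> grows by \<open>j\<close>, which gives a
  Pochhammer product. Its last factor \<open>j * (1 + x)\<close> supplies the outer \<open>j\<close>
  and cancels the growth of the denominator.\<close>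

lemma mehta_add_1:
  fixes x :: real
  assumes "0 \<le> x"
  shows "mehta n (x + 1) = vdm_factor 0 n x * mehta n x"
  unfolding mehta_def vdm_factor_def prod.distrib[symmetric]
proof (rule prod.cong[OF refl])
  fix j assume j: "j \<in> {1..n}"
  have pos: "0 < 1 + real j * x" using assms by (simp add: add_pos_nonneg)
  then have "1 + real j * x \<notin> \<int>\<^sub>\<le>\<^sub>0" by (auto elim!: nonpos_Ints_cases)
  then have "pochhammer (1 + real j * x) j = Gamma (1 + real j * x + real j) / Gamma (1 + real j * x)"
    by (rule pochhammer_Gamma)
  then have 1: "Gamma (1 + real j * (x + 1)) = pochhammer (1 + real j * x) j * Gamma (1 + real j * x)"
    using Gamma_real_pos[OF pos] by (simp add: algebra_simps)
  have "pochhammer (1 + real j * x) j = (\<Prod>l=1..<Suc j. real l + real j * x)"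
    unfolding pochhammer_prod atLeast0LessThan
    by (rule prod.reindex_bij_witness[of _ "\<lambda>l. l - 1" Suc]) auto
  also have "\<dots> = (\<Prod>l=1..<j. real l + real j * x) * (real j * (1 + x))"
    using j by (simp add: prod.atLeastLessThan_Suc algebra_simps)
  finally have 2: "pochhammer (1 + real j * x) j = (\<Prod>l=1..<j. real l + real j * x) * (real j * (1 + x))" .
  have 3: "Gamma (1 + (x + 1)) = (1 + x) * Gamma (1 + x)"
  proof -
    have "1 + x \<notin> \<int>\<^sub>\<le>\<^sub>0" using assms by (auto elim!: nonpos_Ints_cases)
    from Gamma_plus1[OF this] show ?thesis by (simp add: add_ac)
  qed
  have "Gamma (1 + x) > 0" by (rule Gamma_real_pos) (use assms in simp)
  then show "Gamma (1 + real j * (x + 1)) / Gamma (1 + (x + 1)) =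
     real j * (\<Prod>l=1..<j. real l + real (0 + j) * x) * (Gamma (1 + real j * x) / Gamma (1 + x))"
  proof -
    have "(p * (i * a)) * g / (a * h) = i * p * (g / h)" if "a \<noteq> 0" for p i a g h :: real
      using that by simp
    from this[of "1 + x"] show ?thesis unfolding 1 2 3 using assms by simp
  qed
qed

text \<open>Each step removes the first index of the block and counts it among the outside ones, so
  \<open>n\<^sub>0\<close> varies in the induction.\<close>

lemma avg_vdm_factor:
  assumes "1 \<le> \<gamma>"
  shows "n\<^sub>0 + n\<^sub>1 = n \<Longrightarrow> avg {1..n} \<gamma> (\<lambda>x. (vdm {n\<^sub>0 + 1..n} x)\<^sup>2)
    = vdm_factor n\<^sub>0 n\<^sub>1 \<gamma> * avg {1..n} \<gamma> (\<lambda>_. 1)"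
proof (induction n\<^sub>1 arbitrary: n\<^sub>0)
  case 0
  then show ?case by (simp add: vdm_factor_def vdm_def pair_prod_def)
next
  case (Suc m)
  let ?a = "n\<^sub>0 + 1"
  interpret dunkl_block ?a "{?a + 1..n}" "{1..n\<^sub>0}" \<gamma>
    by standard (use assms in auto)
  have I: "insert ?a ({?a + 1..n} \<union> {1..n\<^sub>0}) = {1..n}" "insert ?a {?a + 1..n} = {?a..n}"
    "card {?a + 1..n} = m" using Suc.prems by auto
  have "real i * (1 + \<gamma>) + \<gamma> * real (card {1..n\<^sub>0} + 1) = real i + real (n\<^sub>0 + 1 + i) * \<gamma>" for i
    by (simp add: algebra_simps)
  then have "avg {1..n} \<gamma> (\<lambda>x. (vdm {?a..n} x)\<^sup>2) = (real m + 1) *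
    (\<Prod>i=1..m. real i + real (n\<^sub>0 + 1 + i) * \<gamma>) * avg {1..n} \<gamma> (\<lambda>x. (vdm {?a + 1..n} x)\<^sup>2)"
    using avg_vdm_square[OF assms] unfolding I by (simp only:)
  also have "avg {1..n} \<gamma> (\<lambda>x. (vdm {?a + 1..n} x)\<^sup>2) = vdm_factor (Suc n\<^sub>0) m \<gamma> * avg {1..n} \<gamma> (\<lambda>_. 1)"
    using Suc.IH[of "Suc n\<^sub>0"] Suc.prems by simp
  finally show ?case unfolding vdm_factor_Suc by (simp add: mult.assoc add.commute)
qed

lemma wt_eq_vdm_powr: "finite S \<Longrightarrow> wt S \<gamma> x = ((vdm S x)\<^sup>2) powr \<gamma>"
proof -
  have *: "(\<Prod>p\<in>A. \<bar>f p\<bar> powr (2 * \<gamma>)) = ((\<Prod>p\<in>A. f p)\<^sup>2) powr \<gamma>" for A and f :: "'b \<Rightarrow> real"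
  proof (induction A rule: infinite_finite_induct)
    case (insert p A)
    have "\<bar>f p\<bar> powr (2 * \<gamma>) = ((f p)\<^sup>2) powr \<gamma>"
      by (cases "f p = 0") (auto simp: powr_powr[symmetric])
    then show ?case using insert by (simp add: power_mult_distrib powr_mult)
  qed auto
  show ?thesis
    unfolding wt_def vdm_def pair_prod_def case_prod_unfold by (rule *)
qed

lemma wt_add: "finite S \<Longrightarrow> wt S (\<gamma> + s) x = wt S \<gamma> x * ((vdm S x)\<^sup>2) powr s"
  by (simp add: wt_eq_vdm_powr powr_add)

section \<open>Functional equation, log-convexity and the Bohr-Mollerup argument\<close>

definition mehta_integral :: "nat \<Rightarrow> real \<Rightarrow> real" where
  "mehta_integral n \<gamma> = avg {1..n} \<gamma> (\<lambda>_. 1)"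

lemma mehta_integral_add_1:
  assumes "1 \<le> \<gamma>"
  shows "mehta_integral n (\<gamma> + 1) = vdm_factor 0 n \<gamma> * mehta_integral n \<gamma>"
proof -
  have "mehta_integral n (\<gamma> + 1) = avg {1..n} \<gamma> (\<lambda>x. (vdm {0 + 1..n} x)\<^sup>2)"
    unfolding mehta_integral_def avg_def by (simp add: wt_add mult.commute)
  also have "\<dots> = vdm_factor 0 n \<gamma> * mehta_integral n \<gamma>"
    unfolding mehta_integral_def by (rule avg_vdm_factor[OF assms]) simp
  finally show ?thesis .
qed

text \<open>The right side is the tangent at \<open>t = c\<close> of the concave function
  \<open>t powr s\<close>.\<close>

lemma powr_le_tangent:
  fixes t c s :: real
  assumes "0 \<le> t" "0 < c" "0 \<le> s" "s \<le> 1"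
  shows "t powr s \<le> c powr s * ((1 - s) + s * t / c)"
proof (cases "t = 0")
  case True
  then show ?thesis using assms by simp
next
  case False
  then have "1 powr (1 - s) * (t / c) powr s \<le> (1 - s) * 1 + s * (t / c)"
    using assms by (intro Youngs_inequality_0) auto
  then have "c powr s * (t / c) powr s \<le> c powr s * ((1 - s) + s * t / c)"
    by (intro mult_left_mono) auto
  then show ?thesis using assms by (simp add: powr_divide)
qed

text \<open>The tangent is taken at the weighted mean of the squared Vandermonde product, which is
  \<open>vdm_factor 0 n \<gamma>\<close> by the functional equation. At this point the linear bound
  integrates to exactly what Hoelder's inequality would give.\<close>

lemma mehta_integral_log_convex:
  assumes "1 \<le> \<gamma>" "0 \<le> s" "s \<le> 1"
  shows "mehta_integral n (\<gamma> + s) \<le> mehta_integral n \<gamma> * vdm_factor 0 n \<gamma> powr s"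
proof -
  let ?I = "{1..n}" and ?c = "vdm_factor 0 n \<gamma>"
  have c: "?c > 0" unfolding vdm_factor_def
    using assms by (intro prod_pos mult_pos_pos ballI) (auto intro!: add_pos_nonneg)
  let ?D = "\<lambda>x. (vdm ?I x)\<^sup>2"
  have int: "integrable (gauss_prod ?I) (\<lambda>x. wt ?I t x)" if "0 \<le> t" for t
    using that by (intro tempered_integrable wt_tempered) auto
  have "mehta_integral n (\<gamma> + s) = (\<integral>x. wt ?I (\<gamma> + s) x \<partial>gauss_prod ?I)"
    by (simp add: mehta_integral_def avg_def)
  also have "\<dots> \<le> (\<integral>x. ?c powr s * ((1 - s) * wt ?I \<gamma> x + s / ?c * wt ?I (\<gamma> + 1) x) \<partial>gauss_prod ?I)"
  proof (rule integral_mono)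
    fix x
    have "wt ?I (\<gamma> + s) x = wt ?I \<gamma> x * ?D x powr s" by (rule wt_add) simp
    also have "\<dots> \<le> wt ?I \<gamma> x * (?c powr s * ((1 - s) + s * ?D x / ?c))"
      using assms c by (intro mult_left_mono powr_le_tangent wt_nonneg) auto
    also have "\<dots> = ?c powr s * ((1 - s) * wt ?I \<gamma> x + s / ?c * wt ?I (\<gamma> + 1) x)"
    proof -
      have "wt ?I (\<gamma> + 1) x = wt ?I \<gamma> x * ?D x" using wt_add[of ?I \<gamma> 1 x] by simp
      then show ?thesis by (simp add: algebra_simps)
    qed
    finally show "wt ?I (\<gamma> + s) x \<le> ?c powr s * ((1 - s) * wt ?I \<gamma> x + s / ?c * wt ?I (\<gamma> + 1) x)" .
  qed (use assms int in auto)
  also have "\<dots> = ?c powr s * ((1 - s) * mehta_integral n \<gamma> + s / ?c * mehta_integral n (\<gamma> + 1))"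
    using int[of \<gamma>] int[of "\<gamma> + 1"] assms by (simp add: mehta_integral_def avg_def)
  also have "\<dots> = mehta_integral n \<gamma> * ?c powr s"
    unfolding mehta_integral_add_1[OF assms(1)] using c by (simp add: algebra_simps)
  finally show ?thesis .
qed

lemma mehta_pos:
  fixes x :: real
  assumes "0 \<le> x" shows "0 < mehta n x"
  unfolding mehta_def using assms
  by (intro prod_pos ballI divide_pos_pos Gamma_real_pos) (auto intro!: add_pos_nonneg)

lemma vdm_factor_pos:
  fixes x :: real
  assumes "0 \<le> x" shows "0 < vdm_factor n\<^sub>0 n x"
  unfolding vdm_factor_def
  using assms by (intro prod_pos mult_pos_pos ballI) (auto intro!: add_pos_nonneg)

text \<open>How far \<open>Gamma (1 + j * x)\<close> is from being log-linear between
  \<open>x\<close> and \<open>x + 1\<close>.\<close>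

definition gamma_quot :: "nat \<Rightarrow> real \<Rightarrow> real \<Rightarrow> real" where
  "gamma_quot j s x = Gamma (1 + real j * x) * (Gamma (1 + real j * (x + 1)) / Gamma (1 + real j * x)) powr s
     / Gamma (1 + real j * (x + s))"

lemma mehta_quot_eq:
  assumes "0 \<le> x" "0 \<le> s"
  shows "mehta n x * vdm_factor 0 n x powr s / mehta n (x + s) = (\<Prod>j=1..n. gamma_quot j s x / gamma_quot 1 s x)"
proof -
  have v: "vdm_factor 0 n x = mehta n (x + 1) / mehta n x"
    using mehta_add_1[OF assms(1), of n] mehta_pos[OF assms(1), of n] by simp
  have pos: "0 < Gamma (1 + real j * y)" if "0 \<le> y" for j y
    using that by (intro Gamma_real_pos add_pos_nonneg) auto
  define q where "q j = Gamma (1 + real j * (x + 1)) / Gamma (1 + real j * x)" for j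
  have q: "q j > 0" for j unfolding q_def using assms by (intro divide_pos_pos pos) auto
  have vq: "vdm_factor 0 n x = (\<Prod>j=1..n. q j / q 1)"
    unfolding v mehta_def q_def prod_dividef[symmetric] by (rule prod.cong) simp_all
  have "vdm_factor 0 n x powr s = (\<Prod>j=1..n. q j powr s / q 1 powr s)"
  proof -
    have "(\<Prod>j\<in>A. q j / q 1) powr s = (\<Prod>j\<in>A. q j powr s / q 1 powr s)" for A
      by (induction A rule: infinite_finite_induct)
        (use q in \<open>auto simp: powr_mult powr_divide less_imp_le prod_nonneg\<close>)
    then show ?thesis unfolding vq by simp
  qed
  then have "mehta n x * vdm_factor 0 n x powr s / mehta n (x + s)
    = (\<Prod>j=1..n. (Gamma (1 + real j * x) / Gamma (1 + x)) * (q j powr s / q 1 powr s) /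
        (Gamma (1 + real j * (x + s)) / Gamma (1 + (x + s))))"
    unfolding mehta_def prod.distrib prod_dividef by (simp only:)
  also have "\<dots> = (\<Prod>j=1..n. gamma_quot j s x / gamma_quot 1 s x)"
    by (rule prod.cong) (simp_all add: gamma_quot_def q_def mult_ac)
  finally show ?thesis .
qed

text \<open>By the limit formula behind \<open>Gamma_series'\<close>, \<open>Gamma (y + k)\<close>
  is \<open>fact (k - 1) * k powr y\<close> up to a factor tending to \<open>1\<close>. Along
  \<open>k = j * N\<close> the main terms cancel exactly, and only these factors remain.\<close>

lemma gamma_quot_tendsto:
  assumes "0 \<le> x" "0 \<le> s" "1 \<le> j"
  shows "(\<lambda>N. gamma_quot j s (x + real N)) \<longlonglongrightarrow> 1"
proof -
  define q where "q z k = Gamma_series' z k / Gamma z" for z :: real and k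
  define z where "z = 1 + real j * x"
  have z: "z > 0" using assms by (simp add: z_def add_pos_nonneg)
  have nz: "y \<notin> \<int>\<^sub>\<le>\<^sub>0" if "0 < y" for y :: real using that by (auto elim!: nonpos_Ints_cases)
  have lim: "(\<lambda>N. q y (j * N)) \<longlonglongrightarrow> 1" if "0 < y" for y
  proof -
    have "q y \<longlonglongrightarrow> Gamma y / Gamma y"
      unfolding q_def using Gamma_real_pos[OF that] by (intro tendsto_intros Gamma_series'_LIMSEQ) auto
    moreover have "filterlim (\<lambda>N. j * N) sequentially sequentially"
      using assms by (intro filterlim_subseq strict_monoI) auto
    ultimately show ?thesis
      using Gamma_real_pos[OF that] by (auto dest: filterlim_compose)
  qed
  have G: "Gamma (y + real k) = fact (k - 1) * real k powr y / q y k" "q y k > 0" if "0 < y" "0 < k" for y k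
  proof -
    have "pochhammer y k = Gamma (y + real k) / Gamma y" by (rule pochhammer_Gamma[OF nz[OF that(1)]])
    moreover have "Gamma y \<noteq> 0" using Gamma_real_pos[OF that(1)] by linarith
    ultimately have e: "q y k = fact (k - 1) * real k powr y / Gamma (y + real k)"
      using that by (simp add: q_def Gamma_series'_def powr_def)
    have p: "Gamma (y + real k) > 0" using that by (intro Gamma_real_pos) simp
    show "q y k > 0" unfolding e using p that by simp
    show "Gamma (y + real k) = fact (k - 1) * real k powr y / q y k" unfolding e using p that by simp
  qed
  have "((\<lambda>N. q (z + j * s) (j * N) / (q z (j * N) * (q (z + j) (j * N) / q z (j * N)) powr s))
      \<longlonglongrightarrow> 1 / (1 * (1 / 1) powr s))"
    using z assms by (intro tendsto_intros lim) (auto intro!: add_pos_nonneg)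
  moreover have "\<forall>\<^sub>F N in sequentially. q (z + j * s) (j * N) / (q z (j * N) * (q (z + j) (j * N) / q z (j * N)) powr s)
      = gamma_quot j s (x + real N)"
    using eventually_gt_at_top[of 0]
  proof eventually_elim
    case (elim N)
    define k where "k = j * N"
    have k: "0 < k" using elim assms by (simp add: k_def)
    define c where "c = (fact (k - 1) :: real)"
    have c: "c > 0" by (simp add: c_def)
    have zs: "0 < z + j * s" "0 < z + j" using z assms by (auto intro: add_pos_nonneg)
    have a1: "1 + real j * (x + real N) = z + real k" by (simp add: z_def k_def algebra_simps)
    have a2: "1 + real j * (x + real N + 1) = (z + j) + real k" by (simp add: z_def k_def algebra_simps)
    have a3: "1 + real j * (x + real N + s) = (z + j * s) + real k" by (simp add: z_def k_def algebra_simps)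
    let ?p = "real k powr z"
    have p: "?p > 0" using k by simp
    have r: "Gamma ((z + j) + real k) / Gamma (z + real k) = real k powr j * (q z k / q (z + j) k)"
      unfolding G(1)[OF zs(2) k] G(1)[OF z k] c_def[symmetric] powr_add
      using G(2)[OF zs(2) k] G(2)[OF z k] c p by (simp add: field_simps)
    have r': "(Gamma ((z + j) + real k) / Gamma (z + real k)) powr s
        = real k powr (j * s) * (q z k / q (z + j) k) powr s"
      unfolding r using G(2)[OF zs(2) k] G(2)[OF z k]
      by (subst powr_mult) (auto simp: powr_powr less_imp_le)
    have "gamma_quot j s (x + real N) = (c * ?p / q z k) * (real k powr (j * s) * (q z k / q (z + j) k) powr s)
        / (c * (?p * real k powr (j * s)) / q (z + j * s) k)"
      unfolding gamma_quot_def a1 a2 a3 r' unfolding G(1)[OF zs(1) k] G(1)[OF z k] c_def[symmetric] powr_add ..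
    also have "\<dots> = q (z + j * s) k / (q z k * (q (z + j) k / q z k) powr s)"
      using G(2)[OF zs(1) k] G(2)[OF z k] G(2)[OF zs(2) k] c p k
      by (simp add: powr_divide less_imp_le field_simps)
    finally show ?case by (simp add: k_def)
  qed
  ultimately show ?thesis using Lim_transform_eventually by fastforce
qed

text \<open>
  The quotient of the two sides is \<open>1\<close>-periodic, and log-convexity makes it nonincreasing, as in
  the Bohr--Mollerup theorem.
\<close>
lemma mehta_integral_eq_upto_const:
  assumes "1 \<le> \<gamma>"
  shows "mehta_integral n \<gamma> = mehta_integral n 1 / mehta n 1 * mehta n \<gamma>"
proof -
  define R where "R x = mehta_integral n x / mehta n x" for x :: real
  have per: "R (x + 1) = R x" if "1 \<le> x" for x
    using vdm_factor_pos[of x 0 n] that unfolding R_def mehta_integral_add_1[OF that]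
    by (subst mehta_add_1) auto
  have perN: "R (x + real N) = R x" if "1 \<le> x" for x N
  proof (induction N)
    case (Suc N)
    then show ?case using per[of "x + real N"] that by (simp add: add_ac)
  qed simp
  have mono: "R (x + s) \<le> R x" if x: "1 \<le> x" and s: "0 \<le> s" "s \<le> 1" for x s
  proof -
    \<comment> \<open>Log-convexity at \<open>x + N\<close> gives the inequality with the loss
      \<open>?L N\<close>; periodicity keeps both values of \<open>R\<close> fixed while the loss
      tends to \<open>1\<close>.\<close>
    let ?L = "\<lambda>N. \<Prod>j=1..n. gamma_quot j s (x + real N) / gamma_quot 1 s (x + real N)"
    have "?L \<longlonglongrightarrow> (\<Prod>j=1..n. 1 / 1)"
      using x s by (intro tendsto_prod tendsto_divide gamma_quot_tendsto) auto
    then have "(\<lambda>N. R x * ?L N) \<longlonglongrightarrow> R x * 1" by (intro tendsto_mult tendsto_const) simp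
    moreover have "R (x + s) \<le> R x * ?L N" for N
    proof -
      let ?y = "x + real N"
      have y: "1 \<le> ?y" using x by simp
      have "R (x + s) = R (?y + s)" using perN[of "x + s" N] x s by (simp add: add_ac)
      also have "\<dots> \<le> mehta_integral n ?y * vdm_factor 0 n ?y powr s / mehta n (?y + s)"
        unfolding R_def using x s mehta_pos[of "?y + s" n]
        by (intro divide_right_mono mehta_integral_log_convex) auto
      also have "\<dots> = R ?y * (mehta n ?y * vdm_factor 0 n ?y powr s / mehta n (?y + s))"
        unfolding R_def using mehta_pos[of ?y n] x by simp
      also have "\<dots> = R x * ?L N"
        unfolding perN[OF x] using x s by (subst mehta_quot_eq) auto
      finally show ?thesis .
    qed
    ultimately show ?thesis using LIMSEQ_le_const[of "\<lambda>N. R x * ?L N" "R x * 1"] by auto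
  qed
  \<comment> \<open>Monotonicity gives \<open>R 2 \<le> R (1 + s) \<le> R 1\<close>, and the two
    ends agree by periodicity.\<close>
  have const1: "R (1 + s) = R 1" if "0 \<le> s" "s \<le> 1" for s
    using mono[of 1 s] mono[of "1 + s" "1 - s"] per[of 1] that by simp
  define N where "N = nat \<lfloor>\<gamma> - 1\<rfloor>"
  define s where "s = \<gamma> - 1 - real N"
  have s: "0 \<le> s" "s \<le> 1" using assms by (auto simp: s_def N_def) linarith+
  have "R \<gamma> = R (1 + s + real N)" by (simp add: s_def)
  also have "\<dots> = R 1" using perN[of "1 + s" N] const1 s by simp
  finally show ?thesis using mehta_pos[of \<gamma> n] assms by (simp add: R_def field_simps)
qed

section \<open>The Gaussian measure as a product, and almost sure distinctness of
  coordinates\<close>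

interpretation lborel_prod: product_sigma_finite "\<lambda>_. lborel"
  by (simp add: product_sigma_finite_def sigma_finite_lborel)

text \<open>Product measures are determined by boxes; the normalizing constant is distributed evenly
  over the factors of the density.\<close>

lemma gaussian_measure_eq_gauss_prod: "gaussian_measure n = gauss_prod {1..n}"
  unfolding gauss_prod_def
proof (rule std_normal.PiM_eqI)
  let ?I = "{1..n}" and ?L = "\<Pi>\<^sub>M i\<in>{1..n}. (lborel :: real measure)"
  have s: "sets ?L = sets (\<Pi>\<^sub>M i\<in>?I. std_normal_measure)"
    by (intro sets_PiM_cong) auto
  then show "sets (gaussian_measure n) = sets (\<Pi>\<^sub>M i\<in>?I. std_normal_measure)"
    by (simp add: gaussian_measure_def)
  have weight: "(2 * pi) powr (- (real n / 2)) * (\<Prod>i=1..n. exp (- (x i)\<^sup>2 / 2)) = (\<Prod>i\<in>?I. std_normal_density (x i))"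
    for x :: "nat \<Rightarrow> real"
  proof -
    define r where "r = (2 * pi) powr (- (1 / 2))"
    have "r > 0" by (simp add: r_def)
    then have "(\<Prod>i=1..n. r) = r powr real n" by (simp add: powr_realpow)
    also have "\<dots> = (2 * pi) powr (- (real n / 2))" by (simp add: r_def powr_powr)
    finally have "(2 * pi) powr (- (real n / 2)) = (\<Prod>i=1..n. r)" ..
    moreover have "std_normal_density u = r * exp (- u\<^sup>2 / 2)" for u
      unfolding std_normal_density_def r_def by (simp add: powr_minus powr_half_sqrt inverse_eq_divide)
    ultimately show ?thesis by (simp only: prod.distrib)
  qed
  fix A :: "nat \<Rightarrow> real set" assume A: "\<And>i. i \<in> ?I \<Longrightarrow> A i \<in> sets std_normal_measure"
  have PiE: "Pi\<^sub>E ?I A \<in> sets ?L" unfolding s using A by (intro sets_PiM_I_finite) auto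
  have "emeasure (gaussian_measure n) (Pi\<^sub>E ?I A)
      = (\<integral>\<^sup>+x. ennreal (\<Prod>i\<in>?I. std_normal_density (x i)) * indicator (Pi\<^sub>E ?I A) x \<partial>?L)"
    unfolding gaussian_measure_def weight by (rule emeasure_density) (use PiE in auto)
  also have "\<dots> = (\<integral>\<^sup>+x. (\<Prod>i\<in>?I. ennreal (std_normal_density (x i)) * indicator (A i) (x i)) \<partial>?L)"
  proof (rule nn_integral_cong)
    fix x assume "x \<in> space ?L"
    then have x: "x \<in> extensional ?I" by (simp add: space_PiM PiE_def)
    have "indicator (Pi\<^sub>E ?I A) x = (\<Prod>i\<in>?I. indicator (A i) (x i) :: ennreal)"
    proof (cases "x \<in> Pi\<^sub>E ?I A")
      case True
      then have "x i \<in> A i" if "i \<in> ?I" for i using that by (rule PiE_mem)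
      then have "(\<Prod>i\<in>?I. indicator (A i) (x i) :: ennreal) = 1" by (intro prod.neutral) auto
      then show ?thesis using True by simp
    next
      case False
      then obtain i where "i \<in> ?I" "x i \<notin> A i" using x unfolding PiE_def Pi_def by blast
      then have "(\<Prod>i\<in>?I. indicator (A i) (x i) :: ennreal) = 0"
        by (intro prod_zero bexI[of _ i]) auto
      then show ?thesis using False by simp
    qed
    then show "ennreal (\<Prod>i\<in>?I. std_normal_density (x i)) * indicator (Pi\<^sub>E ?I A) x
        = (\<Prod>i\<in>?I. ennreal (std_normal_density (x i)) * indicator (A i) (x i))"
      by (simp add: prod.distrib prod_ennreal)
  qed
  also have "\<dots> = (\<Prod>i\<in>?I. \<integral>\<^sup>+u. ennreal (std_normal_density u) * indicator (A i) u \<partial>lborel)"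
    using A by (intro lborel_prod.product_nn_integral_prod) auto
  also have "\<dots> = (\<Prod>i\<in>?I. emeasure std_normal_measure (A i))"
    using A by (intro prod.cong refl) (simp add: std_normal_measure_def emeasure_density)
  finally show "emeasure (gaussian_measure n) (Pi\<^sub>E ?I A) = (\<Prod>i\<in>?I. emeasure std_normal_measure (A i))" .
qed simp

text \<open>With the other coordinates fixed, the exceptional values of \<open>x i\<close> form a
  single point, which is null for the normal law.\<close>

lemma AE_gauss_prod_neq:
  assumes "finite I" "i \<in> I" "j \<in> I" "i \<noteq> j"
  shows "AE x in gauss_prod I. x i \<noteq> x j"
proof -
  let ?f = "\<lambda>x :: 'a \<Rightarrow> real. indicator {0} (x i - x j) :: real"
  have m: "(\<lambda>x. x i - x j) \<in> borel_measurable (gauss_prod I)"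
    using assms by (intro borel_measurable_diff measurable_gauss_prod_component)
  have meas: "?f \<in> borel_measurable (gauss_prod I)"
    by (rule measurable_compose[OF m]) simp
  have t: "tempered I ?f"
    by (rule temperedI[where C = 1 and N = 0, OF meas]) (simp add: indicator_def)
  have "integral\<^sup>L (gauss_prod I) ?f = 0"
  proof (rule integral_gauss_prod_insert_zero[OF assms(1,2) t])
    fix x :: "'a \<Rightarrow> real"
    have "(\<integral>u. ?f (x(i := u)) \<partial>std_normal_measure) = (\<integral>u. indicator {x j} u \<partial>std_normal_measure)"
      using assms(4) by (intro Bochner_Integration.integral_cong) (auto simp: indicator_def)
    also have "\<dots> = measure std_normal_measure {x j}" by simp
    also have "\<dots> = 0"
    proof -
      have "emeasure std_normal_measure {x j} = 0"
        unfolding std_normal_measure_def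
        by (subst emeasure_density) (auto intro!: nn_integral_0_iff_AE[THEN iffD2] AE_I[where N = "{x j}"])
      then show ?thesis by (simp add: measure_def)
    qed
    finally show "(\<integral>u. ?f (x(i := u)) \<partial>std_normal_measure) = 0" .
  qed
  moreover have "integrable (gauss_prod I) ?f" by (rule tempered_integrable[OF assms(1) t])
  ultimately have "AE x in gauss_prod I. ?f x = 0"
    by (subst (asm) integral_nonneg_eq_0_iff_AE) auto
  then show ?thesis by eventually_elim (auto simp: indicator_def)
qed

text \<open>Off this null set the squared Vandermonde product has a genuine logarithm, so the weight
  can be written as an exponential.\<close>

lemma AE_vdm_nonzero:
  assumes "finite I"
  shows "AE x in gauss_prod I. vdm I x \<noteq> 0"
proof -
  have "AE x in gauss_prod I. \<forall>p\<in>{(i, j). i \<in> I \<and> j \<in> I \<and> i < j}. x (fst p) \<noteq> x (snd p)"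
  proof (rule AE_finite_allI)
    show "finite {(i, j). i \<in> I \<and> j \<in> I \<and> i < j}"
      by (rule finite_subset[of _ "I \<times> I"]) (use assms in auto)
  qed (use AE_gauss_prod_neq[OF assms] in auto)
  then show ?thesis
  proof eventually_elim
    case (elim x)
    then show ?case unfolding vdm_def pair_prod_def
      by (subst prod_zero_iff) (auto intro: finite_subset[of _ "I \<times> I"] simp: assms)
  qed
qed

section \<open>Extension to complex exponents\<close>

lemma exp_abs_le_sum: "exp \<bar>t\<bar> \<le> exp t + exp (- t :: real)"
  by (cases "t \<ge> 0") auto

lemma norm_exp_minus_one_le: "norm (exp w - 1) \<le> exp \<bar>Re w\<bar> * norm w"
  using Taylor_exp[of w 0] by simp

context
  fixes N :: "'a measure" and P L :: "'a \<Rightarrow> real"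
  assumes P [measurable]: "P \<in> borel_measurable N" and P_nonneg: "\<And>x. 0 \<le> P x"
    and L [measurable]: "L \<in> borel_measurable N"
    and int: "\<And>t. 0 \<le> t \<Longrightarrow> integrable N (\<lambda>x. P x * exp (t * L x))"
begin

text \<open>In the application \<open>L\<close> is the logarithm of the squared Vandermonde product
  and \<open>z\<close> the exponent of the weight. The abstract form separates the complex analysis
  from the polynomials.\<close>

definition exp_transform :: "complex \<Rightarrow> complex" where
  "exp_transform z = (\<integral>x. of_real (P x) * exp (z * of_real (L x)) \<partial>N)"

lemma exp_transform_integrable:
  assumes "0 \<le> Re z"
  shows "integrable N (\<lambda>x. of_real (P x) * exp (z * of_real (L x)))"
  by (rule Bochner_Integration.integrable_bound[OF int[OF assms]])
    (auto simp: norm_mult P_nonneg intro!: AE_I2)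

lemma exp_transform_of_real:
  "0 \<le> t \<Longrightarrow> exp_transform (of_real t) = of_real (\<integral>x. P x * exp (t * L x) \<partial>N)"
proof -
  have "of_real (P x) * exp (complex_of_real t * of_real (L x)) = complex_of_real (P x * exp (t * L x))" for x
    by (simp only: exp_of_real[symmetric] of_real_mult)
  then show ?thesis by (simp only: exp_transform_def integral_complex_of_real)
qed

text \<open>Integrability is available only for \<open>0 \<le> Re z\<close>, so the boundary is
  approached horizontally from the right. As \<open>L\<close> may have either sign, the dominating
  function adds the exponentials at both ends of the interval of exponents.\<close>

lemma exp_transform_right_continuous:
  assumes z: "0 \<le> Re z"
  shows "(\<lambda>k. exp_transform (z + of_real (inverse (real (Suc k))))) \<longlonglongrightarrow> exp_transform z"
  unfolding exp_transform_def
proof (rule integral_dominated_convergence)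
  let ?h = "\<lambda>k. inverse (real (Suc k))"
  show "integrable N (\<lambda>x. P x * exp (Re z * L x) + P x * exp ((Re z + 1) * L x))"
    using z by (intro Bochner_Integration.integrable_add int) auto
  have lim: "(\<lambda>k. z + complex_of_real (?h k)) \<longlonglongrightarrow> z + of_real 0"
    by (intro tendsto_intros LIMSEQ_inverse_real_of_nat)
  show "AE x in N. (\<lambda>k. of_real (P x) * exp ((z + of_real (?h k)) * of_real (L x)))
      \<longlonglongrightarrow> of_real (P x) * exp (z * of_real (L x))"
  proof (rule AE_I2)
    fix x
    have "(\<lambda>k. of_real (P x) * exp ((z + of_real (?h k)) * of_real (L x)))
      \<longlonglongrightarrow> of_real (P x) * exp ((z + of_real 0) * of_real (L x))"
      by (intro tendsto_mult tendsto_const tendsto_exp lim)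
    then show "(\<lambda>k. of_real (P x) * exp ((z + of_real (?h k)) * of_real (L x)))
      \<longlonglongrightarrow> of_real (P x) * exp (z * of_real (L x))" by simp
  qed
  show "AE x in N. norm (of_real (P x) * exp ((z + of_real (?h k)) * of_real (L x)))
     \<le> P x * exp (Re z * L x) + P x * exp ((Re z + 1) * L x)" for k
  proof (rule AE_I2)
    fix x
    define h where "h = ?h k"
    have h: "0 \<le> h" "h \<le> 1" by (auto simp: h_def divide_simps)
    have "exp ((Re z + h) * L x) \<le> exp (Re z * L x) + exp ((Re z + 1) * L x)"
    proof (cases "L x \<ge> 0")
      case True
      then have "(Re z + h) * L x \<le> (Re z + 1) * L x" using h by (intro mult_right_mono) auto
      then show ?thesis by (simp add: add_increasing)
    next
      case False
      then have "(Re z + h) * L x \<le> Re z * L x" using h by (intro mult_right_mono_neg) auto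
      then show ?thesis by (simp add: add_increasing2)
    qed
    from mult_left_mono[OF this P_nonneg[of x]]
    show "norm (of_real (P x) * exp ((z + of_real (?h k)) * of_real (L x)))
     \<le> P x * exp (Re z * L x) + P x * exp ((Re z + 1) * L x)"
      unfolding h_def[symmetric] by (simp add: norm_mult P_nonneg distrib_left)
  qed
qed auto

lemma exp_transform_holomorphic: "exp_transform holomorphic_on {z. 0 < Re z}"
proof (rule holomorphic_onI)
  fix z assume "z \<in> {z. 0 < Re z}"
  then have z: "0 < Re z" by simp
  \<comment> \<open>One share \<open>e\<close> bounds the distance of the increments from
    \<open>z\<close>, another absorbs the factor \<open>L x\<close> from the derivative. The extreme
    exponents are then \<open>0\<close> and \<open>4 * e\<close>, both within the range of
    integrability.\<close>
  define e where "e = Re z / 2"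
  have e: "e > 0" "Re z = 2 * e" using z by (auto simp: e_def)
  let ?g = "\<lambda>x. of_real (P x) * (of_real (L x) * exp (z * of_real (L x)))"
  have "(exp_transform has_field_derivative integral\<^sup>L N ?g) (at z)"
    unfolding has_field_derivative_iff tendsto_at_iff_sequentially o_def
  proof (intro allI impI)
    fix X :: "nat \<Rightarrow> complex" assume X: "\<forall>i. X i \<in> UNIV - {z}" "X \<longlonglongrightarrow> z"
    have "eventually (\<lambda>i. dist (X i) z < e) sequentially" using X(2) e(1) by (rule tendstoD)
    then obtain K where K: "\<And>i. K \<le> i \<Longrightarrow> dist (X i) z < e" by (auto simp: eventually_sequentially)
    define Y where "Y i = X (i + K)" for i
    have Y: "Y i \<noteq> z" "norm (Y i - z) < e" for i using X(1) K[of "i + K"] by (auto simp: Y_def dist_norm)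
    have Ylim: "Y \<longlonglongrightarrow> z" unfolding Y_def using X(2) by (rule LIMSEQ_ignore_initial_segment)
    have Yre: "0 \<le> Re (Y i)" for i
      using Y(2)[of i] abs_Re_le_cmod[of "Y i - z"] e by simp
    let ?s = "\<lambda>i x. of_real (P x) * ((exp (Y i * of_real (L x)) - exp (z * of_real (L x))) / (Y i - z))"
    have "(\<lambda>i. integral\<^sup>L N (?s i)) \<longlonglongrightarrow> integral\<^sup>L N ?g"
    proof (rule integral_dominated_convergence)
      show "integrable N (\<lambda>x. (1 / e) * (P x * exp (0 * L x) + P x * exp ((4 * e) * L x)))"
        using e by (intro integrable_mult_right Bochner_Integration.integrable_add int) auto
      show "AE x in N. (\<lambda>i. ?s i x) \<longlonglongrightarrow> ?g x"
      proof (rule AE_I2)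
        fix x
        have "((\<lambda>w. exp (w * of_real (L x))) has_field_derivative exp (z * of_real (L x)) * (1 * of_real (L x))) (at z)"
          by (rule DERIV_fun_exp) (auto intro!: derivative_eq_intros)
        then have "(\<lambda>i. (exp (Y i * of_real (L x)) - exp (z * of_real (L x))) / (Y i - z))
            \<longlonglongrightarrow> exp (z * of_real (L x)) * (1 * of_real (L x))"
          unfolding has_field_derivative_iff tendsto_at_iff_sequentially o_def using Y(1) Ylim by blast
        then have "(\<lambda>i. ?s i x) \<longlonglongrightarrow> of_real (P x) * (exp (z * of_real (L x)) * (1 * of_real (L x)))"
          by (rule tendsto_mult_left)
        then show "(\<lambda>i. ?s i x) \<longlonglongrightarrow> ?g x" by (simp add: mult_ac)
      qed
      show "AE x in N. norm (?s i x) \<le> (1 / e) * (P x * exp (0 * L x) + P x * exp ((4 * e) * L x))" for i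
      proof (rule AE_I2)
        fix x
        define h where "h = Y i - z"
        have h: "h \<noteq> 0" "norm h < e" using Y[of i] by (auto simp: h_def)
        have "exp (Y i * of_real (L x)) - exp (z * of_real (L x)) = exp (z * of_real (L x)) * (exp (h * of_real (L x)) - 1)"
          by (simp add: h_def algebra_simps exp_add[symmetric])
        then have "norm ((exp (Y i * of_real (L x)) - exp (z * of_real (L x))) / h)
            = exp (Re z * L x) * norm (exp (h * of_real (L x)) - 1) / norm h"
          by (simp add: norm_mult norm_divide)
        also have "\<dots> \<le> exp (Re z * L x) * (exp (e * \<bar>L x\<bar>) * (norm h * \<bar>L x\<bar>)) / norm h"
        proof (intro divide_right_mono mult_left_mono)
          have "\<bar>Re h\<bar> \<le> e" using abs_Re_le_cmod[of h] h by simp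
          then have "\<bar>Re (h * of_real (L x))\<bar> \<le> e * \<bar>L x\<bar>"
            by (simp add: abs_mult mult_right_mono)
          then have "exp \<bar>Re (h * of_real (L x))\<bar> * norm (h * of_real (L x)) \<le> exp (e * \<bar>L x\<bar>) * (norm h * \<bar>L x\<bar>)"
            by (intro mult_mono) (auto simp: norm_mult)
          with norm_exp_minus_one_le[of "h * of_real (L x)"]
          show "norm (exp (h * of_real (L x)) - 1) \<le> exp (e * \<bar>L x\<bar>) * (norm h * \<bar>L x\<bar>)" by linarith
        qed auto
        also have "\<dots> = (exp (2 * e * L x) * exp (e * \<bar>L x\<bar>)) * \<bar>L x\<bar>" using h e by simp
        also have "\<dots> \<le> (exp (2 * e * L x) * exp (e * \<bar>L x\<bar>)) * (exp (e * \<bar>L x\<bar>) / e)"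
        proof (rule mult_left_mono)
          have "e * \<bar>L x\<bar> \<le> exp (e * \<bar>L x\<bar>)" using exp_ge_add_one_self[of "e * \<bar>L x\<bar>"] by linarith
          then show "\<bar>L x\<bar> \<le> exp (e * \<bar>L x\<bar>) / e" using e by (simp add: field_simps)
        qed simp
        also have "\<dots> = (1 / e) * (exp (2 * e * L x) * exp \<bar>2 * e * L x\<bar>)"
          using e by (simp add: abs_mult exp_add[symmetric] field_simps)
        also have "\<dots> \<le> (1 / e) * (exp (2 * e * L x) * (exp (2 * e * L x) + exp (- (2 * e * L x))))"
          using e by (intro mult_left_mono exp_abs_le_sum) auto
        also have "\<dots> = (1 / e) * (exp (0 * L x) + exp ((4 * e) * L x))"
          by (simp add: distrib_left exp_add[symmetric])
        finally have "norm ((exp (Y i * of_real (L x)) - exp (z * of_real (L x))) / (Y i - z))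
            \<le> (1 / e) * (exp (0 * L x) + exp ((4 * e) * L x))" by (simp only: h_def)
        from mult_left_mono[OF this P_nonneg[of x]]
        have "norm (?s i x) \<le> P x * ((1 / e) * (exp (0 * L x) + exp ((4 * e) * L x)))"
          by (simp only: norm_mult norm_of_real abs_of_nonneg[OF P_nonneg])
        also have "\<dots> = (1 / e) * (P x * exp (0 * L x) + P x * exp ((4 * e) * L x))"
          by (simp only: distrib_left mult_ac)
        finally show "norm (?s i x) \<le> (1 / e) * (P x * exp (0 * L x) + P x * exp ((4 * e) * L x))" .
      qed
    qed auto
    moreover have "integral\<^sup>L N (?s i) = (exp_transform (Y i) - exp_transform z) / (Y i - z)" for i
    proof -
      have "integral\<^sup>L N (?s i) = (\<integral>x. (of_real (P x) * exp (Y i * of_real (L x)) - of_real (P x) * exp (z * of_real (L x))) / (Y i - z) \<partial>N)"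
        by (simp only: times_divide_eq_right right_diff_distrib)
      also have "\<dots> = (\<integral>x. of_real (P x) * exp (Y i * of_real (L x)) - of_real (P x) * exp (z * of_real (L x)) \<partial>N) / (Y i - z)"
        by (rule integral_divide_zero)
      also have "\<dots> = (exp_transform (Y i) - exp_transform z) / (Y i - z)"
        unfolding exp_transform_def using z Yre[of i]
        by (subst Bochner_Integration.integral_diff) (auto intro!: exp_transform_integrable)
      finally show ?thesis .
    qed
    ultimately have "(\<lambda>i. (exp_transform (Y i) - exp_transform z) / (Y i - z)) \<longlonglongrightarrow> integral\<^sup>L N ?g"
      by (simp only:)
    then show "(\<lambda>i. (exp_transform (X i) - exp_transform z) / (X i - z)) \<longlonglongrightarrow> integral\<^sup>L N ?g"
      unfolding Y_def by (rule LIMSEQ_offset)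
  qed
  then show "exp_transform field_differentiable at z within {z. 0 < Re z}"
    unfolding field_differentiable_def using has_field_derivative_at_within by blast
qed

lemma exp_transform_eqI:
  assumes h: "\<And>z. 0 \<le> Re z \<Longrightarrow> h field_differentiable at z"
    and eq: "\<And>t. 1 \<le> t \<Longrightarrow> exp_transform (of_real t) = h (of_real t)"
    and z: "0 \<le> Re z"
  shows "exp_transform z = h z"
proof -
  let ?S = "{z. 0 < Re z}"
  have pos: "exp_transform w = h w" if w: "0 < Re w" for w
  proof -
    have "exp_transform w - h w = 0"
    proof (rule analytic_continuation[where f = "\<lambda>w. exp_transform w - h w" and S = ?S and U = "complex_of_real ` {1..}" and \<xi> = 2])
      have "h holomorphic_on ?S"
        by (rule holomorphic_onI) (auto intro!: field_differentiable_at_within h)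
      then show "(\<lambda>w. exp_transform w - h w) holomorphic_on ?S"
        by (intro holomorphic_on_diff exp_transform_holomorphic)
      show "open ?S" by (rule open_halfspace_Re_gt)
      show "connected ?S" by (intro convex_connected convex_halfspace_Re_gt)
      show "2 islimpt complex_of_real ` {1..}"
        unfolding islimpt_sequential
      proof (intro exI conjI allI)
        let ?X = "\<lambda>k. complex_of_real (2 + inverse (real (Suc k)))"
        have "?X \<longlonglongrightarrow> of_real (2 + 0)"
          by (intro tendsto_of_real tendsto_add tendsto_const LIMSEQ_inverse_real_of_nat)
        then show "?X \<longlonglongrightarrow> 2" by simp
        have "inverse (real (Suc k)) \<noteq> 0" "0 \<le> inverse (real (Suc k))" for k by simp_all
        then show "?X k \<in> complex_of_real ` {1..} - {2}" for k
        proof -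
          have "2 + inverse (real (Suc k)) \<noteq> 2" by simp
          then have "?X k \<noteq> of_real 2" unfolding of_real_eq_iff .
          moreover have "?X k \<in> complex_of_real ` {1..}"
            by (intro imageI) (simp add: add_nonneg_nonneg)
          ultimately show ?thesis by simp
        qed
      qed
    qed (use w eq in auto)
    then show ?thesis by simp
  qed
  have lim: "(\<lambda>k. z + complex_of_real (inverse (real (Suc k)))) \<longlonglongrightarrow> z + of_real 0"
    by (intro tendsto_intros LIMSEQ_inverse_real_of_nat)
  have "isCont h z" using h[OF z] by (rule field_differentiable_imp_continuous_at)
  then have "(\<lambda>k. h (z + complex_of_real (inverse (real (Suc k))))) \<longlonglongrightarrow> h z"
    by (rule isCont_tendsto_compose) (use lim in \<open>simp only: of_real_0 add_0_right\<close>)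
  moreover have "h (z + complex_of_real (inverse (real (Suc k)))) = exp_transform (z + of_real (inverse (real (Suc k))))" for k
  proof (rule pos[symmetric])
    have "0 < inverse (real (Suc k))" by simp
    then show "0 < Re (z + complex_of_real (inverse (real (Suc k))))"
      using z unfolding plus_complex.sel Re_complex_of_real by linarith
  qed
  ultimately have "(\<lambda>k. exp_transform (z + of_real (inverse (real (Suc k))))) \<longlonglongrightarrow> h z" by (simp only:)
  with exp_transform_right_continuous[OF z] show ?thesis by (rule LIMSEQ_unique)
qed

end

section \<open>The closed forms, and identification of the integral\<close>

lemma field_differentiable_prod:
  fixes f :: "'i \<Rightarrow> complex \<Rightarrow> complex"
  shows "(\<And>i. i \<in> A \<Longrightarrow> f i field_differentiable at z) \<Longrightarrow> (\<lambda>w. \<Prod>i\<in>A. f i w) field_differentiable at z"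
  by (induction A rule: infinite_finite_induct) (auto intro: field_differentiable_mult field_differentiable_const)

lemma mehta_field_differentiable:
  assumes z: "0 \<le> Re z"
  shows "mehta n field_differentiable at z"
proof -
  have *: "(\<lambda>w. Gamma (1 + of_nat j * w)) field_differentiable at z" for j
  proof -
    have "0 < Re (1 + of_nat j * z)" using z by (simp add: add_pos_nonneg)
    then have "1 + of_nat j * z \<notin> \<int>\<^sub>\<le>\<^sub>0" by (rule gamma_arg_not_nonpos)
    then have "((\<lambda>w. Gamma (1 + of_nat j * w)) has_field_derivative
        Gamma (1 + of_nat j * z) * Digamma (1 + of_nat j * z) * of_nat j) (at z)"
      by (intro DERIV_chain2[OF has_field_derivative_Gamma]) (auto intro!: derivative_eq_intros)
    then show ?thesis unfolding field_differentiable_def by blast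
  qed
  have "Gamma (1 + z) \<noteq> 0"
    unfolding Gamma_eq_zero_iff by (rule gamma_arg_not_nonpos) (use z in simp)
  then show ?thesis
    unfolding mehta_def[abs_def] using *[of 1]
    by (intro field_differentiable_prod field_differentiable_divide *) simp_all
qed

lemma vdm_factor_field_differentiable: "vdm_factor n\<^sub>0 n\<^sub>1 field_differentiable at (z :: complex)"
  unfolding vdm_factor_def[abs_def]
  by (intro field_differentiable_prod field_differentiable_mult field_differentiable_add
      field_differentiable_const field_differentiable_ident)

lemma vdm_factor_of_real: "vdm_factor n\<^sub>0 n\<^sub>1 (complex_of_real t) = of_real (vdm_factor n\<^sub>0 n\<^sub>1 t)"
  unfolding vdm_factor_def by simp

lemma mehta_of_real: "mehta n (complex_of_real t) = of_real (mehta n t)"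
proof -
  have "Gamma (1 + of_nat j * complex_of_real t) = of_real (Gamma (1 + real j * t))" for j
    by (simp flip: Gamma_complex_of_real)
  from this this[of 1] show ?thesis unfolding mehta_def by simp
qed

text \<open>Where \<open>vdm I x\<close> vanishes the weight is zero but the exponential is not;
  these points form a null set, so the integrals agree, also for \<open>t = 0\<close>.\<close>

lemma vdm_transform:
  fixes I S :: "nat set"
  assumes I: "finite I" "S \<subseteq> I"
    and P_def: "P = (\<lambda>x. (vdm S x)\<^sup>2)" and L_def: "L = (\<lambda>x. ln ((vdm I x)\<^sup>2))" and t: "0 \<le> t"
  shows "P \<in> borel_measurable (gauss_prod I)" "L \<in> borel_measurable (gauss_prod I)"
    and "integrable (gauss_prod I) (\<lambda>x. P x * exp (t * L x))"
    and "(\<integral>x. P x * exp (t * L x) \<partial>gauss_prod I) = avg I t P"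
proof -
  have tv: "tempered I (vdm J)" if "J \<subseteq> I" for J
    using that I(1) by (intro polyf_tempered[OF polyf_vdm]) (auto intro: finite_subset)
  have tP: "tempered I P" unfolding P_def by (intro tempered_power tv I)
  show mP: "P \<in> borel_measurable (gauss_prod I)" by (rule tempered_measurable[OF tP])
  have "(\<lambda>x. (vdm I x)\<^sup>2) \<in> borel_measurable (gauss_prod I)"
    by (intro tempered_measurable tempered_power tv order.refl)
  then show mL: "L \<in> borel_measurable (gauss_prod I)" unfolding L_def by (rule borel_measurable_ln)
  have mw: "(\<lambda>x. P x * wt I t x) \<in> borel_measurable (gauss_prod I)"
    using t I by (intro tempered_measurable tempered_mult tP wt_tempered) auto
  have me: "(\<lambda>x. P x * exp (t * L x)) \<in> borel_measurable (gauss_prod I)"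
    using mP mL by (intro borel_measurable_times borel_measurable_exp[THEN measurable_compose[rotated]] borel_measurable_const) auto
  have ae: "AE x in gauss_prod I. P x * exp (t * L x) = P x * wt I t x"
    using AE_vdm_nonzero[OF I(1)]
  proof eventually_elim
    case (elim x)
    then show ?case by (simp add: wt_eq_vdm_powr[OF I(1)] L_def powr_def)
  qed
  have iw: "integrable (gauss_prod I) (\<lambda>x. P x * wt I t x)" by (rule avg_integrable[OF I(1) t tP])
  show "integrable (gauss_prod I) (\<lambda>x. P x * exp (t * L x))"
    using iw integrable_cong_AE[OF me mw ae] by blast
  show "(\<integral>x. P x * exp (t * L x) \<partial>gauss_prod I) = avg I t P"
    unfolding avg_def by (rule integral_cong_AE[OF me mw ae])
qed

text \<open>The formula with the unknown constant \<open>C\<close> is continued to the boundary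
  point \<open>0\<close>, where the transform is the total mass of a probability measure.\<close>

lemma mehta_integral_eq:
  assumes "1 \<le> t"
  shows "mehta_integral n t = mehta n t"
proof -
  let ?I = "{1..n}"
  define C where "C = mehta_integral n 1 / mehta n 1"
  \<comment> \<open>An empty block: \<open>P\<close> is constantly \<open>1\<close>, which makes
    Mehta's integral an instance of \<open>vdm_transform\<close>.\<close>
  define P :: "(nat \<Rightarrow> real) \<Rightarrow> real" where "P = (\<lambda>x. (vdm {} x)\<^sup>2)"
  define L where "L = (\<lambda>x. ln ((vdm ?I x)\<^sup>2))"
  have P1: "P x = 1" for x by (simp add: P_def vdm_def pair_prod_def)
  note vt = vdm_transform[OF finite_atLeastAtMost empty_subsetI P_def L_def]
  have "exp_transform (gauss_prod ?I) P L 0 = of_real C * mehta n 0"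
  proof (rule exp_transform_eqI)
    show "P \<in> borel_measurable (gauss_prod ?I)" "L \<in> borel_measurable (gauss_prod ?I)"
      using vt(1,2)[of 0] by simp_all
    show "integrable (gauss_prod ?I) (\<lambda>x. P x * exp (t * L x))" if "0 \<le> t" for t by (rule vt(3)[OF that])
    show "(\<lambda>z. complex_of_real C * mehta n z) field_differentiable at z" if "0 \<le> Re z" for z
      by (intro field_differentiable_mult field_differentiable_const mehta_field_differentiable that)
    show "exp_transform (gauss_prod ?I) P L (of_real t) = of_real C * mehta n (of_real t)" if "1 \<le> t" for t
    proof -
      have "avg ?I t P = mehta_integral n t" unfolding mehta_integral_def using P1 by (simp add: avg_def)
      also have "\<dots> = C * mehta n t"
        unfolding C_def by (rule mehta_integral_eq_upto_const[OF that])
      finally have "(\<integral>x. P x * exp (t * L x) \<partial>gauss_prod ?I) = C * mehta n t"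
        using vt(4)[of t] that by simp
      moreover have "exp_transform (gauss_prod ?I) P L (of_real t) = of_real (\<integral>x. P x * exp (t * L x) \<partial>gauss_prod ?I)"
        by (rule exp_transform_of_real) (use vt(1,2)[of 0] vt(3) that P1 in auto)
      ultimately show ?thesis by (simp add: mehta_of_real)
    qed
  qed (simp_all add: P1)
  moreover have "exp_transform (gauss_prod ?I) P L 0 = 1"
  proof -
    have "exp_transform (gauss_prod ?I) P L (of_real 0) = of_real (\<integral>x. P x * exp (0 * L x) \<partial>gauss_prod ?I)"
      by (rule exp_transform_of_real) (use vt(1,2)[of 0] vt(3) P1 in auto)
    also have "(\<integral>x. P x * exp (0 * L x) \<partial>gauss_prod ?I) = 1"
      using prob_space.prob_space[OF prob_space_gauss_prod, of ?I] by (simp add: P1)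
    finally show ?thesis by simp
  qed
  moreover have "mehta n (0 :: complex) = 1" by (simp add: mehta_def)
  ultimately have "C = 1" by simp
  then show ?thesis using mehta_integral_eq_upto_const[OF assms, of n] by (simp add: C_def)
qed

text \<open>The inner product of \<open>vdm_factor\<close> raises the Gamma argument of factor
  \<open>n\<^sub>0 + j\<close> from \<open>1 + (n\<^sub>0 + j) * z\<close> to
  \<open>j + (n\<^sub>0 + j) * z\<close>; the factor \<open>1 + z\<close> makes up for the
  denominator \<open>Gamma (2 + z)\<close>.\<close>

lemma vdm_factor_mult_mehta:
  fixes z :: complex
  assumes z: "0 \<le> Re z"
  shows "vdm_factor n\<^sub>0 n\<^sub>1 z * mehta (n\<^sub>0 + n\<^sub>1) z =
    (\<Prod>i=1..n\<^sub>0. Gamma (1 + of_nat i * z) / Gamma (1 + z)) *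
    (\<Prod>j=1..n\<^sub>1. of_nat j * (1 + z) * Gamma (of_nat j + of_nat (n\<^sub>0 + j) * z) / Gamma (2 + z))"
proof -
  have nz: "1 + z \<noteq> 0" using z by (auto simp: complex_eq_iff)
  have "1 + z \<notin> \<int>\<^sub>\<le>\<^sub>0" by (rule gamma_arg_not_nonpos) (use z in simp)
  from Gamma_plus1[OF this] have G2: "Gamma (2 + z) = (1 + z) * Gamma (1 + z)" by (simp add: add_ac)
  have factor: "of_nat j * (\<Prod>l=1..<j. of_nat l + of_nat (n\<^sub>0 + j) * z) * (Gamma (1 + of_nat (n\<^sub>0 + j) * z) / Gamma (1 + z))
    = of_nat j * (1 + z) * Gamma (of_nat j + of_nat (n\<^sub>0 + j) * z) / Gamma (2 + z)" if j: "1 \<le> j" for j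
  proof -
    let ?w = "1 + of_nat (n\<^sub>0 + j) * z"
    have "0 < Re ?w" using z by (simp add: add_pos_nonneg)
    then have w: "?w \<notin> \<int>\<^sub>\<le>\<^sub>0" by (rule gamma_arg_not_nonpos)
    then have "Gamma ?w \<noteq> 0" by (simp add: Gamma_eq_zero_iff)
    then have "pochhammer ?w (j - 1) * Gamma ?w = Gamma (?w + of_nat (j - 1))"
      unfolding pochhammer_Gamma[OF w] by simp
    also have "?w + of_nat (j - 1) = of_nat j + of_nat (n\<^sub>0 + j) * z"
      using j by (simp add: of_nat_diff algebra_simps)
    also have "pochhammer ?w (j - 1) = (\<Prod>l=1..<j. of_nat l + of_nat (n\<^sub>0 + j) * z)"
      unfolding pochhammer_prod atLeast0LessThan
      by (rule prod.reindex_bij_witness[of _ "\<lambda>l. l - 1" Suc]) (use j in \<open>auto simp: algebra_simps\<close>)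
    finally show ?thesis unfolding G2 using nz by (simp add: mult.assoc)
  qed
  have "mehta (n\<^sub>0 + n\<^sub>1) z = (\<Prod>i=1..n\<^sub>0. Gamma (1 + of_nat i * z) / Gamma (1 + z)) *
      (\<Prod>j=1..n\<^sub>1. Gamma (1 + of_nat (n\<^sub>0 + j) * z) / Gamma (1 + z))"
    unfolding mehta_def by (induction n\<^sub>1) (simp_all add: mult.assoc del: of_nat_Suc of_nat_add)
  then have "vdm_factor n\<^sub>0 n\<^sub>1 z * mehta (n\<^sub>0 + n\<^sub>1) z = (\<Prod>i=1..n\<^sub>0. Gamma (1 + of_nat i * z) / Gamma (1 + z)) *
    (\<Prod>j=1..n\<^sub>1. of_nat j * (\<Prod>l=1..<j. of_nat l + of_nat (n\<^sub>0 + j) * z) * (Gamma (1 + of_nat (n\<^sub>0 + j) * z) / Gamma (1 + z)))"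
    unfolding vdm_factor_def prod.distrib by (simp only: mult_ac)
  also have "(\<Prod>j=1..n\<^sub>1. of_nat j * (\<Prod>l=1..<j. of_nat l + of_nat (n\<^sub>0 + j) * z) * (Gamma (1 + of_nat (n\<^sub>0 + j) * z) / Gamma (1 + z)))
    = (\<Prod>j=1..n\<^sub>1. of_nat j * (1 + z) * Gamma (of_nat j + of_nat (n\<^sub>0 + j) * z) / Gamma (2 + z))"
    by (rule prod.cong[OF refl]) (simp only: factor atLeastAtMost_iff)
  finally show ?thesis .
qed

text \<open>All bases are positive reals, so the principal logarithms are real and add up without
  branch ambiguity.\<close>

lemma pair_prod_powr_eq:
  assumes "finite I" "vdm I x \<noteq> 0"
  shows "pair_prod I (\<lambda>i j. complex_of_real \<bar>x i - x j\<bar> powr (2 * z)) = exp (z * of_real (ln ((vdm I x)\<^sup>2)))"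
proof -
  have *: "(\<Prod>p\<in>A. complex_of_real \<bar>f p\<bar> powr (2 * z)) = exp (z * of_real (ln ((\<Prod>p\<in>A. f p)\<^sup>2)))"
    if "finite A" "(\<Prod>p\<in>A. f p) \<noteq> 0" for A and f :: "'b \<Rightarrow> real"
    using that
  proof (induction A rule: finite_induct)
    case (insert p A)
    then have nz: "f p \<noteq> 0" "(\<Prod>p\<in>A. f p) \<noteq> 0" by auto
    have "complex_of_real \<bar>f p\<bar> powr (2 * z) = exp (z * of_real (ln ((f p)\<^sup>2)))"
    proof -
      have "ln ((f p)\<^sup>2) = 2 * ln \<bar>f p\<bar>" using ln_realpow[of "\<bar>f p\<bar>" 2] nz by simp
      then show ?thesis using nz by (simp add: powr_def Ln_of_real mult_ac)
    qed
    moreover have "ln ((f p * (\<Prod>p\<in>A. f p))\<^sup>2) = ln ((f p)\<^sup>2) + ln ((\<Prod>p\<in>A. f p)\<^sup>2)"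
      using nz by (simp add: power_mult_distrib ln_mult)
    ultimately show ?case using insert nz by (simp add: distrib_left exp_add)
  qed simp
  have fin: "finite {(i, j). i \<in> I \<and> j \<in> I \<and> i < j}"
    by (rule finite_subset[of _ "I \<times> I"]) (use assms in auto)
  show ?thesis
    using *[OF fin, of "\<lambda>p. x (fst p) - x (snd p)"] assms
    unfolding vdm_def pair_prod_def case_prod_unfold by simp
qed

theorem corollary7p7:
  fixes n n\<^sub>0 n\<^sub>1 :: nat and \<gamma> :: complex
  assumes "n = n\<^sub>0 + n\<^sub>1" and "n\<^sub>1 \<ge> 2" and "Re \<gamma> \<ge> 0"
  shows "has_bochner_integral (gaussian_measure n)
    (\<lambda>x. (\<Prod>(i, j)\<in>{(i, j). n\<^sub>0 + 1 \<le> i \<and> i < j \<and> j \<le> n}. complex_of_real ((x i - x j)\<^sup>2)) *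
         (\<Prod>(i, j)\<in>{(i, j). 1 \<le> i \<and> i < j \<and> j \<le> n}. complex_of_real \<bar>x i - x j\<bar> powr (2 * \<gamma>)))
    ((\<Prod>i=1..n\<^sub>0. Gamma (1 + of_nat i * \<gamma>) / Gamma (1 + \<gamma>)) *
     (\<Prod>j=1..n\<^sub>1. of_nat j * (1 + \<gamma>) * Gamma (of_nat j + of_nat (n\<^sub>0 + j) * \<gamma>) / Gamma (2 + \<gamma>)))"
proof -
  let ?I = "{1..n}" and ?S = "{n\<^sub>0 + 1..n}"
  define P where "P = (\<lambda>x. (vdm ?S x)\<^sup>2)"
  define L where "L = (\<lambda>x. ln ((vdm ?I x)\<^sup>2))"
  have S: "?S \<subseteq> ?I" by auto
  note vt = vdm_transform[OF finite_atLeastAtMost S P_def L_def]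
  have P0: "0 \<le> P x" for x by (simp add: P_def)
  have val: "exp_transform (gauss_prod ?I) P L \<gamma> = vdm_factor n\<^sub>0 n\<^sub>1 \<gamma> * mehta n \<gamma>"
  proof (rule exp_transform_eqI)
    show "P \<in> borel_measurable (gauss_prod ?I)" "L \<in> borel_measurable (gauss_prod ?I)"
      using vt(1,2)[of 0] by simp_all
    show "integrable (gauss_prod ?I) (\<lambda>x. P x * exp (t * L x))" if "0 \<le> t" for t by (rule vt(3)[OF that])
    show "(\<lambda>z. vdm_factor n\<^sub>0 n\<^sub>1 z * mehta n z) field_differentiable at z" if "0 \<le> Re z" for z
      by (intro field_differentiable_mult vdm_factor_field_differentiable mehta_field_differentiable that)
    show "exp_transform (gauss_prod ?I) P L (of_real t) = vdm_factor n\<^sub>0 n\<^sub>1 (of_real t) * mehta n (of_real t)"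
      if "1 \<le> t" for t
    proof -
      have "(\<integral>x. P x * exp (t * L x) \<partial>gauss_prod ?I) = vdm_factor n\<^sub>0 n\<^sub>1 t * mehta n t"
        using vt(4)[of t] avg_vdm_factor[OF that assms(1)[symmetric]] mehta_integral_eq[OF that, of n] that
        by (simp add: P_def mehta_integral_def)
      moreover have "exp_transform (gauss_prod ?I) P L (of_real t) = of_real (\<integral>x. P x * exp (t * L x) \<partial>gauss_prod ?I)"
        by (rule exp_transform_of_real) (use vt(1,2)[of 0] vt(3) that P0 in auto)
      ultimately show ?thesis by (simp add: mehta_of_real vdm_factor_of_real)
    qed
  qed (use assms P0 in auto)
  let ?f = "\<lambda>x. (\<Prod>(i, j)\<in>{(i, j). n\<^sub>0 + 1 \<le> i \<and> i < j \<and> j \<le> n}. complex_of_real ((x i - x j)\<^sup>2)) *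
         (\<Prod>(i, j)\<in>{(i, j). 1 \<le> i \<and> i < j \<and> j \<le> n}. complex_of_real \<bar>x i - x j\<bar> powr (2 * \<gamma>))"
  let ?g = "\<lambda>x. of_real (P x) * exp (\<gamma> * of_real (L x))"
  have pairs: "{(i, j). a \<le> i \<and> i < j \<and> j \<le> n} = {(i, j). i \<in> {a..n} \<and> j \<in> {a..n} \<and> i < j}" for a by auto
  have f1: "(\<Prod>(i, j)\<in>{(i, j). n\<^sub>0 + 1 \<le> i \<and> i < j \<and> j \<le> n}. complex_of_real ((x i - x j)\<^sup>2)) = of_real (P x)" for x
    unfolding pairs P_def vdm_def pair_prod_def by (simp add: prod_power_distrib case_prod_unfold)
  have f2: "(\<Prod>(i, j)\<in>{(i, j). 1 \<le> i \<and> i < j \<and> j \<le> n}. complex_of_real \<bar>x i - x j\<bar> powr (2 * \<gamma>))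
      = pair_prod ?I (\<lambda>i j. complex_of_real \<bar>x i - x j\<bar> powr (2 * \<gamma>))" for x
    unfolding pairs pair_prod_def ..
  have g: "has_bochner_integral (gauss_prod ?I) ?g (vdm_factor n\<^sub>0 n\<^sub>1 \<gamma> * mehta n \<gamma>)"
    unfolding has_bochner_integral_iff
  proof
    show "integrable (gauss_prod ?I) ?g"
      by (rule exp_transform_integrable) (use vt(1,2)[of 0] vt(3) P0 assms in auto)
    show "integral\<^sup>L (gauss_prod ?I) ?g = vdm_factor n\<^sub>0 n\<^sub>1 \<gamma> * mehta n \<gamma>"
      using val by (subst (asm) exp_transform_def) (use vt(1,2)[of 0] vt(3) P0 in auto)
  qed
  have ae: "AE x in gauss_prod ?I. ?f x = ?g x"
    using AE_vdm_nonzero[OF finite_atLeastAtMost]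
  proof eventually_elim
    case (elim x)
    then show ?case unfolding f1 f2 L_def by (subst pair_prod_powr_eq) auto
  qed
  have mf: "?f \<in> borel_measurable (gauss_prod ?I)"
  proof -
    \<comment> \<open>Complex \<open>powr\<close> with base zero is zero by definition; splitting
      this case off leaves the real logarithm, whose measurability is known.\<close>
    have "(\<lambda>u. complex_of_real \<bar>u\<bar> powr (2 * \<gamma>)) = (\<lambda>u. if u = 0 then 0 else exp (2 * \<gamma> * of_real (ln \<bar>u\<bar>)))"
      by (auto simp: fun_eq_iff powr_def Ln_of_real)
    also have "\<dots> \<in> borel_measurable borel" by measurable
    finally have h: "(\<lambda>u. complex_of_real \<bar>u\<bar> powr (2 * \<gamma>)) \<in> borel_measurable borel" .
    have "(\<lambda>x. \<Prod>p\<in>{(i, j). i \<in> ?I \<and> j \<in> ?I \<and> i < j}. complex_of_real \<bar>x (fst p) - x (snd p)\<bar> powr (2 * \<gamma>))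
        \<in> borel_measurable (gauss_prod ?I)"
      by (intro borel_measurable_prod measurable_compose[OF _ h] borel_measurable_diff measurable_gauss_prod_component) auto
    moreover have "(\<lambda>x. complex_of_real (P x)) \<in> borel_measurable (gauss_prod ?I)"
      using vt(1)[of 0] by (intro measurable_compose[OF _ borel_measurable_of_real]) auto
    ultimately show ?thesis
      unfolding f1 f2 unfolding pair_prod_def case_prod_unfold by (intro borel_measurable_times)
  qed
  have "has_bochner_integral (gauss_prod ?I) ?f (vdm_factor n\<^sub>0 n\<^sub>1 \<gamma> * mehta n \<gamma>)"
    using g has_bochner_integral_cong_AE[OF mf borel_measurable_has_bochner_integral[OF g] ae] by blast
  then show ?thesis
    unfolding gaussian_measure_eq_gauss_prod assms(1) vdm_factor_mult_mehta[OF assms(3)] .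
qed

end
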